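(* Let $A$ be a compact metric space, let $(I,\mathcal{I},\lambda)$ be an atomless probability space, and let $G\colon (I,\mathcal{I},\lambda)\to \mathcal{C}_A\times\mathcal{U}_A$, $G(i)=(\mathcal{A}(i),u_i)$, be a large game. Suppose that at least one of the following conditions holds: (1) $G$ is countable-valued, i.e. $A$ is at most countable and the range of the action correspondence $\mathcal{A}\colon I\to\mathcal{C}_A$ is at most countable; (2) $\mathcal{I}$ is nowhere equivalent to $\sigma(G)$, the $\sigma$-algebra on $I$ generated by $G$. Then $G$ has the pure closed graph property, that is, the following holds. Let $\{(I^n,\mathcal{I}^n,\lambda^n)\}_{n\in\mathbb{Z}_+}$ be any sequence of finite probability spaces with $|I^n|=n$, $\mathcal{I}^n$ the power set of $I^n$, and $\sup_{i\in I^n}\lambda^n(i)\to 0$. For each $n$ let $G^n\colon I^n\to\mathcal{C}_A\times\mathcal{U}_A$ be a finite-player game such that $\{\lambda^n (G^n)^{-1}\}_{n\in\mathbb{Z}_+}$ converges weakly to $\lambda G^{-1}$, and let $g^n$ be a (randomized strategy) Nash equilibrium of $G^n$ such that the sequence of societal summaries $\{s(g^n)\}_{n\in\mathbb{Z}_+}$ converges weakly to some $\tau\in\mathcal{M}(A)$. Then there exists a pure strategy Nash equilibrium $f$ of $G$ such that $s(f)=\lambda f^{-1}=\tau$.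
   Context: Probability spaces are complete and countably additive. $A$ is a compact metric space (common action space) with Borel $\sigma$-algebra $\mathcal{B}(A)$. $\mathcal{M}(A)$ is the set of Borel probability measures on $A$ with the topology of weak convergence. $\mathcal{C}_A$ is the set of nonempty compact subsets of $A$ with the Hausdorff metric. $\mathcal{U}_A$ is the space of bounded continuous real functions on $A\times\mathcal{M}(A)$ with the sup norm. $\mathcal{C}_A\times\mathcal{U}_A$ has the product topology and its Borel $\sigma$-algebra. Large game: a measurable map $G\colon(I,\mathcal{I},\lambda)\to\mathcal{C}_A\times\mathcal{U}_A$, where $(I,\mathcal{I},\lambda)$ is an atomless probability space; write $G(i)=(A_i,u_i)$ with $A_i=\mathcal{A}(i)$, where $A_i$ is player $i$'s feasible action set and $u_i$ her payoff function. $\sigma(G)$ is the smallest $\sigma$-algebra on $I$ making $G$ measurable. A pure strategy profile is a measurable $f\colon I\to A$ with $f(i)\in A_i$ for $\lambda$-almost all $i$; its societal summary is $s(f)=\lambda f^{-1}$. It is a pure strategy Nash equilibrium if for $\lambda$-almost all $i\in I$, $u_i(f(i),\lambda f^{-1})\ge u_i(a,\lambda f^{-1})$ for all $a\in A_i$. Nowhere equivalence: for a sub-$\sigma$-algebra $\mathcal{F}\subseteq\mathcal{I}$, $\mathcal{I}$ is nowhere equivalent to $\mathcal{F}$ if for every $D\in\mathcal{I}$ with $\lambda(D)>0$ there is an $\mathcal{I}$-measurable subset $D_0\subseteq D$ such that $\lambda(D_0\triangle D_1)>0$ for every $D_1\in\mathcal{F}^D=\{D\cap D' : D'\in\mathcal{F}\}$,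 where $\triangle$ is symmetric difference. Finite-player game: a map $G^n\colon I^n\to\mathcal{C}_A\times\mathcal{U}_A$, $G^n(i)=(A_i^n,u_i^n)$, on a finite probability space $(I^n,\mathcal{I}^n,\lambda^n)$ with $|I^n|=n$ and $\mathcal{I}^n$ the power set. A randomized strategy profile of $G^n$ is a map $g^n\colon I^n\to\mathcal{M}(A)$ with $g^n(i,A_i^n)=1$ for all $i\in I^n$ (where $g^n(i,B)=g^n(i)(B)$). Player $i$'s expected payoff is $$u_i^n(g^n)=\int_{\prod_{j\in I^n}A_j^n}u_i^n\Bigl(a_i,\sum_{j\in I^n}\lambda^n(j)\delta_{a_j}\Bigr)\bigotimes_{j\in I^n}g^n(j,da_j),$$ with $\delta_a$ the Dirac measure at $a$ and players randomizing independently (product measure). The societal summary is $s(g^n)=\sum_{i\in I^n}\lambda^n(i)g^n(i)$. $g^n$ is a (randomized strategy) Nash equilibrium of $G^n$ if for all $i\in I^n$, $u_i^n(g^n)\ge u_i^n(\mu,g^n_{-i})$ for all $\mu\in\mathcal{M}(A_i^n)$, where $(\mu,g^n_{-i})$ is the profile in which $i$ plays $\mu$ and each $j\ne i$ plays $g^n(j)$. *)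

theory Defs
  imports "HOL-Probability.Probability"
begin

section \<open>The space of Borel probability measures\<close>

class compact_metric_space = metric_space +
  assumes compact_whole_space: "compact UNIV"

typedef (overloaded) 'a borel_prob =
  "{\<mu> :: 'a::topological_space measure. prob_space \<mu> \<and> sets \<mu> = sets borel}"
  morphisms meas Borel_Prob
proof
  show "return borel undefined \<in> {\<mu> :: 'a measure. prob_space \<mu> \<and> sets \<mu> = sets borel}"
    by (simp add: prob_space_return)
qed

lemma prob_space_meas: "prob_space (meas \<mu>)"
  and sets_meas [simp, measurable_cong]: "sets (meas \<mu>) = sets borel"
  using meas[of \<mu>] by auto

text \<open>The topology of weak convergence is the initial topology for the maps
  \<open>\<mu> \<mapsto> \<integral> \<phi> d\<mu>\<close> with \<open>\<phi>\<close> bounded and continuous.\<close>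

instantiation borel_prob :: (topological_space) topological_space
begin

definition open_borel_prob :: "'a borel_prob set \<Rightarrow> bool" where
  "open_borel_prob = generate_topology
     {{\<mu>. (\<integral>x. apply_bcontfun \<phi> x \<partial>meas \<mu>) \<in> V} | (\<phi> :: 'a \<Rightarrow>\<^sub>C real) V. open V}"

instance
  by standard (auto simp: open_borel_prob_def intro: generate_topology.intros)

end

lemma tendsto_borel_prob_iff:
  fixes \<nu> :: "'b \<Rightarrow> 'a::topological_space borel_prob"
  shows "(\<nu> \<longlongrightarrow> \<mu>) F \<longleftrightarrow>
    (\<forall>\<phi> :: 'a \<Rightarrow>\<^sub>C real. ((\<lambda>n. \<integral>x. apply_bcontfun \<phi> x \<partial>meas (\<nu> n)) \<longlongrightarrow>
       (\<integral>x. apply_bcontfun \<phi> x \<partial>meas \<mu>)) F)"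
    (is "?L \<longleftrightarrow> ?R")
proof
  assume L: ?L
  show ?R
  proof (intro allI topological_tendstoI)
    fix \<phi> :: "'a \<Rightarrow>\<^sub>C real" and V :: "real set"
    assume V: "open V" "(\<integral>x. apply_bcontfun \<phi> x \<partial>meas \<mu>) \<in> V"
    have "open {\<mu>. (\<integral>x. apply_bcontfun \<phi> x \<partial>meas \<mu>) \<in> V}"
      unfolding open_borel_prob_def using V(1) by (blast intro: generate_topology.Basis)
    from topological_tendstoD[OF L this] V(2)
    show "\<forall>\<^sub>F n in F. (\<integral>x. apply_bcontfun \<phi> x \<partial>meas (\<nu> n)) \<in> V" by simp
  qed
next
  assume R: ?R
  show ?L
  proof (rule topological_tendstoI)
    fix S assume "open S" "\<mu> \<in> S"
    then show "\<forall>\<^sub>F n in F. \<nu> n \<in> S"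
      unfolding open_borel_prob_def
    proof (induction rule: generate_topology.induct)
      case (Int a b)
      then show ?case by (auto intro: eventually_conj)
    next
      case (UN K)
      then obtain k where "k \<in> K" "\<mu> \<in> k" by blast
      with UN.IH[of k] show ?case by (auto elim: eventually_mono)
    next
      case (Basis s)
      then obtain \<phi> :: "'a \<Rightarrow>\<^sub>C real" and V
        where "s = {\<mu>. (\<integral>x. apply_bcontfun \<phi> x \<partial>meas \<mu>) \<in> V}" "open V" by blast
      with R Basis.prems show ?case by (auto dest: topological_tendstoD)
    qed simp
  qed
qed

definition dirac :: "'a::topological_space \<Rightarrow> 'a borel_prob" where
  "dirac a = Borel_Prob (return borel a)"

lemma meas_dirac: "meas (dirac a) = return borel a"
  unfolding dirac_def by (subst Borel_Prob_inverse) (simp_all add: prob_space_return)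

text \<open>The law \<open>\<lambda>f\<^sup>-\<^sup>1\<close>; only meaningful for a Borel measurable \<open>f\<close> on a probability space.\<close>

definition law :: "'i measure \<Rightarrow> ('i \<Rightarrow> 'b::topological_space) \<Rightarrow> 'b borel_prob" where
  "law M f = Borel_Prob (distr M borel f)"

lemma meas_law:
  assumes "prob_space M" "f \<in> borel_measurable M"
  shows "meas (law M f) = distr M borel f"
  unfolding law_def using assms
  by (subst Borel_Prob_inverse) (simp_all add: prob_space.prob_space_distr)

text \<open>The mixture \<open>\<Sum>i. \<lambda>(i) g(i)\<close>; only meaningful on a finite discrete probability space.\<close>

definition mixture ::
    "'j measure \<Rightarrow> ('j \<Rightarrow> 'a::topological_space borel_prob) \<Rightarrow> 'a borel_prob" where
  "mixture L g = Borel_Prob (measure_of UNIV (sets borel)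
     (\<lambda>B. \<Sum>i\<in>space L. emeasure L {i} * emeasure (meas (g i)) B))"

definition finite_prob_space :: "'j measure \<Rightarrow> nat \<Rightarrow> bool" where
  "finite_prob_space L n \<longleftrightarrow> prob_space L \<and> finite (space L) \<and> card (space L) = n \<and>
     sets L = Pow (space L)"

lemma emeasure_mixture:
  assumes L: "finite_prob_space L n" and B: "B \<in> sets borel"
  shows "emeasure (meas (mixture L g)) B =
    (\<Sum>i\<in>space L. emeasure L {i} * emeasure (meas (g i)) B)"
proof -
  let ?m = "\<lambda>B. \<Sum>i\<in>space L. emeasure L {i} * emeasure (meas (g i)) B"
  let ?N = "measure_of UNIV (sets borel) ?m"
  have fin: "finite (space L)" and S: "sets L = Pow (space L)" and P: "prob_space L"
    using L by (auto simp: finite_prob_space_def)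
  have sets_N: "sets ?N = sets borel"
    using sets.sigma_sets_eq[of "borel :: 'b measure"] by (simp add: sets_measure_of)
  have "countably_additive (sets borel) ?m"
  proof (rule countably_additiveI)
    fix A :: "nat \<Rightarrow> 'b set"
    assume A: "range A \<subseteq> sets borel" "disjoint_family A"
    have "(\<Sum>k. ?m (A k)) = (\<Sum>i\<in>space L. \<Sum>k. emeasure L {i} * emeasure (meas (g i)) (A k))"
      by (rule suminf_sum) simp
    also have "\<dots> = ?m (\<Union>k. A k)"
    proof (rule sum.cong[OF refl])
      fix i assume "i \<in> space L"
      show "(\<Sum>k. emeasure L {i} * emeasure (meas (g i)) (A k)) =
          emeasure L {i} * emeasure (meas (g i)) (\<Union>k. A k)"
        using A by (simp add: suminf_emeasure)
    qed
    finally show "(\<Sum>k. ?m (A k)) = ?m (\<Union>k. A k)" .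
  qed
  then have em: "emeasure ?N C = ?m C" if "C \<in> sets borel" for C
    using that sets_N by (intro emeasure_measure_of[OF refl]) (auto simp: positive_def)
  have one: "emeasure (meas (g i)) UNIV = 1" for i
    using prob_space.emeasure_space_1[OF prob_space_meas[of "g i"]]
    by (simp add: sets_eq_imp_space_eq[OF sets_meas])
  have "?m UNIV = (\<Sum>i\<in>space L. emeasure L {i})" by (simp add: one)
  also have "\<dots> = emeasure L (space L)"
    using fin S by (intro emeasure_eq_sum_singleton[symmetric]) auto
  also have "\<dots> = 1" using P by (rule prob_space.emeasure_space_1)
  finally have "prob_space ?N"
    using em[of UNIV] by (intro prob_spaceI) (simp add: space_measure_of_conv)
  then show ?thesis
    unfolding mixture_def using em[OF B] sets_N by (simp add: Borel_Prob_inverse)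
qed

section \<open>The space of nonempty compact sets\<close>

typedef (overloaded) 'a ncompact = "{K :: 'a::topological_space set. compact K \<and> K \<noteq> {}}"
  morphisms set_of NCompact
  by (rule exI[of _ "{undefined}"]) simp

lemma compact_set_of: "compact (set_of K)" and set_of_nonempty: "set_of K \<noteq> {}"
  using set_of[of K] by auto

definition hausdorff_dist :: "'a::metric_space set \<Rightarrow> 'a set \<Rightarrow> real" where
  "hausdorff_dist K L = max (SUP x\<in>K. infdist x L) (SUP y\<in>L. infdist y K)"

lemma hausdorff_dist_le_iff:
  assumes "compact K" "K \<noteq> {}" "compact L" "L \<noteq> {}"
  shows "hausdorff_dist K L \<le> e \<longleftrightarrow> (\<forall>x\<in>K. infdist x L \<le> e) \<and> (\<forall>y\<in>L. infdist y K \<le> e)"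
proof -
  have "bdd_above ((\<lambda>x. infdist x S) ` T)" if "compact T" for S T :: "'a set"
    using that by (intro bounded_imp_bdd_above compact_imp_bounded compact_continuous_image)
      (auto intro: continuous_intros)
  then show ?thesis
    unfolding hausdorff_dist_def using assms by (simp add: cSUP_le_iff)
qed

instantiation ncompact :: (metric_space) metric_space
begin

definition dist_ncompact :: "'a ncompact \<Rightarrow> 'a ncompact \<Rightarrow> real" where
  "dist_ncompact K L = hausdorff_dist (set_of K) (set_of L)"

definition uniformity_ncompact :: "('a ncompact \<times> 'a ncompact) filter" where
  "uniformity_ncompact = (INF e\<in>{0 <..}. principal {(x, y). dist x y < e})"

definition open_ncompact :: "'a ncompact set \<Rightarrow> bool" where
  "open_ncompact S = (\<forall>x\<in>S. \<forall>\<^sub>F (x', y) in uniformity. x' = x \<longrightarrow> y \<in> S)"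

instance
proof
  fix K L N :: "'a ncompact"
  have le: "dist A B \<le> e \<longleftrightarrow>
      (\<forall>x\<in>set_of A. infdist x (set_of B) \<le> e) \<and> (\<forall>y\<in>set_of B. infdist y (set_of A) \<le> e)"
    for A B :: "'a ncompact" and e
    unfolding dist_ncompact_def
    by (rule hausdorff_dist_le_iff) (simp_all add: compact_set_of set_of_nonempty)
  note D = le[THEN iffD1, OF order_refl]
  have nonneg: "0 \<le> dist A B" for A B :: "'a ncompact"
    using D[of A B] set_of_nonempty[of A] infdist_nonneg by (meson ex_in_conv order_trans)
  have zero: "x \<in> set_of B \<longleftrightarrow> infdist x (set_of B) \<le> 0" for x and B :: "'a ncompact"
    using in_closed_iff_infdist_zero[OF compact_imp_closed[OF compact_set_of] set_of_nonempty, of x B]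
      infdist_nonneg[of x "set_of B"] by linarith
  have "dist K L = 0 \<longleftrightarrow> dist K L \<le> 0" using nonneg[of K L] by linarith
  also have "\<dots> \<longleftrightarrow> set_of K = set_of L" by (auto simp: le zero[symmetric])
  finally show "dist K L = 0 \<longleftrightarrow> K = L" by (simp add: set_of_inject)
  have half: "infdist x (set_of B) \<le> dist A C + dist B C"
    if x: "x \<in> set_of A" for x and A B C :: "'a ncompact"
  proof -
    obtain z where z: "z \<in> set_of C" "\<And>y. y \<in> set_of C \<Longrightarrow> dist x z \<le> dist x y"
      using continuous_attains_inf[OF compact_set_of[of C] set_of_nonempty, of "dist x"]
        continuous_on_dist[OF continuous_on_const continuous_on_id, of "set_of C" x]
      by auto
    then have "dist x z \<le> infdist x (set_of C)"
      unfolding infdist_notempty[OF set_of_nonempty] by (intro cINF_greatest set_of_nonempty)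
    have "infdist x (set_of B) \<le> infdist z (set_of B) + dist x z" by (rule infdist_triangle)
    also have "infdist z (set_of B) \<le> dist B C" using D[of B C] z(1) by blast
    also have "dist x z \<le> dist A C" using D[of A C] x \<open>dist x z \<le> _\<close> by force
    finally show ?thesis by simp
  qed
  show "dist K L \<le> dist K N + dist L N"
    unfolding le using half[of _ K L N] half[of _ L K N] by (auto simp: add.commute)
qed (rule uniformity_ncompact_def open_ncompact_def)+

end

section \<open>Large games\<close>

type_synonym 'a payoff = "('a \<times> 'a borel_prob) \<Rightarrow>\<^sub>C real"
type_synonym 'a characteristic = "'a ncompact \<times> 'a payoff"

abbreviation feasible :: "('i \<Rightarrow> 'a::metric_space characteristic) \<Rightarrow> 'i \<Rightarrow> 'a set" where
  "feasible G i \<equiv> set_of (fst (G i))"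

abbreviation payoff ::
    "('i \<Rightarrow> 'a::metric_space characteristic) \<Rightarrow> 'i \<Rightarrow> 'a \<Rightarrow> 'a borel_prob \<Rightarrow> real" where
  "payoff G i a \<mu> \<equiv> apply_bcontfun (snd (G i)) (a, \<mu>)"

definition atomless :: "'i measure \<Rightarrow> bool" where
  "atomless M \<longleftrightarrow> (\<forall>D\<in>sets M. measure M D > 0 \<longrightarrow>
     (\<exists>E\<in>sets M. E \<subseteq> D \<and> 0 < measure M E \<and> measure M E < measure M D))"

definition large_game :: "'i measure \<Rightarrow> ('i \<Rightarrow> 'a::metric_space characteristic) \<Rightarrow> bool" where
  "large_game M G \<longleftrightarrow> prob_space M \<and> complete_measure M \<and> atomless M \<and>
     G \<in> measurable M borel"

definition pure_profile ::
    "'i measure \<Rightarrow> ('i \<Rightarrow> 'a::metric_space characteristic) \<Rightarrow> ('i \<Rightarrow> 'a) \<Rightarrow> bool" where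
  "pure_profile M G f \<longleftrightarrow> f \<in> measurable M borel \<and> (AE i in M. f i \<in> feasible G i)"

definition pure_Nash ::
    "'i measure \<Rightarrow> ('i \<Rightarrow> 'a::metric_space characteristic) \<Rightarrow> ('i \<Rightarrow> 'a) \<Rightarrow> bool" where
  "pure_Nash M G f \<longleftrightarrow> pure_profile M G f \<and>
     (AE i in M. \<forall>a\<in>feasible G i. payoff G i (f i) (law M f) \<ge> payoff G i a (law M f))"

definition countable_valued :: "'i measure \<Rightarrow> ('i \<Rightarrow> 'a::metric_space characteristic) \<Rightarrow> bool" where
  "countable_valued M G \<longleftrightarrow> countable (UNIV :: 'a set) \<and> countable ((\<lambda>i. fst (G i)) ` space M)"

definition game_algebra ::
    "'i measure \<Rightarrow> ('i \<Rightarrow> 'a::metric_space characteristic) \<Rightarrow> 'i set set" where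
  "game_algebra M G = sets (vimage_algebra (space M) G borel)"

definition nowhere_equivalent :: "'i measure \<Rightarrow> 'i set set \<Rightarrow> bool" where
  "nowhere_equivalent M \<F> \<longleftrightarrow> (\<forall>D\<in>sets M. measure M D > 0 \<longrightarrow>
     (\<exists>D\<^sub>0\<in>sets M. D\<^sub>0 \<subseteq> D \<and>
        (\<forall>D\<^sub>1\<in>{D \<inter> D' | D'. D' \<in> \<F>}. measure M (sym_diff D\<^sub>0 D\<^sub>1) > 0)))"

section \<open>Finite-player games\<close>

definition randomized_profile :: "'j measure \<Rightarrow> ('j \<Rightarrow> 'a::metric_space characteristic) \<Rightarrow>
    ('j \<Rightarrow> 'a borel_prob) \<Rightarrow> bool" where
  "randomized_profile L H g \<longleftrightarrow> (\<forall>i\<in>space L. measure (meas (g i)) (feasible H i) = 1)"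

definition expected_payoff :: "'j measure \<Rightarrow> ('j \<Rightarrow> 'a::metric_space characteristic) \<Rightarrow>
    ('j \<Rightarrow> 'a borel_prob) \<Rightarrow> 'j \<Rightarrow> real" where
  "expected_payoff L H g i =
     (LINT a : (\<Pi>\<^sub>E j\<in>space L. feasible H j) | (\<Pi>\<^sub>M j\<in>space L. meas (g j)).
        payoff H i (a i) (mixture L (\<lambda>j. dirac (a j))))"

text \<open>An element of \<open>\<M>(A\<^sub>i)\<close> is represented as a measure on the whole action space that
  gives \<open>A\<^sub>i\<close> full mass.\<close>

definition randomized_Nash :: "'j measure \<Rightarrow> ('j \<Rightarrow> 'a::metric_space characteristic) \<Rightarrow>
    ('j \<Rightarrow> 'a borel_prob) \<Rightarrow> bool" where
  "randomized_Nash L H g \<longleftrightarrow> randomized_profile L H g \<and>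
     (\<forall>i\<in>space L. \<forall>\<mu>. measure (meas \<mu>) (feasible H i) = 1 \<longrightarrow>
        expected_payoff L H g i \<ge> expected_payoff L H (g(i := \<mu>)) i)"

section \<open>The closed graph property\<close>

text \<open>The finite player sets are subsets of an arbitrary type, which the \<open>itself\<close> argument
  makes visible. The sequences are indexed by the positive integers, so their entry at \<open>0\<close>
  is unconstrained.\<close>

definition pure_closed_graph ::
    "'j itself \<Rightarrow> 'i measure \<Rightarrow> ('i \<Rightarrow> 'a::metric_space characteristic) \<Rightarrow> bool" where
  "pure_closed_graph _ M G \<longleftrightarrow>
     (\<forall>(L :: nat \<Rightarrow> 'j measure) (H :: nat \<Rightarrow> 'j \<Rightarrow> 'a characteristic)
       (g :: nat \<Rightarrow> 'j \<Rightarrow> 'a borel_prob) (\<tau> :: 'a borel_prob).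
        (\<forall>n\<ge>1. finite_prob_space (L n) n) \<longrightarrow>
        (\<lambda>n. SUP i\<in>space (L n). measure (L n) {i}) \<longlonglongrightarrow> 0 \<longrightarrow>
        (\<lambda>n. law (L n) (H n)) \<longlonglongrightarrow> law M G \<longrightarrow>
        (\<forall>n\<ge>1. randomized_Nash (L n) (H n) (g n)) \<longrightarrow>
        (\<lambda>n. mixture (L n) (g n)) \<longlonglongrightarrow> \<tau> \<longrightarrow>
        (\<exists>f. pure_Nash M G f \<and> law M f = \<tau>))"

end

theory Submission
  imports Defs
begin

text \<open>Let \<open>\<mu>\<close> be the distribution of types in the large game \<open>G\<close>. A profile of the \<open>n\<close>-th finite game induces a
joint distribution of types and actions; what is wanted is a limit of these distributions, and then
a pure profile of \<open>G\<close> that realizes enough of the limit.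

The limit. The action space is cut into finer and finer finite partitions by balls \<open>b 0, b 1, \<dots>\<close> whose
spheres are \<open>\<tau>\<close>-null; the cells are indexed by bit strings. For a cell \<open>B\<close> the mass that the \<open>n\<close>-th game
gives to \<open>C \<times> B\<close>, with \<open>C\<close> a \<open>\<mu>\<close>-continuity set of types, has a limit along a suitable filter
(\<open>exists_limit_filter\<close>). This limit is additive in \<open>C\<close> and dominated by \<open>\<mu>\<close>, hence has a density with
respect to \<open>\<mu>\<close> (\<open>dominated_charge_density\<close>). The densities play the part of the
conditional probabilities of the cells given the type; they integrate to \<open>\<tau>\<close> of the cells.

Optimality in the limit. In a game with small players the realized distribution of actions is close to
its mean with high probability (\<open>empirical_concentration\<close>), and the mean is close to \<open>\<tau>\<close>. So an
equilibrium strategy nearly maximizes the payoff against \<open>\<tau>\<close>, and the function \<open>gap\<close>, which is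
continuous in the type and, for a nonempty cell, vanishes exactly if some best reply to \<open>\<tau>\<close> lies in the
closure of the cell, tends to zero on average over the players who use the cell (\<open>average_gap_tendsto_0\<close>). Therefore
a type gives positive density only to cells whose closure contains a best reply to \<open>\<tau>\<close>
(\<open>limit_response_densities\<close>).

The pure profile. If \<open>\<I>\<close> is nowhere equivalent to \<open>\<sigma>(G)\<close>, a set of players can be split with any
prescribed conditional probability given \<open>\<sigma>(G)\<close> (\<open>nowhere_equivalent_exists_subset_with_density\<close>). This
builds, bit by bit, a nested system of sets of players that copies the cells (\<open>realize_densities\<close>); the
action of a player is the limit point of the cells she belongs to. If the action space is countable,
the densities shrink to weights on single actions, and a pure selection with the same total weights
is found inside the supports (\<open>countable_purification\<close>). In both cases the distribution of the selected
actions is \<open>\<tau>\<close>, and every selected action is a limit of best replies to \<open>\<tau>\<close>.\<close>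

section \<open>Splitting a set along a sub-\<open>\<sigma>\<close>-algebra\<close>

lemma integrable_imp_set_integrable:
  fixes f :: "'b \<Rightarrow> real"
  assumes "integrable M f" "A \<in> sets M"
  shows "set_integrable M A f"
  unfolding set_integrable_def using assms(2,1) by (rule integrable_mult_indicator)

text \<open>An exhaustion argument: the \<open>n\<close>-th extension comes within \<open>1 / (n + 1)\<close> of the supremum of the
measures that are still available, so the union of the chain leaves no room for a further gain.\<close>

lemma exists_measure_maximal:
  assumes M: "finite_measure M" and sub: "\<A> \<subseteq> sets M" and ne: "X0 \<in> \<A>"
    and Un: "\<And>E :: nat \<Rightarrow> _. range E \<subseteq> \<A> \<Longrightarrow> incseq E \<Longrightarrow> (\<Union>n. E n) \<in> \<A>"
  shows "\<exists>X\<in>\<A>. \<forall>Y\<in>\<A>. X \<subseteq> Y \<longrightarrow> measure M Y = measure M X"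
proof -
  interpret finite_measure M by fact
  define s where "s X = (SUP Y\<in>{Y\<in>\<A>. X \<subseteq> Y}. measure M Y)" for X
  have bdd: "bdd_above (measure M ` {Y\<in>\<A>. X \<subseteq> Y})" for X
    by (intro bdd_aboveI2[of _ _ "measure M (space M)"]) (auto intro: bounded_measure)
  have step: "\<exists>Y. Y \<in> \<A> \<and> X \<subseteq> Y \<and> s X - inverse (real (Suc n)) < measure M Y" if "X \<in> \<A>" for X n
  proof -
    have "s X - inverse (real (Suc n)) < s X" by simp
    then show ?thesis
      unfolding s_def[of X] using that by (subst (asm) less_cSUP_iff[OF _ bdd]) auto
  qed
  have "\<exists>E. \<forall>n. E n \<in> \<A> \<and> (E n \<subseteq> E (Suc n) \<and> s (E n) - inverse (real (Suc n)) < measure M (E (Suc n)))"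
    by (rule dependent_nat_choice) (use ne step in auto)
  then obtain E where E: "\<And>n. E n \<in> \<A>" "\<And>n. E n \<subseteq> E (Suc n)"
      "\<And>n. s (E n) - inverse (real (Suc n)) < measure M (E (Suc n))"
    by blast
  have X: "(\<Union>n. E n) \<in> \<A>" using E by (intro Un) (auto intro: incseq_SucI)
  have "measure M Y = measure M (\<Union>n. E n)" if Y: "Y \<in> \<A>" "(\<Union>n. E n) \<subseteq> Y" for Y
  proof (rule antisym)
    have "measure M Y \<le> measure M (\<Union>n. E n) + inverse (real (Suc n))" for n
    proof -
      have "measure M Y \<le> s (E n)"
        unfolding s_def using Y by (intro cSUP_upper bdd) auto
      moreover have "measure M (E (Suc n)) \<le> measure M (\<Union>n. E n)"
        using X sub by (intro finite_measure_mono) auto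
      ultimately show ?thesis using E(3)[of n] by linarith
    qed
    moreover have "(\<lambda>n. measure M (\<Union>n. E n) + inverse (real (Suc n))) \<longlonglongrightarrow> measure M (\<Union>n. E n) + 0"
      by (intro tendsto_intros LIMSEQ_inverse_real_of_nat)
    ultimately show "measure M Y \<le> measure M (\<Union>n. E n)"
      using LIMSEQ_le_const[of "\<lambda>n. measure M (\<Union>n. E n) + inverse (real (Suc n))"] by auto
    show "measure M (\<Union>n. E n) \<le> measure M Y"
      using Y sub by (intro finite_measure_mono) auto
  qed
  with X show ?thesis by blast
qed

lemma exists_conditional_probability:
  assumes M: "finite_measure M" and F: "subalgebra M F" and X: "X \<in> sets M"
  shows "\<exists>p\<in>borel_measurable F. integrable M p \<and>
    (\<forall>C\<in>sets F. measure M (X \<inter> C) = (\<integral>x\<in>C. p x \<partial>M))"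
proof (intro bexI[of _ "real_cond_exp M F (indicator X)"] conjI ballI)
  interpret finite_measure M by fact
  interpret finite_measure_subalgebra M F by unfold_locales (rule F)
  have int: "integrable M (indicator X :: _ \<Rightarrow> real)"
    using X by (simp add: integrable_indicator_iff less_top[symmetric])
  then show "integrable M (real_cond_exp M F (indicator X))"
    by (rule real_cond_exp_int(1))
  fix C assume C: "C \<in> sets F"
  then have CM: "C \<in> sets M" using F by (auto simp: subalgebra_def)
  have "(\<integral>x\<in>C. real_cond_exp M F (indicator X) x \<partial>M) = (\<integral>x\<in>C. indicator X x \<partial>M)"
    by (rule real_cond_exp_intA[OF int C, symmetric])
  also have "\<dots> = (\<integral>x. indicator (X \<inter> C) x \<partial>M)"
    unfolding set_lebesgue_integral_def by (intro Bochner_Integration.integral_cong) (auto simp: indicator_def)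
  also have "\<dots> = measure M (X \<inter> C)"
    using sets.sets_into_space[OF X] by (simp add: Int_absorb2 le_infI1)
  finally show "measure M (X \<inter> C) = (\<integral>x\<in>C. real_cond_exp M F (indicator X) x \<partial>M)" ..
qed simp

text \<open>Take a part \<open>D0\<close> of \<open>D\<close> that is not cut out of \<open>D\<close> by a set of \<open>F\<close>, and let \<open>C0\<close> be the event that \<open>D0\<close> has at
most the conditional probability of \<open>D - D0\<close> given \<open>F\<close>. On \<open>C0\<close> the set \<open>D0\<close>, and off \<open>C0\<close> the set
\<open>D - D0\<close>, has at most half of the conditional probability of \<open>D\<close>. If both of these pieces were null,
\<open>D0\<close> would agree with \<open>D \<inter> (space M - C0)\<close> up to a null set.\<close>

lemma nowhere_equivalent_halving:
  assumes M: "finite_measure M" and F: "subalgebra M F"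
    and ne: "nowhere_equivalent M (sets F)"
    and D: "D \<in> sets M" "measure M D > 0"
  shows "\<exists>E\<in>sets M. E \<subseteq> D \<and> measure M E > 0 \<and>
    (\<forall>C\<in>sets F. 2 * measure M (E \<inter> C) \<le> measure M (D \<inter> C))"
proof -
  interpret finite_measure M by fact
  have FM: "sets F \<subseteq> sets M" and sp: "space F = space M" using F by (auto simp: subalgebra_def)
  from ne[unfolded nowhere_equivalent_def, rule_format, OF D]
  obtain D0 where D0: "D0 \<in> sets M" "D0 \<subseteq> D"
    and ne_all: "\<forall>D\<^sub>1\<in>{D \<inter> D' | D'. D' \<in> sets F}. measure M (sym_diff D0 D\<^sub>1) > 0" by auto
  have ne0: "measure M (sym_diff D0 (D \<inter> D')) > 0" if "D' \<in> sets F" for D'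
    by (rule ne_all[rule_format]) (use that in auto)
  define D1 where "D1 = D - D0"
  have D1: "D1 \<in> sets M" "D1 \<subseteq> D" using D D0 by (auto simp: D1_def)
  have "\<forall>X. \<exists>p. X \<in> sets M \<longrightarrow> p \<in> borel_measurable F \<and> integrable M p \<and>
      (\<forall>C\<in>sets F. measure M (X \<inter> C) = (\<integral>x\<in>C. p x \<partial>M))"
    using exists_conditional_probability[OF M F] by blast
  then obtain p where p: "\<And>X. X \<in> sets M \<Longrightarrow> p X \<in> borel_measurable F \<and> integrable M (p X) \<and>
      (\<forall>C\<in>sets F. measure M (X \<inter> C) = (\<integral>x\<in>C. p X x \<partial>M))"
    unfolding choice_iff by blast
  then have pint: "integrable M (p X)"
    and pI: "C \<in> sets F \<Longrightarrow> measure M (X \<inter> C) = (\<integral>x\<in>C. p X x \<partial>M)" if "X \<in> sets M" for X C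
    using that by blast+
  have [measurable]: "p D0 \<in> borel_measurable F" "p D1 \<in> borel_measurable F"
    using p D0(1) D1(1) by blast+
  have mono: "measure M (X \<inter> C) \<le> measure M (Y \<inter> C)"
    if X: "X \<in> sets M" "Y \<in> sets M" and C: "C \<in> sets F" "\<And>x. x \<in> C \<Longrightarrow> p X x \<le> p Y x" for X Y C
    unfolding pI[OF X(1) C(1)] pI[OF X(2) C(1)]
    using C FM X by (intro set_integral_mono integrable_imp_set_integrable pint) auto
  define C0 where "C0 = {x\<in>space F. p D0 x \<le> p D1 x}"
  have C0[measurable]: "C0 \<in> sets F" unfolding C0_def by measurable
  have C0': "space F - C0 \<in> sets F" using C0 by auto
  have sum: "measure M (D \<inter> C) = measure M (D0 \<inter> C) + measure M (D1 \<inter> C)" if "C \<in> sets F" for C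
  proof -
    have "D \<inter> C = (D0 \<inter> C) \<union> (D1 \<inter> C)" using D0 by (auto simp: D1_def)
    then show ?thesis using D0 D1 that FM
      by (subst finite_measure_Union[symmetric]) (auto simp: D1_def)
  qed
  have res: "\<exists>E\<in>sets M. E \<subseteq> D \<and> measure M E > 0 \<and>
    (\<forall>C\<in>sets F. 2 * measure M (E \<inter> C) \<le> measure M (D \<inter> C))"
    if Y: "X \<in> sets M" "Y \<in> sets M" "X \<subseteq> D" and C: "C' \<in> sets F" "\<And>x. x \<in> C' \<Longrightarrow> p X x \<le> p Y x"
      and s: "\<And>C. C \<in> sets F \<Longrightarrow> measure M (D \<inter> C) = measure M (X \<inter> C) + measure M (Y \<inter> C)"
      and pos: "measure M (X \<inter> C') > 0" for X Y C'
  proof (rule bexI[of _ "X \<inter> C'"], intro conjI ballI)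
    fix C assume CF: "C \<in> sets F"
    have "2 * measure M (X \<inter> (C' \<inter> C)) \<le> measure M (D \<inter> (C' \<inter> C))"
      using mono[of X Y "C' \<inter> C"] s[of "C' \<inter> C"] Y C CF by auto
    also have "\<dots> \<le> measure M (D \<inter> C)"
      using D CF FM by (intro finite_measure_mono) auto
    finally show "2 * measure M (X \<inter> C' \<inter> C) \<le> measure M (D \<inter> C)" by (simp add: Int_assoc)
  qed (use Y C FM pos in auto)
  show ?thesis
  proof (rule ccontr)
    assume neg: "\<not> ?thesis"
    have "\<not> measure M (D0 \<inter> C0) > 0"
    proof
      assume "measure M (D0 \<inter> C0) > 0"
      with neg show False
        by (elim notE, intro res[of D0 D1 C0]) (use D0 D1 C0 sum in \<open>simp_all add: C0_def\<close>)
    qed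
    then have "measure M (D0 \<inter> C0) = 0" by (simp add: zero_less_measure_iff)
    moreover have "\<not> measure M (D1 \<inter> (space F - C0)) > 0"
    proof
      assume "measure M (D1 \<inter> (space F - C0)) > 0"
      with neg show False
        by (elim notE, intro res[of D1 D0 "space F - C0"]) (use D0 D1 C0' sum in \<open>auto simp: C0_def\<close>)
    qed
    then have "measure M (D1 \<inter> (space F - C0)) = 0" by (simp add: zero_less_measure_iff)
    moreover have MM: "C0 \<in> sets M" "space F - C0 \<in> sets M" using C0 C0' FM by auto
    moreover have "sym_diff D0 (D \<inter> (space F - C0)) \<subseteq> (D0 \<inter> C0) \<union> (D1 \<inter> (space F - C0))"
      using D sets.sets_into_space[OF D(1)] sp D0 by (auto simp: D1_def)
    then have "measure M (sym_diff D0 (D \<inter> (space F - C0))) \<le>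
        measure M ((D0 \<inter> C0) \<union> (D1 \<inter> (space F - C0)))"
      using D0 D1 MM by (intro finite_measure_mono) auto
    moreover have "\<dots> \<le> measure M (D0 \<inter> C0) + measure M (D1 \<inter> (space F - C0))"
      using D0 D1 MM by (intro measure_Un_le) auto
    ultimately show False using ne0[OF C0'] by linarith
  qed
qed

lemma nowhere_equivalent_small_part:
  assumes M: "finite_measure M" and F: "subalgebra M F"
    and ne: "nowhere_equivalent M (sets F)"
    and D: "D \<in> sets M" "measure M D > 0"
  shows "\<exists>E\<in>sets M. E \<subseteq> D \<and> measure M E > 0 \<and>
    (\<forall>C\<in>sets F. 2 ^ k * measure M (E \<inter> C) \<le> measure M (D \<inter> C))"
proof (induction k)
  case 0
  then show ?case using D by auto
next
  case (Suc k)
  then obtain E where E: "E \<in> sets M" "E \<subseteq> D" "measure M E > 0"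
    "\<And>C. C \<in> sets F \<Longrightarrow> 2 ^ k * measure M (E \<inter> C) \<le> measure M (D \<inter> C)" by blast
  obtain E' where E': "E' \<in> sets M" "E' \<subseteq> E" "measure M E' > 0"
    "\<And>C. C \<in> sets F \<Longrightarrow> 2 * measure M (E' \<inter> C) \<le> measure M (E \<inter> C)"
    using nowhere_equivalent_halving[OF M F ne E(1,3)] by blast
  have "2 ^ Suc k * measure M (E' \<inter> C) \<le> measure M (D \<inter> C)" if C: "C \<in> sets F" for C
  proof -
    have "2 ^ Suc k * measure M (E' \<inter> C) = 2 ^ k * (2 * measure M (E' \<inter> C))" by simp
    also have "\<dots> \<le> 2 ^ k * measure M (E \<inter> C)" using E'(4)[OF C] by (intro mult_left_mono) auto
    also have "\<dots> \<le> measure M (D \<inter> C)" using E(4)[OF C] .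
    finally show ?thesis .
  qed
  with E E' show ?case by blast
qed

text \<open>Maharam's lemma. A maximal part of \<open>D\<close> whose conditional probability given \<open>F\<close> stays below \<open>\<phi>\<close> must attain
\<open>\<phi>\<close>: where it stays below by \<open>2\<^sup>-\<^sup>k\<close>, one could still add a nonnull part of the rest of \<open>D\<close> whose
conditional probability is at most \<open>2\<^sup>-\<^sup>k\<close>.\<close>

proposition nowhere_equivalent_exists_subset_with_density:
  assumes M: "finite_measure M" and F: "subalgebra M F"
    and ne: "nowhere_equivalent M (sets F)"
    and D: "D \<in> sets M"
    and \<phi>: "\<phi> \<in> borel_measurable F" "integrable M \<phi>" "\<And>x. x \<in> space M \<Longrightarrow> 0 \<le> \<phi> x"
    and le: "\<And>C. C \<in> sets F \<Longrightarrow> (\<integral>x\<in>C. \<phi> x \<partial>M) \<le> measure M (D \<inter> C)"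
  shows "\<exists>E\<in>sets M. E \<subseteq> D \<and> (\<forall>C\<in>sets F. measure M (E \<inter> C) = (\<integral>x\<in>C. \<phi> x \<partial>M))"
proof -
  interpret finite_measure M by fact
  have FM: "sets F \<subseteq> sets M" and sp: "space F = space M" using F by (auto simp: subalgebra_def)
  define \<A> where "\<A> = {E\<in>sets M. E \<subseteq> D \<and> (\<forall>C\<in>sets F. measure M (E \<inter> C) \<le> (\<integral>x\<in>C. \<phi> x \<partial>M))}"
  have "{} \<in> \<A>"
    unfolding \<A>_def using \<phi>(3) sets.sets_into_space FM
    by (auto simp: set_lebesgue_integral_def indicator_def intro!: Bochner_Integration.integral_nonneg)
  moreover have "(\<Union>n. E n) \<in> \<A>" if E: "range E \<subseteq> \<A>" "incseq E" for E :: "nat \<Rightarrow> _"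
  proof -
    have "measure M ((\<Union>n. E n) \<inter> C) \<le> (\<integral>x\<in>C. \<phi> x \<partial>M)" if C: "C \<in> sets F" for C
    proof -
      have "(\<lambda>n. measure M (E n \<inter> C)) \<longlonglongrightarrow> measure M (\<Union>n. E n \<inter> C)"
      proof (rule finite_Lim_measure_incseq)
        show "range (\<lambda>n. E n \<inter> C) \<subseteq> sets M" using E(1) C FM by (auto simp: \<A>_def)
        show "incseq (\<lambda>n. E n \<inter> C)"
          using monoD[OF E(2)] by (intro monoI) blast
      qed
      then have "measure M (\<Union>n. E n \<inter> C) \<le> (\<integral>x\<in>C. \<phi> x \<partial>M)"
      proof (rule LIMSEQ_le_const2, intro exI allI impI)
        show "measure M (E n \<inter> C) \<le> (\<integral>x\<in>C. \<phi> x \<partial>M)" for n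
          using E(1) C unfolding \<A>_def by blast
      qed
      moreover have "(\<Union>n. E n) \<inter> C = (\<Union>n. E n \<inter> C)" by blast
      ultimately show ?thesis by (simp only:)
    qed
    moreover have "(\<Union>n. E n) \<in> sets M" "(\<Union>n. E n) \<subseteq> D" using E(1) unfolding \<A>_def by blast+
    ultimately show ?thesis unfolding \<A>_def by blast
  qed
  moreover have "\<A> \<subseteq> sets M" by (auto simp: \<A>_def)
  ultimately have "\<exists>X\<in>\<A>. \<forall>Y\<in>\<A>. X \<subseteq> Y \<longrightarrow> measure M Y = measure M X"
    by (intro exists_measure_maximal[OF M])
  then obtain E where E: "E \<in> \<A>" and max: "\<And>Y. Y \<in> \<A> \<Longrightarrow> E \<subseteq> Y \<Longrightarrow> measure M Y = measure M E"
    by blast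
  have EM: "E \<in> sets M" "E \<subseteq> D" and Ele: "\<And>C. C \<in> sets F \<Longrightarrow> measure M (E \<inter> C) \<le> (\<integral>x\<in>C. \<phi> x \<partial>M)"
    using E unfolding \<A>_def by blast+
  obtain p where pm[measurable]: "p \<in> borel_measurable F" and pint: "integrable M p"
    and pI: "\<And>C. C \<in> sets F \<Longrightarrow> measure M (E \<inter> C) = (\<integral>x\<in>C. p x \<partial>M)"
    using exists_conditional_probability[OF M F EM(1)] by blast
  note \<phi>(1)[measurable]
  have SI: "set_integrable M C p" "set_integrable M C \<phi>" "set_integrable M C (\<lambda>x. \<phi> x - p x)" if "C \<in> sets F" for C
    using that FM pint \<phi>(2) by (auto intro!: integrable_imp_set_integrable)
  define d where "d x = \<phi> x - p x" for x
  have dint: "(\<integral>x\<in>C. d x \<partial>M) = (\<integral>x\<in>C. \<phi> x \<partial>M) - measure M (E \<inter> C)" if C: "C \<in> sets F" for C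
    unfolding d_def pI[OF C] using SI[OF C] by (intro set_integral_diff(2))
  have dpos: "(\<integral>x\<in>C. d x \<partial>M) \<ge> 0" if C: "C \<in> sets F" for C
    using dint[OF C] Ele[OF C] by simp
  \<comment> \<open>\<open>d\<close> is the deficit of \<open>E\<close>; a deficit of \<open>2\<^sup>-\<^sup>k\<close> on a nonnull set would contradict maximality.\<close>
  have small: "measure M {x\<in>space F. inverse (2 ^ k) \<le> d x} = 0" for k
  proof (rule ccontr)
    define Ck where "Ck = {x\<in>space F. inverse (2 ^ k) \<le> d x}"
    assume "measure M {x\<in>space F. inverse (2 ^ k) \<le> d x} \<noteq> 0"
    then have pos: "measure M Ck > 0" by (simp add: zero_less_measure_iff Ck_def)
    have Ck: "Ck \<in> sets F" unfolding Ck_def d_def by measurable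
    have ge: "inverse (2 ^ k) * measure M C \<le> (\<integral>x\<in>C. d x \<partial>M)" if C: "C \<in> sets F" "C \<subseteq> Ck" for C
    proof -
      have "inverse (2 ^ k) * measure M C = (\<integral>x\<in>C. inverse (2 ^ k) \<partial>M)"
        using C(1) FM by (auto simp: set_lebesgue_integral_def mult.commute)
      also have "\<dots> \<le> (\<integral>x\<in>C. d x \<partial>M)"
        unfolding d_def using C(1) SI(3)[OF C(1)] FM
        by (intro set_integral_mono integrable_imp_set_integrable integrable_const)
          (use C(2) pint \<phi>(2) in \<open>auto simp: Ck_def d_def\<close>)
      finally show ?thesis .
    qed
    have "0 < inverse (2 ^ k) * measure M Ck" using pos by simp
    also have "\<dots> \<le> (\<integral>x\<in>Ck. d x \<partial>M)" by (intro ge Ck) simp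
    also have "\<dots> = (\<integral>x\<in>Ck. \<phi> x \<partial>M) - measure M (E \<inter> Ck)" by (rule dint[OF Ck])
    also have "\<dots> \<le> measure M (D \<inter> Ck) - measure M (E \<inter> Ck)" using le[OF Ck] by simp
    also have "\<dots> = measure M ((D - E) \<inter> Ck)"
    proof -
      have "(D - E) \<inter> Ck = D \<inter> Ck - E \<inter> Ck" by auto
      then show ?thesis using D EM Ck FM by (subst finite_measure_Diff[symmetric]) auto
    qed
    finally have "measure M ((D - E) \<inter> Ck) > 0" .
    moreover have "(D - E) \<inter> Ck \<in> sets M" using D EM Ck FM by auto
    ultimately obtain E' where E': "E' \<in> sets M" "E' \<subseteq> (D - E) \<inter> Ck" "measure M E' > 0"
      "\<And>C. C \<in> sets F \<Longrightarrow> 2 ^ k * measure M (E' \<inter> C) \<le> measure M ((D - E) \<inter> Ck \<inter> C)"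
      using nowhere_equivalent_small_part[OF M F ne, of "(D - E) \<inter> Ck" k] by blast
    have "measure M ((E \<union> E') \<inter> C) \<le> (\<integral>x\<in>C. \<phi> x \<partial>M)" if C: "C \<in> sets F" for C
    proof -
      have eq: "E' \<inter> C = E' \<inter> (C \<inter> Ck)" using E' by auto
      have CC: "C \<inter> Ck \<in> sets F" "C - Ck \<in> sets F" using C Ck by auto
      have "measure M ((E \<union> E') \<inter> C) = measure M (E \<inter> C \<union> E' \<inter> C)" by (simp add: Int_Un_distrib2)
      also have "\<dots> = measure M (E \<inter> C) + measure M (E' \<inter> C)"
        using EM E' C FM by (intro finite_measure_Union) auto
      also have "measure M (E' \<inter> C) \<le> inverse (2 ^ k) * measure M ((D - E) \<inter> Ck \<inter> (C \<inter> Ck))"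
        using E'(4)[OF CC(1)] by (simp add: eq field_simps)
      also have "\<dots> \<le> inverse (2 ^ k) * measure M (C \<inter> Ck)"
        using CC FM by (intro mult_left_mono finite_measure_mono) auto
      also have "\<dots> \<le> (\<integral>x\<in>C \<inter> Ck. d x \<partial>M)" by (intro ge CC) auto
      also have "\<dots> \<le> (\<integral>x\<in>C \<inter> Ck. d x \<partial>M) + (\<integral>x\<in>C - Ck. d x \<partial>M)" using dpos[OF CC(2)] by simp
      also have "\<dots> = (\<integral>x\<in>(C \<inter> Ck) \<union> (C - Ck). d x \<partial>M)"
        using SI(3)[OF CC(1)] SI(3)[OF CC(2)] by (subst set_integral_Un) (auto simp: d_def[abs_def])
      also have "(C \<inter> Ck) \<union> (C - Ck) = C" by auto
      finally show ?thesis using dint[OF C] by simp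
    qed
    moreover have "E \<union> E' \<in> sets M" "E \<union> E' \<subseteq> D" using EM E' by auto
    ultimately have "E \<union> E' \<in> \<A>" unfolding \<A>_def by blast
    then have "measure M (E \<union> E') = measure M E" by (rule max) auto
    moreover have "measure M (E \<union> E') = measure M E + measure M E'"
      using EM E' by (intro finite_measure_Union) auto
    ultimately show False using E'(3) by simp
  qed
  have "AE x in M. \<not> (inverse (2 ^ k) \<le> d x)" for k
  proof (rule AE_I')
    show "{x\<in>space F. inverse (2 ^ k) \<le> d x} \<in> null_sets M"
    proof -
      have "{x\<in>space F. inverse (2 ^ k) \<le> d x} \<in> sets F" unfolding d_def by measurable
      then show ?thesis using small[of k] FM by (auto simp: null_sets_def emeasure_eq_measure)
    qed
  qed (auto simp: sp)
  then have "AE x in M. \<forall>k. \<not> (inverse (2 ^ k) \<le> d x)" by (simp add: AE_all_countable)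
  then have d0: "AE x in M. d x \<le> 0"
  proof eventually_elim
    fix x assume k: "\<forall>k. \<not> inverse (2 ^ k) \<le> d x"
    show "d x \<le> 0"
    proof (rule ccontr)
      assume "\<not> d x \<le> 0"
      then obtain k where "(1 / 2) ^ k < d x" using real_arch_pow_inv[of "d x" "1/2"] by auto
      with k[rule_format, of k] show False by (simp add: power_divide field_simps)
    qed
  qed
  have "measure M (E \<inter> C) = (\<integral>x\<in>C. \<phi> x \<partial>M)" if C: "C \<in> sets F" for C
  proof (rule antisym[OF Ele[OF C]])
    have "(\<integral>x\<in>C. d x \<partial>M) \<le> (\<integral>x\<in>C. 0 \<partial>M)"
      unfolding set_lebesgue_integral_def
    proof (rule integral_mono_AE)
      show "integrable M (\<lambda>x. indicator C x *\<^sub>R d x)"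
        using SI(3)[OF C] by (simp add: d_def[abs_def] set_integrable_def)
      show "AE x in M. indicator C x *\<^sub>R d x \<le> indicator C x *\<^sub>R 0"
        using d0 by eventually_elim (simp add: indicator_def)
    qed simp
    then show "(\<integral>x\<in>C. \<phi> x \<partial>M) \<le> measure M (E \<inter> C)" using dint[OF C] by simp
  qed
  with EM show ?thesis by blast
qed

section \<open>Pure selections from countably many weights\<close>

text \<open>Sierpinski's theorem for the measure with density \<open>H\<close>. An atomless measure is one that is nowhere
equivalent to the trivial \<open>\<sigma>\<close>-algebra, and having a density preserves this property; so Maharam's lemma
applies with a constant \<open>\<phi>\<close>.\<close>

lemma atomless_exists_subset_with_integral:
  fixes H :: "'i \<Rightarrow> real"
  assumes M: "finite_measure M" and at: "atomless M"
    and H: "integrable M H" "\<And>x. x \<in> space M \<Longrightarrow> 0 \<le> H x"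
    and D: "D \<in> sets M" and v: "0 \<le> v" "v \<le> (\<integral>x\<in>D. H x \<partial>M)"
  shows "\<exists>E\<in>sets M. E \<subseteq> D \<and> (\<integral>x\<in>E. H x \<partial>M) = v"
proof -
  interpret finite_measure M by fact
  have Hm[measurable]: "H \<in> borel_measurable M" using H(1) by simp
  define N where "N = density M (\<lambda>x. ennreal (H x))"
  define F where "F = sigma (space M) {}"
  have setsN: "sets N = sets M" and spN: "space N = space M" by (simp_all add: N_def)
  have emN: "emeasure N S = ennreal (\<integral>x\<in>S. H x \<partial>M)" and mN: "measure N S = (\<integral>x\<in>S. H x \<partial>M)"
    if S: "S \<in> sets M" for S
  proof -
    have "(\<integral>\<^sup>+x. ennreal (indicator S x * H x) \<partial>M) = ennreal (\<integral>x. indicator S x * H x \<partial>M)"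
      using integrable_imp_set_integrable[OF H(1) S] H(2)
      by (intro nn_integral_eq_integral) (auto simp: set_integrable_def indicator_def)
    moreover have "emeasure N S = (\<integral>\<^sup>+x. ennreal (indicator S x * H x) \<partial>M)"
      unfolding N_def using S by (subst emeasure_density)
        (auto intro!: nn_integral_cong simp: indicator_def)
    ultimately show *: "emeasure N S = ennreal (\<integral>x\<in>S. H x \<partial>M)"
      by (simp add: set_lebesgue_integral_def)
    have "0 \<le> (\<integral>x\<in>S. H x \<partial>M)"
      unfolding set_lebesgue_integral_def using H(2)
      by (intro Bochner_Integration.integral_nonneg) (auto simp: indicator_def)
    then show "measure N S = (\<integral>x\<in>S. H x \<partial>M)" using * by (simp add: measure_def)
  qed
  interpret N: finite_measure N
    by (rule finite_measureI) (simp add: spN emN)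
  have setsF: "sets F = {{}, space M}" and spF: "space F = space M"
    by (simp_all add: F_def sigma_sets_empty_eq)
  have F: "subalgebra N F" by (auto simp: subalgebra_def setsF spF spN setsN)
  have ne: "nowhere_equivalent N (sets F)"
    unfolding nowhere_equivalent_def
  proof (intro ballI impI)
    fix X assume X: "X \<in> sets N" "measure N X > 0"
    define X' where "X' = X \<inter> {x\<in>space M. H x > 0}"
    have X'[measurable]: "X' \<in> sets M" using X unfolding X'_def setsN by measurable
    have pos: "measure N S > 0 \<longleftrightarrow> measure M S > 0" if S: "S \<in> sets M" "S \<subseteq> X'" for S
    proof -
      have "emeasure N S = 0 \<longleftrightarrow> (AE x in M. x \<in> S \<longrightarrow> ennreal (H x) = 0)"
        unfolding N_def using S(1) by (subst emeasure_density) (auto simp: nn_integral_0_iff_AE indicator_def)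
      also have "\<dots> \<longleftrightarrow> (AE x in M. x \<notin> S)"
        using S(2) by (intro AE_cong) (auto simp: X'_def ennreal_eq_0_iff)
      also have "\<dots> \<longleftrightarrow> emeasure M S = 0"
        using S(1) by (auto simp: AE_iff_null_sets[OF S(1), symmetric] null_sets_def)
      finally show ?thesis
        by (simp add: N.emeasure_eq_measure emeasure_eq_measure zero_less_measure_iff)
    qed
    have split: "measure N X = measure N X' + measure N (X - X')"
      using X X' by (subst N.finite_measure_Union[symmetric]) (auto simp: setsN X'_def intro!: arg_cong[where f = "measure N"])
    have XX: "X - X' \<in> sets M" using X X' setsN by auto
    have "measure N (X - X') = (\<integral>x\<in>X - X'. 0 \<partial>M)"
      unfolding mN[OF XX] set_lebesgue_integral_def using H(2)
      by (intro Bochner_Integration.integral_cong) (auto simp: indicator_def X'_def intro!: antisym)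
    then have "measure N X' > 0" using split X(2) by simp
    then have "measure M X' > 0" using pos[of X'] X' by simp
    then obtain E where E: "E \<in> sets M" "E \<subseteq> X'" "0 < measure M E" "measure M E < measure M X'"
      using at X' unfolding atomless_def by blast
    have "measure M (X' - E) > 0" using E X' finite_measure_Diff[of X' E] by auto
    then have p2: "measure N (X' - E) > 0" using pos[of "X' - E"] E X' by auto
    have p1: "measure N E > 0" using pos[of E] E by auto
    show "\<exists>D\<^sub>0\<in>sets N. D\<^sub>0 \<subseteq> X \<and> (\<forall>D\<^sub>1\<in>{X \<inter> D' | D'. D' \<in> sets F}. measure N (sym_diff D\<^sub>0 D\<^sub>1) > 0)"
    proof (rule bexI[of _ E], intro conjI ballI)
      show "E \<subseteq> X" using E by (auto simp: X'_def)
      fix D\<^sub>1 assume "D\<^sub>1 \<in> {X \<inter> D' | D'. D' \<in> sets F}"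
      then have "D\<^sub>1 = {} \<or> D\<^sub>1 = X" using sets.sets_into_space[OF X(1)] by (auto simp: setsF spN)
      then show "measure N (sym_diff E D\<^sub>1) > 0"
      proof
        assume "D\<^sub>1 = X"
        have "measure N (X' - E) \<le> measure N (sym_diff E D\<^sub>1)"
          using E X X' \<open>D\<^sub>1 = X\<close> by (intro N.finite_measure_mono) (auto simp: X'_def setsN)
        with p2 show ?thesis by simp
      qed (use p1 in simp)
    qed (use E setsN in simp)
  qed
  define T where "T = measure N (space M)"
  have DN: "D \<in> sets N" "measure N D = (\<integral>x\<in>D. H x \<partial>M)" using D mN by (auto simp: setsN)
  have DT: "measure N D \<le> T" unfolding T_def using N.bounded_measure[of D] by (simp add: spN)
  have T0: "v / T * T = v" using v DN DT by (cases "T = 0") auto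
  have Tpos: "0 \<le> T" by (simp add: T_def)
  have le: "(\<integral>x\<in>C. v / T \<partial>N) \<le> measure N (D \<inter> C)" if "C \<in> sets F" for C
  proof -
    have "C = {} \<or> C = space N" using that by (auto simp: setsF spN)
    then show ?thesis
    proof
      assume C: "C = space N"
      then have "(\<integral>x\<in>C. v / T \<partial>N) = v / T * T"
        by (simp add: set_lebesgue_integral_def T_def spN mult.commute)
      then show ?thesis using T0 v(2) DN sets.sets_into_space[OF DN(1)] C by (simp add: Int_absorb2)
    qed (simp add: set_lebesgue_integral_def)
  qed
  have "\<exists>E\<in>sets N. E \<subseteq> D \<and> (\<forall>C\<in>sets F. measure N (E \<inter> C) = (\<integral>x\<in>C. v / T \<partial>N))"
    by (rule nowhere_equivalent_exists_subset_with_density[OF N.finite_measure_axioms F ne DN(1)])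
      (use le v(1) Tpos in auto)
  then obtain E where E: "E \<in> sets N" "E \<subseteq> D" "\<And>C. C \<in> sets F \<Longrightarrow> measure N (E \<inter> C) = (\<integral>x\<in>C. v / T \<partial>N)"
    by blast
  have "measure N (E \<inter> space N) = v / T * T"
    using E(3)[of "space M"] by (simp add: setsF set_lebesgue_integral_def T_def spN mult.commute)
  then have "measure N E = v" using sets.sets_into_space[OF E(1)] T0 by (simp add: Int_absorb2)
  then show ?thesis using E mN setsN by auto
qed


text \<open>Here \<open>h a i\<close> is the weight that \<open>i\<close> gives to column \<open>a\<close>, and \<open>c\<close> is a pure choice among the columns up to \<open>n\<close>
which carries the total weight of each of them when \<open>i\<close> counts with the sum of its first weights. To
merge the next column, let it take over, inside \<open>{c = a}\<close>, a set \<open>E a\<close> whose new mass is exactly the mass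
that the new column brings into \<open>{c = a}\<close>: column \<open>a\<close> then keeps its total. Points whose first weights
vanish count for nothing so far and go to the new column.\<close>

lemma purification_step:
  fixes h :: "nat \<Rightarrow> 'i \<Rightarrow> real" and c :: "'i \<Rightarrow> nat"
  assumes M: "finite_measure M" and at: "atomless M"
    and h: "\<And>a. integrable M (h a)" "\<And>a i. 0 \<le> h a i"
    and c: "c \<in> measurable M (count_space UNIV)" "\<And>i. c i \<le> n"
    and mass: "\<And>a. a \<le> n \<Longrightarrow> (\<integral>i\<in>{i\<in>space M. c i = a}. (\<Sum>b\<le>n. h b i) \<partial>M) = (\<integral>i. h a i \<partial>M)"
    and supp: "\<And>i. i \<in> space M \<Longrightarrow> (\<Sum>b\<le>n. h b i) = 0 \<or> 0 < h (c i) i"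
  shows "\<exists>c'\<in>measurable M (count_space UNIV). (\<forall>i. c' i = c i \<or> c' i = Suc n) \<and>
    (\<forall>a\<le>Suc n. (\<integral>i\<in>{i\<in>space M. c' i = a}. (\<Sum>b\<le>Suc n. h b i) \<partial>M) = (\<integral>i. h a i \<partial>M)) \<and>
    (\<forall>i\<in>space M. (\<Sum>b\<le>Suc n. h b i) = 0 \<or> 0 < h (c' i) i)"
proof -
  interpret finite_measure M by fact
  note c(1)[measurable]
  have hm[measurable]: "h a \<in> borel_measurable M" for a using h(1)[of a] by simp
  define H where "H m i = (\<Sum>b\<le>m. h b i)" for m i
  have Hint: "integrable M (H m)" for m unfolding H_def using h(1) by simp
  have Hm[measurable]: "H m \<in> borel_measurable M" for m using Hint[of m] by simp
  have Hpos: "0 \<le> H m i" for m i unfolding H_def using h(2) by (intro sum_nonneg) auto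
  have HS: "H (Suc n) i = H n i + h (Suc n) i" for i by (simp add: H_def)
  have Hge: "h a i \<le> H n i" if "a \<le> n" for a i
    unfolding H_def using that h(2) by (intro member_le_sum) auto
  note SI = integrable_imp_set_integrable[OF h(1)] integrable_imp_set_integrable[OF Hint]
  define D where "D a = {i\<in>space M. c i = a}" for a
  define P where "P a = {i\<in>space M. c i = a \<and> 0 < H n i}" for a
  define Q where "Q a = {i\<in>space M. c i = a \<and> 0 < H n i \<and> 0 < h (Suc n) i}" for a
  have sets[measurable]: "D a \<in> sets M" "P a \<in> sets M" "Q a \<in> sets M" for a
    unfolding D_def P_def Q_def by measurable
  have "\<exists>E\<in>sets M. E \<subseteq> Q a \<and> (\<integral>i\<in>E. H (Suc n) i \<partial>M) = (\<integral>i\<in>P a. h (Suc n) i \<partial>M)" for a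
  proof (rule atomless_exists_subset_with_integral[OF M at Hint])
    show "0 \<le> (\<integral>i\<in>P a. h (Suc n) i \<partial>M)"
      unfolding set_lebesgue_integral_def using h(2) by (intro Bochner_Integration.integral_nonneg) (auto simp: indicator_def)
    have "(\<integral>i\<in>P a. h (Suc n) i \<partial>M) = (\<integral>i\<in>Q a. h (Suc n) i \<partial>M)"
      unfolding set_lebesgue_integral_def using h(2)[of "Suc n"]
      by (intro Bochner_Integration.integral_cong) (auto simp: indicator_def P_def Q_def order_less_le)
    also have "\<dots> \<le> (\<integral>i\<in>Q a. H (Suc n) i \<partial>M)"
      by (intro set_integral_mono SI sets) (simp add: HS Hpos)
    finally show "(\<integral>i\<in>P a. h (Suc n) i \<partial>M) \<le> (\<integral>i\<in>Q a. H (Suc n) i \<partial>M)" .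
  qed (auto simp: Hpos)
  then have "\<forall>a. \<exists>E. E \<in> sets M \<and> E \<subseteq> Q a \<and> (\<integral>i\<in>E. H (Suc n) i \<partial>M) = (\<integral>i\<in>P a. h (Suc n) i \<partial>M)"
    by blast
  then obtain E where E[measurable]: "\<And>a. E a \<in> sets M" and EQ: "\<And>a. E a \<subseteq> Q a"
    and Eint: "\<And>a. (\<integral>i\<in>E a. H (Suc n) i \<partial>M) = (\<integral>i\<in>P a. h (Suc n) i \<partial>M)"
    by (auto simp only: choice_iff)
  define c' where "c' i = (if H n i = 0 \<or> i \<in> E (c i) then Suc n else c i)" for i
  have Ec: "{i\<in>space M. i \<in> E (c i)} = (\<Union>a. E a \<inter> D a)"
    using EQ by (auto simp: D_def Q_def)
  have [measurable]: "{i\<in>space M. i \<in> E (c i)} \<in> sets M" unfolding Ec by measurable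
  have c'm[measurable]: "c' \<in> measurable M (count_space UNIV)"
    unfolding c'_def by measurable
  have c': "c' i = c i \<or> c' i = Suc n" for i by (auto simp: c'_def)
  have le: "c' i \<le> Suc n" for i using c'[of i] c(2)[of i] by auto
  have old: "(\<integral>i\<in>{i\<in>space M. c' i = a}. H (Suc n) i \<partial>M) = (\<integral>i. h a i \<partial>M)" if a: "a \<le> n" for a
  proof -
    have "{i\<in>space M. c' i = a} = P a - E a"
      using EQ[of a] a Hpos[of n] by (auto simp: c'_def P_def Q_def order_less_le)
    moreover have "(\<integral>i\<in>P a. H (Suc n) i \<partial>M) = (\<integral>i\<in>P a - E a. H (Suc n) i \<partial>M) + (\<integral>i\<in>E a. H (Suc n) i \<partial>M)"
    proof -
      have "P a = (P a - E a) \<union> E a" using EQ[of a] by (auto simp: P_def Q_def)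
      then show ?thesis by (metis (no_types, lifting) Diff_disjoint E SI(2) inf_commute set_integral_Un sets(2) sets.Diff)
    qed
    moreover have "(\<integral>i\<in>P a. H (Suc n) i \<partial>M) = (\<integral>i\<in>P a. H n i \<partial>M) + (\<integral>i\<in>P a. h (Suc n) i \<partial>M)"
      unfolding HS by (intro set_integral_add SI sets)
    moreover have "(\<integral>i\<in>P a. H n i \<partial>M) = (\<integral>i\<in>D a. H n i \<partial>M)"
      unfolding set_lebesgue_integral_def using Hpos[of n]
      by (intro Bochner_Integration.integral_cong) (auto simp: indicator_def P_def D_def order_less_le)
    ultimately show ?thesis using Eint[of a] mass[OF a] by (simp add: D_def H_def)
  qed
  \<comment> \<open>The mass of the new column follows from conservation of the total mass.\<close>
  have tot: "(\<Sum>a\<le>Suc n. \<integral>i\<in>{i\<in>space M. c' i = a}. H (Suc n) i \<partial>M) = (\<Sum>a\<le>Suc n. \<integral>i. h a i \<partial>M)"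
  proof -
    have "(\<Sum>a\<le>Suc n. \<integral>i\<in>{i\<in>space M. c' i = a}. H (Suc n) i \<partial>M) =
        (\<integral>i\<in>(\<Union>a\<in>{..Suc n}. {i\<in>space M. c' i = a}). H (Suc n) i \<partial>M)"
      by (intro set_integral_finite_Union[symmetric] SI) (auto simp: disjoint_family_on_def)
    also have "(\<Union>a\<in>{..Suc n}. {i\<in>space M. c' i = a}) = space M" using le by auto
    also have "(\<integral>i\<in>space M. H (Suc n) i \<partial>M) = (\<integral>i. H (Suc n) i \<partial>M)"
      by (rule set_integral_space[OF Hint])
    also have "\<dots> = (\<Sum>a\<le>Suc n. \<integral>i. h a i \<partial>M)"
      unfolding H_def using h(1) by (intro Bochner_Integration.integral_sum) auto
    finally show ?thesis .
  qed
  have "(\<integral>i\<in>{i\<in>space M. c' i = a}. H (Suc n) i \<partial>M) = (\<integral>i. h a i \<partial>M)" if "a \<le> Suc n" for a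
    using old tot that by (cases "a = Suc n") auto
  moreover have "H (Suc n) i = 0 \<or> 0 < h (c' i) i" if i: "i \<in> space M" for i
  proof (cases "H n i = 0")
    case True
    then show ?thesis using h(2)[of "Suc n" i] by (auto simp: c'_def HS)
  next
    case False
    then have "0 < h (c i) i" using supp[OF i] by (simp add: H_def)
    then show ?thesis using False EQ[of "c i"] by (auto simp: c'_def Q_def)
  qed
  ultimately show ?thesis using c' c'm unfolding H_def by blast
qed

text \<open>Merge the columns one after the other. The total weights are right at every stage, so all that can go
wrong is that the choice at a point changes forever. Where the partial sums exceed \<open>1 / 2\<close>, a change
to column \<open>n + 1\<close> happens on a set of measure at most twice the integral of that column. These
integrals are summable, and the partial sums tend to \<open>1\<close>; so by Borel and Cantelli almost every point
changes its choice only finitely often.\<close>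

theorem countable_purification:
  fixes h :: "nat \<Rightarrow> 'i \<Rightarrow> real"
  assumes M: "finite_measure M" and at: "atomless M"
    and hm: "\<And>a. h a \<in> borel_measurable M" and h0: "\<And>a i. 0 \<le> h a i"
    and h1: "\<And>i. (\<lambda>a. h a i) sums 1"
  shows "\<exists>c\<in>measurable M (count_space UNIV).
    (\<forall>a. measure M {i\<in>space M. c i = a} = (\<integral>i. h a i \<partial>M)) \<and> (AE i in M. 0 < h (c i) i)"
proof -
  interpret finite_measure M by fact
  note hm[measurable]
  define H where "H m i = (\<Sum>b\<le>m. h b i)" for m i
  have Hm[measurable]: "H m \<in> borel_measurable M" for m unfolding H_def by measurable
  have H0: "0 \<le> H m i" for m i unfolding H_def using h0 by (intro sum_nonneg) auto
  have Hlim: "(\<lambda>m. H m i) \<longlonglongrightarrow> 1" for i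
    using h1[of i] unfolding H_def sums_def_le .
  have Hmono: "H m i \<le> H m' i" if "m \<le> m'" for m m' i
    unfolding H_def using that h0 by (intro sum_mono2) auto
  have H1: "H m i \<le> 1" for m i
    using Hlim[of i] Hmono by (intro LIMSEQ_le_const) auto
  have hH: "h a i \<le> H a i" for a i unfolding H_def using h0 by (intro member_le_sum) auto
  have hle1: "h a i \<le> 1" for a i using hH[of a i] H1[of a i] by simp
  have hint: "integrable M (h a)" for a
    using h0 hle1 by (intro integrable_const_bound[of _ 1]) auto
  have Hint: "integrable M (H a)" for a
    using H0 H1 by (intro integrable_const_bound[of _ 1]) auto
  define good where "good n c \<longleftrightarrow> c \<in> measurable M (count_space UNIV) \<and> (\<forall>i. c i \<le> n) \<and>
    (\<forall>a\<le>n. (\<integral>i\<in>{i\<in>space M. c i = a}. H n i \<partial>M) = (\<integral>i. h a i \<partial>M)) \<and>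
    (\<forall>i\<in>space M. H n i = 0 \<or> 0 < h (c i) i)" for n and c :: "'i \<Rightarrow> nat"
  have "\<exists>c. \<forall>n. good n (c n) \<and> (\<forall>i. c (Suc n) i = c n i \<or> c (Suc n) i = Suc n)"
  proof (rule dependent_nat_choice)
    have "(\<integral>i\<in>space M. h 0 i \<partial>M) = (\<integral>i. h 0 i \<partial>M)" by (rule set_integral_space[OF hint])
    then have "good 0 (\<lambda>_. 0)"
      using h0 by (auto simp: good_def H_def order_less_le)
    then show "\<exists>c. good 0 c" by blast
  next
    fix c n assume g: "good n c"
    then have "\<exists>c'\<in>measurable M (count_space UNIV). (\<forall>i. c' i = c i \<or> c' i = Suc n) \<and>
      (\<forall>a\<le>Suc n. (\<integral>i\<in>{i\<in>space M. c' i = a}. (\<Sum>b\<le>Suc n. h b i) \<partial>M) = (\<integral>i. h a i \<partial>M)) \<and>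
      (\<forall>i\<in>space M. (\<Sum>b\<le>Suc n. h b i) = 0 \<or> 0 < h (c' i) i)"
      by (intro purification_step[OF M at hint h0, of c n]) (auto simp: good_def H_def)
    then obtain c' where c': "c' \<in> measurable M (count_space UNIV)" "\<And>i. c' i = c i \<or> c' i = Suc n"
      "\<And>a. a \<le> Suc n \<Longrightarrow> (\<integral>i\<in>{i\<in>space M. c' i = a}. H (Suc n) i \<partial>M) = (\<integral>i. h a i \<partial>M)"
      "\<And>i. i \<in> space M \<Longrightarrow> H (Suc n) i = 0 \<or> 0 < h (c' i) i"
      unfolding H_def by blast
    have "c' i \<le> Suc n" for i using c'(2)[of i] g unfolding good_def by (metis le_SucI order_refl)
    then have "good (Suc n) c'" using c' unfolding good_def by blast
    then show "\<exists>c'. good (Suc n) c' \<and> (\<forall>i. c' i = c i \<or> c' i = Suc n)" using c'(2) by blast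
  qed
  then obtain c where good: "\<And>n. good n (c n)" and step: "\<And>n i. c (Suc n) i = c n i \<or> c (Suc n) i = Suc n"
    by blast
  have cm[measurable]: "c n \<in> measurable M (count_space UNIV)" and cle: "c n i \<le> n"
    and mass: "a \<le> n \<Longrightarrow> (\<integral>i\<in>{i\<in>space M. c n i = a}. H n i \<partial>M) = (\<integral>i. h a i \<partial>M)"
    and supp: "i \<in> space M \<Longrightarrow> H n i = 0 \<or> 0 < h (c n i) i" for n a i
    using good[of n] by (auto simp: good_def)
  have sumh: "summable (\<lambda>a. \<integral>i. h a i \<partial>M)"
  proof (rule summableI_nonneg_bounded[where x = "measure M (space M)"])
    show "0 \<le> (\<integral>i. h a i \<partial>M)" for a using h0 by (intro Bochner_Integration.integral_nonneg) auto
    fix n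
    have "(\<Sum>a<n. \<integral>i. h a i \<partial>M) \<le> (\<Sum>a\<le>n. \<integral>i. h a i \<partial>M)"
      using h0 by (intro sum_mono2 Bochner_Integration.integral_nonneg) auto
    also have "\<dots> = (\<integral>i. H n i \<partial>M)" unfolding H_def using hint by simp
    also have "\<dots> \<le> (\<integral>i. 1 \<partial>M)" using Hint H1 by (intro integral_mono) auto
    finally show "(\<Sum>a<n. \<integral>i. h a i \<partial>M) \<le> measure M (space M)" by simp
  qed
  have stab: "AE i in M. 1 / 2 \<le> H m i \<longrightarrow> (\<forall>\<^sub>F n in sequentially. c (Suc n) i \<noteq> Suc n)" for m
  proof -
    define T where "T n = {i\<in>space M. 1 / 2 \<le> H m i \<and> c (Suc n) i = Suc n}" for n
    have [measurable]: "T n \<in> sets M" for n unfolding T_def by measurable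
    have bound: "measure M (T n) \<le> 2 * (\<integral>i. h (Suc n) i \<partial>M)" if "n \<ge> m" for n
    proof -
      have "measure M (T n) = (\<integral>i. indicator (T n) i \<partial>M)" by simp
      also have "\<dots> \<le> (\<integral>i. 2 * (indicator {i\<in>space M. c (Suc n) i = Suc n} i *\<^sub>R H (Suc n) i) \<partial>M)"
      proof (rule integral_mono)
        show "integrable M (\<lambda>i. 2 * (indicator {i\<in>space M. c (Suc n) i = Suc n} i *\<^sub>R H (Suc n) i))"
          using integrable_imp_set_integrable[OF Hint, of "{i\<in>space M. c (Suc n) i = Suc n}" "Suc n"]
          unfolding set_integrable_def by simp
        fix i
        have "H m i \<le> H (Suc n) i" using that by (intro Hmono) simp
        then show "indicator (T n) i \<le> 2 * (indicator {i\<in>space M. c (Suc n) i = Suc n} i *\<^sub>R H (Suc n) i)"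
          using H0[of "Suc n" i] by (auto simp: T_def indicator_def)
      qed (simp add: integrable_indicator_iff less_top[symmetric])
      also have "\<dots> = 2 * (\<integral>i\<in>{i\<in>space M. c (Suc n) i = Suc n}. H (Suc n) i \<partial>M)"
        unfolding set_lebesgue_integral_def by simp
      finally show ?thesis using mass[of "Suc n" "Suc n"] by simp
    qed
    have "summable (\<lambda>n. 2 * (\<integral>i. h (Suc n) i \<partial>M))"
      by (intro summable_mult summable_Suc_iff[THEN iffD2, OF sumh])
    then have "summable (\<lambda>n. measure M (T n))"
      by (rule summable_comparison_test_ev[rotated]) (use bound in \<open>auto simp: eventually_sequentially\<close>)
    then have "AE i in M. \<forall>\<^sub>F n in sequentially. i \<in> space M - T n"
      by (intro borel_cantelli_AE1) (auto simp: less_top[symmetric])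
    then show ?thesis
      by eventually_elim (auto simp: T_def elim: eventually_mono)
  qed
  have "AE i in M. \<forall>m. 1 / 2 \<le> H m i \<longrightarrow> (\<forall>\<^sub>F n in sequentially. c (Suc n) i \<noteq> Suc n)"
    unfolding AE_all_countable using stab by blast
  then have "AE i in M. \<forall>\<^sub>F n in sequentially. c (Suc n) i \<noteq> Suc n"
  proof eventually_elim
    case (elim i)
    have "\<forall>\<^sub>F m in sequentially. 1 / 2 < H m i" using Hlim[of i] by (rule order_tendstoD) simp
    then obtain m where "1 / 2 < H m i" by (auto dest: eventually_happens)
    with elim show ?case by (meson less_imp_le)
  qed
  then have conv: "AE i in M. \<exists>a. \<forall>\<^sub>F n in sequentially. c n i = a"
  proof eventually_elim
    case (elim i)
    then obtain N where N: "\<And>n. n \<ge> N \<Longrightarrow> c (Suc n) i = c n i"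
      using step unfolding eventually_sequentially by metis
    have "c n i = c N i" if "n \<ge> N" for n
      using that by (induction n rule: dec_induct) (auto simp: N)
    then show ?case unfolding eventually_sequentially by blast
  qed
  define l where "l i = nat \<lfloor>lim (\<lambda>n. real (c n i))\<rfloor>" for i
  have lm[measurable]: "l \<in> measurable M (count_space UNIV)" unfolding l_def by measurable
  have ev: "AE i in M. \<forall>\<^sub>F n in sequentially. c n i = l i"
    using conv
  proof eventually_elim
    case (elim i)
    then obtain a where a: "\<forall>\<^sub>F n in sequentially. c n i = a" by blast
    then have "(\<lambda>n. real (c n i)) \<longlonglongrightarrow> real a"
      by (intro tendsto_eventually) (auto elim: eventually_mono)
    then have "l i = a" by (simp add: l_def limI)
    with a show ?case by simp
  qed
  have "measure M {i\<in>space M. l i = a} = (\<integral>i. h a i \<partial>M)" for a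
  proof -
    have "(\<lambda>n. \<integral>i. indicator {i\<in>space M. c n i = a} i *\<^sub>R H n i \<partial>M) \<longlonglongrightarrow>
        (\<integral>i. indicator {i\<in>space M. l i = a} i \<partial>M)"
    proof (rule integral_dominated_convergence[where w = "\<lambda>_. 1"])
      show "AE i in M. (\<lambda>n. indicator {i\<in>space M. c n i = a} i *\<^sub>R H n i) \<longlonglongrightarrow> indicator {i\<in>space M. l i = a} i"
        using ev AE_space
      proof eventually_elim
        case (elim i)
        have "(\<lambda>n. (if l i = a then 1 else 0) * H n i) \<longlonglongrightarrow> (if l i = a then 1 else 0) * 1"
          by (intro tendsto_intros Hlim)
        moreover have "\<forall>\<^sub>F n in sequentially. (if l i = a then 1 else 0) * H n i =
            indicator {i\<in>space M. c n i = a} i *\<^sub>R H n i"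
          using elim(1) by eventually_elim (use elim(2) in \<open>auto simp: indicator_def\<close>)
        ultimately have "(\<lambda>n. indicator {i\<in>space M. c n i = a} i *\<^sub>R H n i) \<longlonglongrightarrow> (if l i = a then 1 else 0) * 1"
          by (rule Lim_transform_eventually)
        moreover have "(if l i = a then 1 else 0) * 1 = (indicator {i\<in>space M. l i = a} i :: real)"
          using elim(2) by simp
        ultimately show ?case by (simp only:)
      qed
      show "AE i in M. norm (indicator {i\<in>space M. c n i = a} i *\<^sub>R H n i) \<le> 1" for n
        using H0[of n] H1[of n] by (auto simp: indicator_def)
    qed auto
    moreover have "\<forall>\<^sub>F n in sequentially. (\<integral>i. indicator {i\<in>space M. c n i = a} i *\<^sub>R H n i \<partial>M) = (\<integral>i. h a i \<partial>M)"
      using eventually_ge_at_top[of a] by eventually_elim (use mass in \<open>simp add: set_lebesgue_integral_def\<close>)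
    then have "(\<lambda>n. \<integral>i. indicator {i\<in>space M. c n i = a} i *\<^sub>R H n i \<partial>M) \<longlonglongrightarrow> (\<integral>i. h a i \<partial>M)"
      by (rule tendsto_eventually)
    ultimately have "(\<integral>i. indicator {i\<in>space M. l i = a} i \<partial>M) = (\<integral>i. h a i \<partial>M)"
      by (rule LIMSEQ_unique)
    then show ?thesis by simp
  qed
  moreover have "AE i in M. 0 < h (l i) i"
    using ev AE_space
  proof eventually_elim
    case (elim i)
    have "\<forall>\<^sub>F n in sequentially. 0 < H n i" using Hlim[of i] by (rule order_tendstoD) simp
    with elim(1) have "\<forall>\<^sub>F n in sequentially. 0 < h (l i) i"
    proof eventually_elim
      case (elim n)
      then show ?case using supp[OF \<open>i \<in> space M\<close>, of n] by simp
    qed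
    then show ?case by simp
  qed
  ultimately show ?thesis using lm by blast
qed

section \<open>Densities of dominated charges\<close>

text \<open>Domination by \<open>M\<close> makes the charge continuous at the empty set, hence countably additive.\<close>

lemma charge_extension:
  fixes \<rho> :: "'a set \<Rightarrow> real"
  assumes M: "finite_measure M" and alg: "algebra (space M) \<C>" and sub: "\<C> \<subseteq> sets M"
    and nonneg: "\<And>C. C \<in> \<C> \<Longrightarrow> 0 \<le> \<rho> C"
    and le: "\<And>C. C \<in> \<C> \<Longrightarrow> \<rho> C \<le> measure M C"
    and add: "\<And>C D. C \<in> \<C> \<Longrightarrow> D \<in> \<C> \<Longrightarrow> C \<inter> D = {} \<Longrightarrow> \<rho> (C \<union> D) = \<rho> C + \<rho> D"
  shows "\<exists>N. space N = space M \<and> sets N = sigma_sets (space M) \<C> \<and> finite_measure N \<and>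
    (\<forall>C\<in>\<C>. measure N C = \<rho> C)"
proof -
  interpret finite_measure M by fact
  interpret A: algebra "space M" \<C> by fact
  have zero: "\<rho> {} = 0" using add[of "{}" "{}"] by auto
  have "\<exists>\<mu> :: 'a set \<Rightarrow> ennreal. (\<forall>s\<in>\<C>. \<mu> s = ennreal (\<rho> s)) \<and>
      measure_space (space M) (sigma_sets (space M) \<C>) \<mu>"
  proof (rule A.caratheodory_empty_continuous)
    show "positive \<C> (\<lambda>s. ennreal (\<rho> s))" by (simp add: positive_def zero)
    show "Measure_Space.additive \<C> (\<lambda>s. ennreal (\<rho> s))"
      unfolding Measure_Space.additive_def by (simp add: add nonneg ennreal_plus)
    fix E :: "nat \<Rightarrow> 'a set" assume E: "range E \<subseteq> \<C>" "decseq E" "(\<Inter>i. E i) = {}"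
    have "(\<lambda>i. measure M (E i)) \<longlonglongrightarrow> measure M (\<Inter>i. E i)"
      using E sub by (intro finite_Lim_measure_decseq) auto
    then have lim0: "(\<lambda>i. measure M (E i)) \<longlonglongrightarrow> 0" using E(3) by simp
    have "(\<lambda>i. \<rho> (E i)) \<longlonglongrightarrow> 0"
    proof (rule tendsto_sandwich[OF _ _ tendsto_const lim0])
      have EC: "E i \<in> \<C>" for i using E(1) by blast
      show "\<forall>\<^sub>F i in sequentially. 0 \<le> \<rho> (E i)" by (simp add: nonneg EC)
      show "\<forall>\<^sub>F i in sequentially. \<rho> (E i) \<le> measure M (E i)" by (simp add: le EC)
    qed
    then show "(\<lambda>i. ennreal (\<rho> (E i))) \<longlonglongrightarrow> 0"
      using tendsto_ennrealI[of "\<lambda>i. \<rho> (E i)" 0] by simp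
  qed simp
  then obtain \<mu> :: "'a set \<Rightarrow> ennreal" where \<mu>: "\<And>s. s \<in> \<C> \<Longrightarrow> \<mu> s = ennreal (\<rho> s)"
    "measure_space (space M) (sigma_sets (space M) \<C>) \<mu>" by blast
  define N where "N = measure_of (space M) \<C> \<mu>"
  have pow: "\<C> \<subseteq> Pow (space M)" by (rule A.space_closed)
  have em: "emeasure N s = ennreal (\<rho> s)" if "s \<in> \<C>" for s
    unfolding N_def using \<mu> that by (simp add: emeasure_measure_of_conv)
  have sp: "space N = space M" "sets N = sigma_sets (space M) \<C>"
    unfolding N_def using pow by (simp_all add: space_measure_of sets_measure_of)
  have "finite_measure N"
    by (rule finite_measureI) (simp add: sp em A.top)
  moreover have "measure N s = \<rho> s" if "s \<in> \<C>" for s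
    using em[OF that] nonneg[OF that] by (simp add: measure_def)
  ultimately show ?thesis using sp by blast
qed

text \<open>Extend both \<open>\<rho>\<close> and its complement in \<open>M\<close>. The two extensions sum to \<open>M\<close> on the generated
\<open>\<sigma>\<close>-algebra, which yields absolute continuity and bounds the density by \<open>1\<close>.\<close>

proposition dominated_charge_density:
  fixes \<rho> :: "'a set \<Rightarrow> real"
  assumes M: "finite_measure M" and alg: "algebra (space M) \<C>" and sub: "\<C> \<subseteq> sets M"
    and nonneg: "\<And>C. C \<in> \<C> \<Longrightarrow> 0 \<le> \<rho> C"
    and le: "\<And>C. C \<in> \<C> \<Longrightarrow> \<rho> C \<le> measure M C"
    and add: "\<And>C D. C \<in> \<C> \<Longrightarrow> D \<in> \<C> \<Longrightarrow> C \<inter> D = {} \<Longrightarrow> \<rho> (C \<union> D) = \<rho> C + \<rho> D"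
  shows "\<exists>h\<in>borel_measurable (sigma (space M) \<C>). (\<forall>x. 0 \<le> h x \<and> h x \<le> 1) \<and>
    (\<forall>C\<in>\<C>. (\<integral>x\<in>C. h x \<partial>M) = \<rho> C)"
proof -
  interpret finite_measure M by fact
  interpret A: algebra "space M" \<C> by fact
  define \<Sigma> where "\<Sigma> = sigma (space M) \<C>"
  have pow: "\<C> \<subseteq> Pow (space M)" by (rule A.space_closed)
  have stable: "Int_stable \<C>" using A.Int by (auto simp: Int_stable_def)
  have setsS: "sets \<Sigma> = sigma_sets (space M) \<C>" and spS: "space \<Sigma> = space M"
    unfolding \<Sigma>_def using pow by (simp_all add: space_measure_of sets_measure_of)
  have sigM: "sigma_sets (space M) \<C> \<subseteq> sets M" using sub by (rule sets.sigma_sets_subset)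
  have subalg: "subalgebra M \<Sigma>" using setsS spS sigM by (simp add: subalgebra_def)
  define R where "R = restr_to_subalg M \<Sigma>"
  have spR: "space R = space M" "sets R = sigma_sets (space M) \<C>"
    by (simp_all add: R_def space_restr_to_subalg sets_restr_to_subalg[OF subalg] setsS)
  have emR: "emeasure R S = emeasure M S" if "S \<in> sigma_sets (space M) \<C>" for S
    unfolding R_def using that by (simp add: emeasure_restr_to_subalg[OF subalg] setsS)
  interpret R: finite_measure R
    by (rule finite_measureI) (simp add: spR emR sigma_sets_top)
  have compl: "measure M C - \<rho> C \<ge> 0" "measure M C - \<rho> C \<le> measure M C" if "C \<in> \<C>" for C
    using le[OF that] nonneg[OF that] by auto
  have compl_add: "measure M (C \<union> D) - \<rho> (C \<union> D) = (measure M C - \<rho> C) + (measure M D - \<rho> D)"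
    if "C \<in> \<C>" "D \<in> \<C>" "C \<inter> D = {}" for C D
    using add[OF that] finite_measure_Union[of C D] that sub by auto
  obtain N where N: "space N = space M" "sets N = sigma_sets (space M) \<C>" "finite_measure N"
      "\<And>C. C \<in> \<C> \<Longrightarrow> measure N C = \<rho> C"
    using charge_extension[of M \<C> \<rho>, OF M alg sub nonneg le add] by blast
  obtain N' where N': "space N' = space M" "sets N' = sigma_sets (space M) \<C>" "finite_measure N'"
      "\<And>C. C \<in> \<C> \<Longrightarrow> measure N' C = measure M C - \<rho> C"
    using charge_extension[of M \<C> "\<lambda>C. measure M C - \<rho> C", OF M alg sub compl compl_add] by blast
  interpret N: finite_measure N by fact
  interpret N': finite_measure N' by fact
  have sum: "measure N S + measure N' S = measure R S" if "S \<in> sigma_sets (space M) \<C>" for S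
    using stable pow that
  proof (induction rule: sigma_sets_induct_disjoint)
    case (basic S)
    then have "measure R S = measure M S" using emR[of S] by (simp add: measure_def)
    with basic show ?case by (simp add: N(4) N'(4))
  next
    case (compl S)
    have top: "measure N (space M) + measure N' (space M) = measure R (space M)"
      using emR[of "space M"] A.top N(4)[OF A.top] N'(4)[OF A.top] by (simp add: measure_def sigma_sets_top)
    show ?case
      using compl top N.finite_measure_compl[of S] N'.finite_measure_compl[of S] R.finite_measure_compl[of S]
      by (simp add: N N' spR)
  next
    case (union E)
    then have E: "range E \<subseteq> sets N" "range E \<subseteq> sets N'" "range E \<subseteq> sets R" by (auto simp: N N' spR)
    have "(\<lambda>i. measure N (E i) + measure N' (E i)) sums (measure N (\<Union>i. E i) + measure N' (\<Union>i. E i))"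
      using union E by (intro sums_add N.finite_measure_UNION N'.finite_measure_UNION)
    moreover have "(\<lambda>i. measure R (E i)) sums measure R (\<Union>i. E i)"
      using union E by (intro R.finite_measure_UNION)
    ultimately show ?case using union by (simp add: sums_unique2)
  qed simp
  have density: "\<exists>f\<in>borel_measurable R. density R f = K"
    if K: "finite_measure K" "sets K = sigma_sets (space M) \<C>"
      and le: "\<And>S. S \<in> sigma_sets (space M) \<C> \<Longrightarrow> measure K S \<le> measure R S" for K
  proof -
    interpret K: finite_measure K by fact
    have "absolutely_continuous R K"
      unfolding absolutely_continuous_def
    proof
      fix S assume "S \<in> null_sets R"
      then have S: "S \<in> sets R" "measure R S = 0" by (auto simp: null_sets_def measure_def)
      then have "measure K S = 0" using le[of S] by (simp add: spR measure_le_0_iff)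
      then show "S \<in> null_sets K" using S(1) by (auto simp: null_sets_def K spR K.emeasure_eq_measure)
    qed
    then show ?thesis using R.Radon_Nikodym_finite_measure[OF K(1)] K spR by blast
  qed
  obtain f where f[measurable]: "f \<in> borel_measurable R" and fN: "density R f = N"
    using density[OF N(3,2)] sum by (metis le_add_same_cancel1 measure_nonneg)
  obtain f' where f'[measurable]: "f' \<in> borel_measurable R" and fN': "density R f' = N'"
    using density[OF N'(3,2)] sum by (metis le_add_same_cancel2 measure_nonneg)
  have "density R (\<lambda>x. f x + f' x) = density R (\<lambda>_. 1)"
  proof (rule measure_eqI)
    fix S assume "S \<in> sets (density R (\<lambda>x. f x + f' x))"
    then have S[measurable]: "S \<in> sets R" by simp
    have "emeasure (density R (\<lambda>x. f x + f' x)) S = emeasure N S + emeasure N' S"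
      unfolding fN[symmetric] fN'[symmetric] using S
      by (simp add: emeasure_density nn_integral_add distrib_right)
    also have "\<dots> = emeasure R S"
      using sum[of S] S by (simp add: N.emeasure_eq_measure N'.emeasure_eq_measure R.emeasure_eq_measure spR
          flip: ennreal_plus)
    finally show "emeasure (density R (\<lambda>x. f x + f' x)) S = emeasure (density R (\<lambda>_. 1)) S"
      by (simp add: density_1)
  qed simp
  then have "AE x in R. f x + f' x = 1"
    by (subst (asm) R.density_unique_iff) auto
  then have f1: "AE x in R. f x \<le> 1"
    by eventually_elim (metis le_iff_add)
  define h where "h x = min 1 (enn2real (f x))" for x
  have "h \<in> borel_measurable R" unfolding h_def by measurable
  then have hS[measurable]: "h \<in> borel_measurable \<Sigma>"
    using measurable_cong_sets[of R \<Sigma> borel borel] spR setsS by auto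
  have hM[measurable]: "h \<in> borel_measurable M" by (rule measurable_from_subalg[OF subalg hS])
  have h01: "0 \<le> h x" "h x \<le> 1" for x by (auto simp: h_def)
  have "(\<integral>x\<in>C. h x \<partial>M) = \<rho> C" if C: "C \<in> \<C>" for C
  proof -
    have CS[measurable]: "C \<in> sets \<Sigma>" "C \<in> sets R" "C \<in> sets M"
      using C setsS spR sub by auto
    have "(\<integral>x\<in>C. h x \<partial>M) = enn2real (\<integral>\<^sup>+x. ennreal (indicator C x * h x) \<partial>M)"
      unfolding set_lebesgue_integral_def
      by (subst integral_eq_nn_integral) (auto simp: h01)
    also have "(\<integral>\<^sup>+x. ennreal (indicator C x * h x) \<partial>M) = (\<integral>\<^sup>+x. ennreal (indicator C x * h x) \<partial>R)"
      unfolding R_def by (rule nn_integral_subalgebra2[OF subalg, symmetric]) simp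
    also have "\<dots> = (\<integral>\<^sup>+x. f x * indicator C x \<partial>R)"
    proof (rule nn_integral_cong_AE)
      show "AE x in R. ennreal (indicator C x * h x) = f x * indicator C x"
        using f1
      proof eventually_elim
        case (elim x)
        then have "f x < top" by (simp add: le_less_trans[OF _ ennreal_one_less_top])
        then have "ennreal (enn2real (f x)) = f x" by simp
        moreover have "enn2real (f x) \<le> 1" using elim by (simp add: enn2real_leI)
        ultimately show ?case by (simp add: h_def indicator_def min_absorb2)
      qed
    qed
    also have "\<dots> = emeasure N C" unfolding fN[symmetric] by (simp add: emeasure_density)
    finally show ?thesis using N(4)[OF C] by (simp add: measure_def)
  qed
  with hS h01 show ?thesis unfolding \<Sigma>_def by blast
qed

text \<open>This makes the densities of an additive family of charges additive almost everywhere.\<close>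

lemma AE_eq_if_integrals_eq_on_algebra:
  fixes f g :: "'a \<Rightarrow> real"
  assumes M: "finite_measure M" and alg: "algebra (space M) \<C>" and sub: "\<C> \<subseteq> sets M"
    and f: "f \<in> borel_measurable (sigma (space M) \<C>)" "integrable M f"
    and g: "g \<in> borel_measurable (sigma (space M) \<C>)" "integrable M g"
    and eq: "\<And>C. C \<in> \<C> \<Longrightarrow> (\<integral>x\<in>C. f x \<partial>M) = (\<integral>x\<in>C. g x \<partial>M)"
  shows "AE x in M. f x = g x"
proof -
  interpret finite_measure M by fact
  interpret A: algebra "space M" \<C> by fact
  define \<Sigma> where "\<Sigma> = sigma (space M) \<C>"
  have pow: "\<C> \<subseteq> Pow (space M)" by (rule A.space_closed)
  have stable: "Int_stable \<C>" using A.Int by (auto simp: Int_stable_def)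
  have setsS: "sets \<Sigma> = sigma_sets (space M) \<C>" and spS: "space \<Sigma> = space M"
    unfolding \<Sigma>_def using pow by (simp_all add: space_measure_of sets_measure_of)
  have sigM: "sigma_sets (space M) \<C> \<subseteq> sets M" using sub by (rule sets.sigma_sets_subset)
  have subalg: "subalgebra M \<Sigma>" using setsS spS sigM by (simp add: subalgebra_def)
  define R where "R = restr_to_subalg M \<Sigma>"
  have setsR: "sets R = sets \<Sigma>" by (simp add: R_def sets_restr_to_subalg[OF subalg])
  have fS[measurable]: "f \<in> borel_measurable \<Sigma>" "g \<in> borel_measurable \<Sigma>"
    using f g by (simp_all add: \<Sigma>_def)
  have SI: "set_integrable M S f" "set_integrable M S g" if "S \<in> sigma_sets (space M) \<C>" for S
    using that sigM f g by (auto intro!: integrable_imp_set_integrable)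
  have eqS: "(\<integral>x\<in>S. f x \<partial>M) = (\<integral>x\<in>S. g x \<partial>M)" if "S \<in> sigma_sets (space M) \<C>" for S
    using stable pow that
  proof (induction rule: sigma_sets_induct_disjoint)
    case (basic S) then show ?case by (rule eq)
  next
    case (compl S)
    have d: "(\<integral>x\<in>space M - S. k x \<partial>M) = (\<integral>x\<in>space M. k x \<partial>M) - (\<integral>x\<in>S. k x \<partial>M)"
      if "integrable M k" for k :: "'a \<Rightarrow> real"
    proof -
      have S: "S \<in> sets M" using compl sigM by auto
      have "(\<integral>x\<in>S \<union> (space M - S). k x \<partial>M) = (\<integral>x\<in>S. k x \<partial>M) + (\<integral>x\<in>space M - S. k x \<partial>M)"
        using S that by (intro set_integral_Un integrable_imp_set_integrable) auto
      moreover have "S \<union> (space M - S) = space M" using sets.sets_into_space[OF S] by auto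
      ultimately show ?thesis by simp
    qed
    show ?case using d[OF f(2)] d[OF g(2)] compl.IH eq[OF A.top] by simp
  next
    case (union E)
    have E: "E i \<in> sigma_sets (space M) \<C>" for i using union by auto
    then have U: "(\<Union>i. E i) \<in> sigma_sets (space M) \<C>" by (rule sigma_sets.Union)
    have dis: "\<And>i j. i \<noteq> j \<Longrightarrow> E i \<inter> E j = {}" using union by (auto simp: disjoint_family_on_def)
    have EM: "\<And>i. E i \<in> sets M" using E sigM by auto
    show ?case
      using lebesgue_integral_countable_add[OF EM dis SI(1)[OF U]]
        lebesgue_integral_countable_add[OF EM dis SI(2)[OF U]] union.IH by simp
  qed (simp add: set_lebesgue_integral_def)
  have "AE x in R. f x = g x"
  proof (rule density_unique_real)
    show "integrable R f" "integrable R g"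
      unfolding R_def using f g by (auto intro!: integrable_in_subalg[OF subalg] fS)
    fix S assume "S \<in> sets R"
    then have S: "S \<in> sets \<Sigma>" by (simp add: setsR)
    have "(\<integral>x\<in>S. k x \<partial>R) = (\<integral>x\<in>S. k x \<partial>M)" if [measurable]: "k \<in> borel_measurable \<Sigma>" for k :: "'a \<Rightarrow> real"
      unfolding R_def set_lebesgue_integral_def using S by (intro integral_subalgebra2[OF subalg]) simp
    then show "(\<integral>x\<in>S. f x \<partial>R) = (\<integral>x\<in>S. g x \<partial>R)" using eqS[of S] S by (simp add: setsS fS)
  qed
  then show ?thesis unfolding R_def by (rule AE_restr_to_subalg[OF subalg])
qed

section \<open>Weak convergence and codes of points\<close>

abbreviation mass :: "'a::topological_space borel_prob \<Rightarrow> 'a set \<Rightarrow> real" where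
  "mass \<mu> \<equiv> measure (meas \<mu>)"

lemma space_meas [simp]: "space (meas \<mu>) = UNIV"
  by (simp add: sets_eq_imp_space_eq[OF sets_meas])

lemma finite_measure_meas: "finite_measure (meas \<mu>)"
  using prob_space_meas[of \<mu>] by (rule prob_space.finite_measure)

lemma integrable_bcontfun:
  fixes \<phi> :: "'a::topological_space \<Rightarrow>\<^sub>C real"
  shows "integrable (meas \<mu>) (apply_bcontfun \<phi>)"
proof -
  have "apply_bcontfun \<phi> \<in> borel_measurable borel"
    by (intro borel_measurable_continuous_onI) (simp add: continuous_on_apply_bcontfun)
  then show ?thesis
    using norm_bounded[of \<phi>] finite_measure_meas[of \<mu>]
    by (intro finite_measure.integrable_const_bound[of _ _ "norm \<phi>"]) auto
qed

lemma integrable_meas_bounded: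
  fixes f :: "'a::topological_space \<Rightarrow> real"
  assumes "f \<in> borel_measurable borel" "\<And>x. \<bar>f x\<bar> \<le> B"
  shows "integrable (meas \<mu>) f"
  using assms finite_measure_meas[of \<mu>] by (intro finite_measure.integrable_const_bound[of _ _ B]) auto

lemma exists_bcontfun:
  fixes f :: "'a::topological_space \<Rightarrow> real"
  assumes "continuous_on UNIV f" "\<And>x. \<bar>f x\<bar> \<le> B"
  shows "\<exists>\<phi> :: 'a \<Rightarrow>\<^sub>C real. apply_bcontfun \<phi> = f"
proof -
  have "f \<in> bcontfun"
    using assms by (auto simp: bcontfun_def bounded_iff)
  then show ?thesis by (metis Bcontfun_inverse)
qed

text \<open>For nonempty \<open>S\<close> the functions \<open>max 0 (1 - k * infdist x S)\<close> decrease to the indicator of \<open>S\<close> as \<open>k\<close> grows.\<close>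

lemma closed_approx_bcontfun:
  fixes S :: "'a::metric_space set"
  assumes S: "closed S" "mass \<mu> S < c"
  shows "\<exists>\<phi> :: 'a \<Rightarrow>\<^sub>C real. (\<forall>x. indicator S x \<le> \<phi> x) \<and> (\<integral>x. \<phi> x \<partial>meas \<mu>) < c"
proof (cases "S = {}")
  case True
  then show ?thesis using S by (intro exI[of _ 0]) auto
next
  case False
  interpret prob_space "meas \<mu>" by (rule prob_space_meas)
  have [measurable]: "S \<in> sets borel" using S(1) by simp
  define f where "f k x = max 0 (1 - real k * infdist x S)" for k x
  have cont: "continuous_on UNIV (f k)" for k
    unfolding f_def by (intro continuous_intros)
  have [measurable]: "f k \<in> borel_measurable borel" for k
    using cont by (rule borel_measurable_continuous_onI)
  have bd: "\<bar>f k x\<bar> \<le> 1" for k x unfolding f_def by (simp add: infdist_nonneg)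
  have lim: "(\<lambda>k. f k x) \<longlonglongrightarrow> indicator S x" for x
  proof (cases "x \<in> S")
    case True
    then have "f k x = 1" for k by (simp add: f_def)
    then show ?thesis using True by simp
  next
    case xS: False
    then have pos: "infdist x S > 0"
      using in_closed_iff_infdist_zero[OF S(1) False, of x] infdist_nonneg[of x S] by linarith
    have "\<forall>\<^sub>F k in sequentially. 1 / infdist x S < real k"
      using filterlim_real_sequentially by (auto simp: filterlim_at_top_dense)
    then have "\<forall>\<^sub>F k in sequentially. f k x = 0"
    proof eventually_elim
      case (elim k)
      then have "1 < real k * infdist x S" using pos by (simp add: field_simps)
      then show ?case by (simp add: f_def)
    qed
    then show ?thesis using xS by (simp add: tendsto_eventually)
  qed
  have "(\<lambda>k. \<integral>x. f k x \<partial>meas \<mu>) \<longlonglongrightarrow> (\<integral>x. indicator S x \<partial>meas \<mu>)"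
    using bd lim by (intro integral_dominated_convergence[where w = "\<lambda>_. 1"]) auto
  then have "\<forall>\<^sub>F k in sequentially. (\<integral>x. f k x \<partial>meas \<mu>) < c"
    using S(2) by (intro order_tendstoD(2)) auto
  then obtain k where k: "(\<integral>x. f k x \<partial>meas \<mu>) < c" by (auto dest: eventually_happens)
  obtain \<phi> :: "'a \<Rightarrow>\<^sub>C real" where \<phi>: "apply_bcontfun \<phi> = f k"
    using exists_bcontfun[OF cont bd] by blast
  show ?thesis
    using k by (intro exI[of _ \<phi>]) (auto simp: \<phi> f_def indicator_def)
qed

lemma measure_le_integral_bcontfun:
  fixes S :: "'a::topological_space set" and \<phi> :: "'a \<Rightarrow>\<^sub>C real"
  assumes "S \<in> sets borel" "\<And>x. indicator S x \<le> \<phi> x"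
  shows "mass \<nu> S \<le> (\<integral>x. \<phi> x \<partial>meas \<nu>)"
proof -
  have "mass \<nu> S = (\<integral>x. indicator S x \<partial>meas \<nu>)" using assms by simp
  also have "\<dots> \<le> (\<integral>x. \<phi> x \<partial>meas \<nu>)"
    using assms by (intro integral_mono integrable_bcontfun integrable_meas_bounded[of _ 1]) auto
  finally show ?thesis .
qed

lemma weak_limit_closed:
  fixes S :: "'a::metric_space set"
  assumes "(\<nu> \<longlongrightarrow> \<mu>) F" "closed S" "mass \<mu> S < c"
  shows "\<forall>\<^sub>F n in F. mass (\<nu> n) S < c"
proof -
  obtain \<phi> :: "'a \<Rightarrow>\<^sub>C real" where \<phi>: "\<And>x. indicator S x \<le> \<phi> x"
      "(\<integral>x. \<phi> x \<partial>meas \<mu>) < c"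
    using closed_approx_bcontfun[OF assms(2,3)] by blast
  have "\<forall>\<^sub>F n in F. (\<integral>x. \<phi> x \<partial>meas (\<nu> n)) < c"
    using assms(1) \<phi>(2) unfolding tendsto_borel_prob_iff by (intro order_tendstoD(2)) auto
  then show ?thesis
    by eventually_elim (use measure_le_integral_bcontfun[of S \<phi>] \<phi>(1) assms(2) in \<open>force intro: le_less_trans\<close>)
qed

text \<open>The part of the portmanteau theorem that is needed, along an arbitrary filter because limits are
later taken along a filter finer than \<open>sequentially\<close>.\<close>

proposition weak_limit_continuity_set:
  fixes C :: "'a::metric_space set"
  assumes lim: "(\<nu> \<longlongrightarrow> \<mu>) F" and C: "C \<in> sets borel" "mass \<mu> (frontier C) = 0"
  shows "((\<lambda>n. mass (\<nu> n) C) \<longlongrightarrow> mass \<mu> C) F"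
proof (rule order_tendstoI)
  have half: "\<forall>\<^sub>F n in F. mass (\<nu> n) B < c"
    if B: "B \<in> sets borel" "mass \<mu> (frontier B) = 0" "mass \<mu> B < c" for B c
  proof -
    interpret prob_space "meas \<mu>" by (rule prob_space_meas)
    have "mass \<mu> (closure B) \<le> mass \<mu> (B \<union> frontier B)"
      using B(1) by (intro finite_measure_mono) (auto simp: closure_Un_frontier frontier_closed)
    also have "\<dots> \<le> mass \<mu> B + mass \<mu> (frontier B)"
      using B by (intro measure_Un_le) (auto simp: frontier_def)
    finally have "mass \<mu> (closure B) < c" using B by simp
    from weak_limit_closed[OF lim closed_closure this] show ?thesis
    proof eventually_elim
      case (elim n)
      interpret n: prob_space "meas (\<nu> n)" by (rule prob_space_meas)
      have "mass (\<nu> n) B \<le> mass (\<nu> n) (closure B)"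
        by (intro n.finite_measure_mono closure_subset) simp
      with elim show ?case by simp
    qed
  qed
  show "\<forall>\<^sub>F n in F. mass (\<nu> n) C < c" if "mass \<mu> C < c" for c
    using half C that by blast
  have compl: "mass \<nu> (- C) = 1 - mass \<nu> C" for \<nu>
    using prob_space.prob_compl[OF prob_space_meas[of \<nu>], of C] C by (simp add: Compl_eq_Diff_UNIV)
  show "\<forall>\<^sub>F n in F. c < mass (\<nu> n) C" if "c < mass \<mu> C" for c
    using half[of "- C" "1 - c"] C that by (simp add: compl frontier_complement borel_comp)
qed

lemma borel_prob_eqI:
  fixes \<mu> \<nu> :: "'a::metric_space borel_prob"
  assumes "\<And>\<phi> :: 'a \<Rightarrow>\<^sub>C real. (\<integral>x. \<phi> x \<partial>meas \<mu>) = (\<integral>x. \<phi> x \<partial>meas \<nu>)"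
  shows "\<mu> = \<nu>"
proof -
  interpret m: prob_space "meas \<mu>" by (rule prob_space_meas)
  interpret n: prob_space "meas \<nu>" by (rule prob_space_meas)
  have le: "mass \<mu>' S \<le> mass \<nu>' S"
    if "closed S" and eq: "\<And>\<phi> :: 'a \<Rightarrow>\<^sub>C real. (\<integral>x. \<phi> x \<partial>meas \<mu>') = (\<integral>x. \<phi> x \<partial>meas \<nu>')"
    for S \<mu>' \<nu>'
  proof (rule ccontr)
    assume "\<not> ?thesis"
    then obtain \<phi> :: "'a \<Rightarrow>\<^sub>C real" where \<phi>: "\<And>x. indicator S x \<le> \<phi> x"
        "(\<integral>x. \<phi> x \<partial>meas \<nu>') < mass \<mu>' S"
      using closed_approx_bcontfun[OF \<open>closed S\<close>, of \<nu>' "mass \<mu>' S"] by force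
    with measure_le_integral_bcontfun[of S \<phi> \<mu>'] \<open>closed S\<close> eq[of \<phi>] show False by force
  qed
  have "meas \<mu> = meas \<nu>"
  proof (rule measure_eqI_generator_eq[where E = "Collect closed" and A = "\<lambda>_. UNIV" and \<Omega> = UNIV])
    show "emeasure (meas \<mu>) X = emeasure (meas \<nu>) X" if "X \<in> Collect closed" for X
      using that le[of X \<mu> \<nu>] le[of X \<nu> \<mu>] assms
      by (simp add: m.emeasure_eq_measure n.emeasure_eq_measure antisym)
    show "sets (meas \<mu>) = sigma_sets UNIV (Collect closed)" "sets (meas \<nu>) = sigma_sets UNIV (Collect closed)"
      by (simp_all add: borel_eq_closed)
  qed (auto simp: Int_stable_def)
  then show ?thesis by (simp add: meas_inject)
qed

text \<open>The first \<open>n\<close> of the sets \<open>b 0, b 1, \<dots>\<close> code a point by \<open>n\<close> bits, the latest bit first, and \<open>cell b s\<close> consists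
of the points with code \<open>s\<close>. So the cells of length \<open>n\<close> form a partition, and prepending a bit refines it.\<close>

primrec cell :: "(nat \<Rightarrow> 'a set) \<Rightarrow> bool list \<Rightarrow> 'a set" where
  "cell b [] = UNIV"
| "cell b (\<beta> # s) = (if \<beta> then cell b s \<inter> b (length s) else cell b s - b (length s))"

primrec code :: "(nat \<Rightarrow> 'a set) \<Rightarrow> nat \<Rightarrow> 'a \<Rightarrow> bool list" where
  "code b 0 x = []"
| "code b (Suc n) x = (x \<in> b n) # code b n x"

lemma length_code [simp]: "length (code b n x) = n"
  by (induction n) auto

lemma mem_cell_iff: "x \<in> cell b s \<longleftrightarrow> code b (length s) x = s"
  by (induction s) auto

lemma code_eq_antimono: "code b n x = code b n y \<Longrightarrow> m \<le> n \<Longrightarrow> code b m x = code b m y"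
  by (induction n) (auto elim: le_SucE)

lemma code_eq_iff: "code b n x = code b n y \<longleftrightarrow> (\<forall>l<n. x \<in> b l \<longleftrightarrow> y \<in> b l)"
  by (induction n) (auto simp: less_Suc_eq)

lemma sets_cell:
  assumes "\<And>l. b l \<in> sets borel"
  shows "cell b s \<in> sets borel"
  by (induction s) (use assms in auto)

text \<open>The mesh of the partitions into cells tends to \<open>0\<close>.\<close>

definition resolving :: "(nat \<Rightarrow> 'a::metric_space set) \<Rightarrow> bool" where
  "resolving b \<longleftrightarrow> (\<forall>e>0. \<exists>n. \<forall>x y. code b n x = code b n y \<longrightarrow> dist x y < e)"

definition continuity_sets :: "'a::metric_space borel_prob \<Rightarrow> 'a set set" where
  "continuity_sets \<mu> = {C\<in>sets borel. mass \<mu> (frontier C) = 0}"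

lemma continuity_setsD:
  "C \<in> continuity_sets \<mu> \<Longrightarrow> C \<in> sets borel" "C \<in> continuity_sets \<mu> \<Longrightarrow> mass \<mu> (frontier C) = 0"
  by (auto simp: continuity_sets_def)

lemma algebra_continuity_sets: "algebra UNIV (continuity_sets \<mu>)"
proof -
  interpret prob_space "meas \<mu>" by (rule prob_space_meas)
  have sub: "mass \<mu> X = 0" if "X \<subseteq> frontier A \<union> frontier B" "X \<in> sets borel"
    "mass \<mu> (frontier A) = 0" "mass \<mu> (frontier B) = 0" for X A B
  proof -
    have "mass \<mu> X \<le> mass \<mu> (frontier A \<union> frontier B)"
      using that by (intro finite_measure_mono) (auto simp: frontier_def)
    also have "\<dots> \<le> mass \<mu> (frontier A) + mass \<mu> (frontier B)"
      by (intro measure_Un_le) (auto simp: frontier_def)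
    finally show ?thesis using that measure_nonneg[of "meas \<mu>" X] by linarith
  qed
  have fr: "frontier X \<in> sets borel" for X :: "'a set" by (simp add: frontier_def)
  show ?thesis
    unfolding algebra_iff_Un continuity_sets_def
    using sub[OF frontier_Un_subset fr]
    by (auto simp: frontier_complement simp flip: Compl_eq_Diff_UNIV)
qed

lemma cell_continuity_sets:
  assumes "\<And>l. b l \<in> continuity_sets \<mu>"
  shows "cell b s \<in> continuity_sets \<mu>"
proof -
  interpret algebra UNIV "continuity_sets \<mu>" by (rule algebra_continuity_sets)
  show ?thesis using assms by (induction s) auto
qed

text \<open>Only countably many values of \<open>f\<close> are taken with positive probability.\<close>

lemma exists_null_level:
  fixes f :: "'a::topological_space \<Rightarrow> real"
  assumes f: "f \<in> borel_measurable borel" and "l < u"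
  shows "\<exists>c. l < c \<and> c < u \<and> mass \<mu> {x. f x = c} = 0"
proof -
  interpret prob_space "meas \<mu>" by (rule prob_space_meas)
  note f[measurable]
  interpret d: prob_space "distr (meas \<mu>) borel f" by (rule prob_space_distr) simp
  have "measure (distr (meas \<mu>) borel f) {c} = mass \<mu> {x. f x = c}" for c
    by (subst measure_distr) (auto simp: vimage_def)
  then have "countable {c. mass \<mu> {x. f x = c} \<noteq> 0}"
    using d.countable_support by simp
  moreover have "uncountable {l<..<u}" using \<open>l < u\<close> by (simp add: uncountable_open_interval)
  ultimately have "\<not> {l<..<u} \<subseteq> {c. mass \<mu> {x. f x = c} \<noteq> 0}"
    using countable_subset by blast
  then show ?thesis by auto
qed

lemma continuity_sets_superlevel:
  fixes f :: "'a::metric_space \<Rightarrow> real"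
  assumes f: "continuous_on UNIV f" and c: "mass \<mu> {x. f x = c} = 0"
  shows "{x. c < f x} \<in> continuity_sets \<mu>"
proof -
  interpret prob_space "meas \<mu>" by (rule prob_space_meas)
  have [measurable]: "f \<in> borel_measurable borel" using f by (rule borel_measurable_continuous_onI)
  have o: "open {x. c < f x}" by (intro open_Collect_less f) simp
  have "closed {x. c \<le> f x}" by (intro closed_Collect_le f) simp
  then have "closure {x. c < f x} \<subseteq> {x. c \<le> f x}" by (rule closure_minimal[rotated]) auto
  then have "frontier {x. c < f x} \<subseteq> {x. f x = c}"
    using o by (auto simp: frontier_def interior_open)
  then have "mass \<mu> (frontier {x. c < f x}) \<le> mass \<mu> {x. f x = c}"
    by (intro finite_measure_mono) auto
  with c o show ?thesis by (auto simp: continuity_sets_def measure_le_0_iff)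
qed

text \<open>Use balls around the points of finite nets. The radii for the \<open>m\<close>-th net may vary between \<open>1 / (m + 1)\<close>,
so that the balls cover, and twice that number, and this leaves room to make the spheres null.\<close>

lemma exists_resolving_continuity_sets:
  fixes \<tau> :: "'a::compact_metric_space borel_prob"
  shows "\<exists>b. resolving b \<and> (\<forall>l. b l \<in> continuity_sets \<tau>)"
proof -
  define good where "good x m r \<longleftrightarrow> inverse (real (Suc m)) < r \<and> r < 2 * inverse (real (Suc m)) \<and>
    mass \<tau> {y. dist x y = r} = 0" for x m r
  have "\<exists>r. good x m r" for m x
    unfolding good_def by (intro exists_null_level borel_measurable_continuous_onI continuous_intros) simp
  then have "\<forall>x m. \<exists>r. good x m r" by blast
  then obtain r where "\<forall>x m. good x m (r x m)" by (auto simp only: choice_iff)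
  then have r: "\<And>x m. inverse (real (Suc m)) < r x m" "\<And>x m. r x m < 2 * inverse (real (Suc m))"
    "\<And>x m. mass \<tau> {y. dist x y = r x m} = 0"
    by (auto simp only: good_def)
  have ball: "ball x (r x m) \<in> continuity_sets \<tau>" for x m
  proof -
    have "continuous_on UNIV (\<lambda>y. - dist x y)" by (intro continuous_intros)
    from continuity_sets_superlevel[OF this, of \<tau> "- r x m"] r(3)[of x m] show ?thesis
      by (simp add: ball_def)
  qed
  have "\<forall>m. \<exists>N :: 'a set. finite N \<and> UNIV \<subseteq> (\<Union>x\<in>N. ball x (inverse (real (Suc m))))"
    using compact_whole_space[where 'a = 'a] unfolding compact_eq_totally_bounded by simp
  then obtain net :: "nat \<Rightarrow> 'a set" where net: "\<And>m. finite (net m)"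
      "\<And>m. UNIV \<subseteq> (\<Union>x\<in>net m. ball x (inverse (real (Suc m))))" by (auto simp only: choice_iff)
  define U where "U = (\<Union>m. (\<lambda>x. ball x (r x m)) ` net m)"
  have U: "countable U" "U \<noteq> {}"
  proof -
    show "countable U"
      unfolding U_def by (intro countable_UN) (auto intro: countable_finite net(1))
    obtain x where "x \<in> net 0" using net(2)[of 0] by (metis UNIV_I UN_E subsetD)
    then have "ball x (r x 0) \<in> U" unfolding U_def by blast
    then show "U \<noteq> {}" by blast
  qed
  define b where "b = from_nat_into U"
  have range: "range b = U" unfolding b_def using U by (simp add: range_from_nat_into)
  have "resolving b"
    unfolding resolving_def
  proof (intro allI impI)
    fix e :: real assume "e > 0"
    then obtain m where m: "inverse (real (Suc m)) < e / 4"
      using reals_Archimedean[of "e / 4"] by auto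
    have "(\<lambda>x. ball x (r x m)) ` net m \<subseteq> b ` UNIV" using range by (auto simp: U_def)
    then obtain I where I: "finite I" "(\<lambda>x. ball x (r x m)) ` net m = b ` I"
      using finite_subset_image[of "(\<lambda>x. ball x (r x m)) ` net m" b UNIV] net(1) by auto
    obtain n where n: "I \<subseteq> {..<n}" using finite_nat_bounded[OF I(1)] by blast
    show "\<exists>n. \<forall>x y. code b n x = code b n y \<longrightarrow> dist x y < e"
    proof (intro exI[of _ n] allI impI)
      fix x y assume eq: "code b n x = code b n y"
      obtain z where z: "z \<in> net m" "dist z x < inverse (real (Suc m))" using net(2)[of m] by (auto dest: subsetD[OF _ UNIV_I, of _ x])
      have "ball z (r z m) \<in> b ` I" using z(1) unfolding I(2)[symmetric] by blast
      then obtain l where l: "l < n" "b l = ball z (r z m)" using n by auto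
      have "x \<in> b l" using z r(1)[of m z] l by auto
      then have "y \<in> b l" using eq l by (auto simp: code_eq_iff)
      then have "dist z y < r z m" "dist z x < r z m" using \<open>x \<in> b l\<close> l by auto
      then have "dist x y < 2 * r z m" using dist_triangle3[of x y z] by linarith
      then show "dist x y < e" using r(2)[of z m] m by linarith
    qed
  qed
  moreover have "b l \<in> continuity_sets \<tau>" for l
  proof -
    have "b l \<in> U" using range by auto
    then show ?thesis using ball by (auto simp: U_def)
  qed
  ultimately show ?thesis by blast
qed

text \<open>An arbitrary point if the cell is empty.\<close>

definition cell_point :: "(nat \<Rightarrow> 'a set) \<Rightarrow> bool list \<Rightarrow> 'a" where
  "cell_point b s = (SOME x. x \<in> cell b s)"

lemma code_cell_point: "code b n (cell_point b (code b n x)) = code b n x"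
proof -
  have "x \<in> cell b (code b n x)" by (simp add: mem_cell_iff)
  then have "cell_point b (code b n x) \<in> cell b (code b n x)"
    unfolding cell_point_def by (rule someI)
  then show ?thesis by (simp add: mem_cell_iff)
qed

lemma finite_codes: "finite {s :: bool list. length s = n}"
  using finite_lists_length_eq[of "UNIV :: bool set" n] by simp

lemma measurable_code:
  assumes "\<And>l. b l \<inter> space M \<in> sets M"
  shows "code b n \<in> measurable M (count_space UNIV)"
proof -
  have cell: "cell b s \<inter> space M \<in> sets M" for s
  proof (induction s)
    case (Cons \<beta> s)
    have "cell b (\<beta> # s) \<inter> space M =
      (if \<beta> then (cell b s \<inter> space M) \<inter> (b (length s) \<inter> space M) else (cell b s \<inter> space M) - (b (length s) \<inter> space M))"
      by auto
    then show ?case using Cons assms[of "length s"] by auto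
  qed simp
  have "code b n -` {s} \<inter> space M = (if length s = n then cell b s \<inter> space M else {})" for s
    by (auto simp: mem_cell_iff)
  then show ?thesis
    by (subst measurable_count_space_eq_countable) (auto simp: cell)
qed

lemma integral_code:
  fixes f :: "bool list \<Rightarrow> real"
  assumes M: "finite_measure M" and b: "\<And>l. b l \<inter> space M \<in> sets M"
  shows "(\<integral>x. f (code b n x) \<partial>M) = (\<Sum>s | length s = n. f s * measure M (cell b s \<inter> space M))"
    and "integrable M (\<lambda>x. f (code b n x))"
proof -
  interpret finite_measure M by fact
  note measurable_code[of b M n, OF b, measurable]
  have cs: "cell b s \<inter> space M \<in> sets M" if "length s = n" for s
  proof -
    have "cell b s \<inter> space M = code b n -` {s} \<inter> space M" using that by (auto simp: mem_cell_iff)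
    then show ?thesis using measurable_sets[OF measurable_code[of b M n, OF b], of "{s}"] by simp
  qed
  have eq: "f (code b n x) = (\<Sum>s | length s = n. f s * indicator (cell b s \<inter> space M) x)" if "x \<in> space M" for x
  proof -
    have "(\<Sum>s | length s = n. f s * indicator (cell b s \<inter> space M) x) =
        (\<Sum>s | length s = n. if s = code b n x then f s else 0)"
      by (rule sum.cong) (use that in \<open>auto simp: mem_cell_iff indicator_def\<close>)
    also have "\<dots> = f (code b n x)" using finite_codes by (subst sum.delta) auto
    finally show ?thesis by simp
  qed
  have int: "integrable M (indicator (cell b s \<inter> space M) :: _ \<Rightarrow> real)" if "length s = n" for s
    using cs[OF that] by (intro integrable_const_bound[of _ 1]) auto
  have "(\<integral>x. f (code b n x) \<partial>M) = (\<integral>x. (\<Sum>s | length s = n. f s * indicator (cell b s \<inter> space M) x) \<partial>M)"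
    by (rule Bochner_Integration.integral_cong) (auto simp: eq)
  also have "\<dots> = (\<Sum>s | length s = n. \<integral>x. f s * indicator (cell b s \<inter> space M) x \<partial>M)"
    using int by (intro Bochner_Integration.integral_sum) auto
  also have "\<dots> = (\<Sum>s | length s = n. f s * measure M (cell b s \<inter> space M))"
    by (intro sum.cong) auto
  finally show "(\<integral>x. f (code b n x) \<partial>M) = (\<Sum>s | length s = n. f s * measure M (cell b s \<inter> space M))" .
  have "integrable M (\<lambda>x. (\<Sum>s | length s = n. f s * indicator (cell b s \<inter> space M) x))"
    using int by auto
  then show "integrable M (\<lambda>x. f (code b n x))"
    by (subst Bochner_Integration.integrable_cong[OF refl eq])
qed

lemma resolving_cell_point_uniform:
  fixes \<phi> :: "'a::compact_metric_space \<Rightarrow> real"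
  assumes b: "resolving b" and \<phi>: "continuous_on UNIV \<phi>" and e: "e > 0"
  shows "\<exists>n. \<forall>m\<ge>n. \<forall>x. \<bar>\<phi> (cell_point b (code b m x)) - \<phi> x\<bar> < e"
proof -
  have "uniformly_continuous_on UNIV \<phi>"
    using \<phi> compact_whole_space by (rule compact_uniformly_continuous)
  then obtain d where d: "d > 0" "\<And>x y. dist x y < d \<Longrightarrow> dist (\<phi> x) (\<phi> y) < e"
    using e unfolding uniformly_continuous_on_def by auto
  obtain n where n: "\<And>x y. code b n x = code b n y \<Longrightarrow> dist x y < d"
    using b d(1) unfolding resolving_def by blast
  have "dist (cell_point b (code b m x)) x < d" if "m \<ge> n" for m x
    using code_eq_antimono[OF code_cell_point[of b m x] that] by (rule n)
  then have "\<bar>\<phi> (cell_point b (code b m x)) - \<phi> x\<bar> < e" if "m \<ge> n" for m x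
    using d(2)[of "cell_point b (code b m x)" x] that by (simp add: dist_real_def)
  then show ?thesis by blast
qed

lemma tendsto_cell_point:
  fixes b :: "nat \<Rightarrow> 'a::compact_metric_space set"
  assumes b: "resolving b"
  shows "(\<lambda>n. cell_point b (code b n x)) \<longlonglongrightarrow> x"
proof (rule metric_LIMSEQ_I)
  fix e :: real assume "e > 0"
  then obtain n where n: "\<And>x y. code b n x = code b n y \<Longrightarrow> dist x y < e"
    using b unfolding resolving_def by blast
  show "\<exists>n. \<forall>m\<ge>n. dist (cell_point b (code b m x)) x < e"
    using code_eq_antimono[OF code_cell_point[of b _ x]] n by blast
qed

text \<open>A continuous function is uniformly close to a combination of indicators of cells, so the measures of
countably many cells control weak convergence to \<open>\<tau>\<close>.\<close>

lemma tendsto_borel_prob_cells: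
  fixes \<tau> :: "'a::compact_metric_space borel_prob"
  assumes b: "resolving b" "\<And>l. b l \<in> sets borel"
    and lim: "\<And>s. ((\<lambda>n. mass (\<nu> n) (cell b s)) \<longlongrightarrow> mass \<tau> (cell b s)) F"
  shows "(\<nu> \<longlongrightarrow> \<tau>) F"
  unfolding tendsto_borel_prob_iff
proof (intro allI tendstoI)
  fix \<phi> :: "'a \<Rightarrow>\<^sub>C real" and e :: real assume e: "e > 0"
  obtain n where n: "\<And>m x. m \<ge> n \<Longrightarrow> \<bar>\<phi> (cell_point b (code b m x)) - \<phi> x\<bar> < e / 3"
    using resolving_cell_point_uniform[OF b(1), of \<phi> "e / 3"] e
    by (auto simp: continuous_on_apply_bcontfun)
  define I where "I \<mu> = (\<Sum>s | length s = n. \<phi> (cell_point b s) * mass \<mu> (cell b s))" for \<mu>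
  have close: "\<bar>I \<mu> - (\<integral>x. \<phi> x \<partial>meas \<mu>)\<bar> \<le> e / 3" for \<mu>
  proof -
    interpret prob_space "meas \<mu>" by (rule prob_space_meas)
    have i: "integrable (meas \<mu>) (\<lambda>x. \<phi> (cell_point b (code b n x)))"
      and I: "I \<mu> = (\<integral>x. \<phi> (cell_point b (code b n x)) \<partial>meas \<mu>)"
      using integral_code[of "meas \<mu>" b "\<lambda>s. \<phi> (cell_point b s)" n] b(2) finite_measure_meas[of \<mu>]
      by (auto simp: I_def)
    have "\<bar>\<integral>x. \<phi> (cell_point b (code b n x)) - \<phi> x \<partial>meas \<mu>\<bar> \<le> (\<integral>x. \<bar>\<phi> (cell_point b (code b n x)) - \<phi> x\<bar> \<partial>meas \<mu>)"
      by (rule integral_abs_bound)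
    also have "\<dots> \<le> (\<integral>x. e / 3 \<partial>meas \<mu>)"
      using n[of n] i integrable_bcontfun[of \<mu> \<phi>] by (intro integral_mono) (auto intro: less_imp_le)
    finally show ?thesis
      using i integrable_bcontfun[of \<mu> \<phi>] prob_space by (simp add: I)
  qed
  have "((\<lambda>n. I (\<nu> n)) \<longlongrightarrow> I \<tau>) F"
    unfolding I_def by (intro tendsto_intros lim)
  then have "\<forall>\<^sub>F k in F. dist (I (\<nu> k)) (I \<tau>) < e / 3" by (rule tendstoD) (use e in simp)
  then show "\<forall>\<^sub>F n in F. dist (\<integral>x. \<phi> x \<partial>meas (\<nu> n)) (\<integral>x. \<phi> x \<partial>meas \<tau>) < e"
  proof (rule eventually_mono)
    fix k assume "dist (I (\<nu> k)) (I \<tau>) < e / 3"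
    then show "dist (\<integral>x. \<phi> x \<partial>meas (\<nu> k)) (\<integral>x. \<phi> x \<partial>meas \<tau>) < e"
      using close[of "\<nu> k"] close[of \<tau>] unfolding dist_real_def by linarith
  qed
qed

section \<open>The distance of a set of actions from optimality\<close>

definition max_over :: "'a::metric_space ncompact \<Rightarrow> ('a \<Rightarrow> real) \<Rightarrow> real" where
  "max_over K w = (SUP a\<in>set_of K. w a)"

lemma max_over_attained:
  assumes "continuous_on UNIV w"
  obtains b where "b \<in> set_of K" "w b = max_over K w" "\<And>a. a \<in> set_of K \<Longrightarrow> w a \<le> max_over K w"
proof -
  obtain b where b: "b \<in> set_of K" "\<And>a. a \<in> set_of K \<Longrightarrow> w a \<le> w b"
    using continuous_attains_sup[OF compact_set_of[of K] set_of_nonempty, of w]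
      continuous_on_subset[OF assms subset_UNIV] by blast
  then have "max_over K w = w b"
    unfolding max_over_def by (intro cSup_eq_maximum) auto
  with b that show thesis by auto
qed

lemma max_over_upper: "continuous_on UNIV w \<Longrightarrow> a \<in> set_of K \<Longrightarrow> w a \<le> max_over K w"
  by (metis max_over_attained)

lemma ncompact_near_point:
  fixes K L :: "'a::metric_space ncompact"
  assumes a: "a \<in> set_of K" and d: "dist K L < d"
  obtains b where "b \<in> set_of L" "dist a b < d"
proof -
  have "infdist a (set_of L) \<le> dist K L"
    using hausdorff_dist_le_iff[of "set_of K" "set_of L" "dist K L"] a
    by (simp add: compact_set_of set_of_nonempty dist_ncompact_def)
  then have "infdist a (set_of L) < d" using d by simp
  then have "\<exists>b\<in>set_of L. dist a b < d"
    unfolding infdist_notempty[OF set_of_nonempty]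
    by (subst (asm) cINF_less_iff) (auto simp: set_of_nonempty)
  with that show thesis by blast
qed

text \<open>The value of the best action against society \<open>\<tau>\<close> when playing \<open>a\<close> costs \<open>\<theta> a\<close>.\<close>

definition penalized_value :: "'a::metric_space borel_prob \<Rightarrow> ('a \<Rightarrow> real) \<Rightarrow> 'a characteristic \<Rightarrow> real" where
  "penalized_value \<tau> \<theta> x = max_over (fst x) (\<lambda>a. (snd x) (a, \<tau>) - \<theta> a)"

lemma continuous_on_payoff_section:
  fixes u :: "'a::metric_space payoff"
  shows "continuous_on UNIV (\<lambda>a. u (a, \<tau>))"
  by (rule continuous_on_compose2[OF continuous_on_apply_bcontfun[of UNIV u]])
    (auto intro!: continuous_intros)

text \<open>Uniform continuity of the penalized payoff absorbs a change of the feasible set, the sup norm a change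
of the payoff.\<close>

lemma penalized_value_le:
  fixes K :: "'a::compact_metric_space ncompact" and \<theta> :: "'a \<Rightarrow> real" and u u' :: "'a payoff"
  assumes \<theta>: "continuous_on UNIV \<theta>"
    and w: "\<And>a b. dist a b < d \<Longrightarrow>
      \<bar>(u (a, \<tau>) - \<theta> a) - (u (b, \<tau>) - \<theta> b)\<bar> < e / 2"
    and K: "dist K K' < d" and u: "dist u u' < e / 2"
  shows "penalized_value \<tau> \<theta> (K, u) \<le> penalized_value \<tau> \<theta> (K', u') + e"
    and "penalized_value \<tau> \<theta> (K', u') \<le> penalized_value \<tau> \<theta> (K, u) + e"
proof -
  have c: "continuous_on UNIV (\<lambda>a. v (a, \<tau>) - \<theta> a)" for v :: "'a payoff"
    by (intro continuous_intros continuous_on_payoff_section \<theta>)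
  have uu: "\<bar>u x - u' x\<bar> < e / 2" for x
    using dist_bounded[of u x u'] u by (simp add: dist_real_def)
  obtain a where a: "a \<in> set_of K" "u (a, \<tau>) - \<theta> a = penalized_value \<tau> \<theta> (K, u)"
    using max_over_attained[OF c[of u], of K] by (auto simp: penalized_value_def)
  obtain b where b: "b \<in> set_of K'" "dist a b < d" using ncompact_near_point[OF a(1) K] by blast
  have "u' (b, \<tau>) - \<theta> b \<le> penalized_value \<tau> \<theta> (K', u')"
    using max_over_upper[OF c[of u'] b(1)] by (simp add: penalized_value_def)
  then show "penalized_value \<tau> \<theta> (K, u) \<le> penalized_value \<tau> \<theta> (K', u') + e"
    using a(2) w[OF b(2)] uu[of "(b, \<tau>)"] by linarith
  obtain a' where a': "a' \<in> set_of K'" "u' (a', \<tau>) - \<theta> a' = penalized_value \<tau> \<theta> (K', u')"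
    using max_over_attained[OF c[of u'], of K'] by (auto simp: penalized_value_def)
  obtain b' where b': "b' \<in> set_of K" "dist a' b' < d"
    using ncompact_near_point[OF a'(1)] K by (metis dist_commute)
  have "u (b', \<tau>) - \<theta> b' \<le> penalized_value \<tau> \<theta> (K, u)"
    using max_over_upper[OF c[of u] b'(1)] by (simp add: penalized_value_def)
  then show "penalized_value \<tau> \<theta> (K', u') \<le> penalized_value \<tau> \<theta> (K, u) + e"
    using a'(2) w[OF b'(2)] uu[of "(a', \<tau>)"] by linarith
qed

lemma continuous_on_penalized_value:
  fixes \<theta> :: "'a::compact_metric_space \<Rightarrow> real"
  assumes \<theta>: "continuous_on UNIV \<theta>"
  shows "continuous_on UNIV (penalized_value \<tau> \<theta>)"
  unfolding continuous_on_iff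
proof (intro ballI allI impI)
  fix x :: "'a characteristic" and e :: real assume e: "0 < e"
  obtain K u where x: "x = (K, u)" by (cases x)
  have "continuous_on UNIV (\<lambda>a. u (a, \<tau>) - \<theta> a)"
    by (intro continuous_intros continuous_on_payoff_section \<theta>)
  then have "uniformly_continuous_on UNIV (\<lambda>a. u (a, \<tau>) - \<theta> a)"
    using compact_whole_space by (rule compact_uniformly_continuous)
  from this[unfolded uniformly_continuous_on_def, rule_format, OF half_gt_zero[OF half_gt_zero[OF e]]]
  obtain d where "d > 0" and d': "\<forall>a\<in>UNIV. \<forall>b\<in>UNIV. dist b a < d \<longrightarrow>
      dist (u (b, \<tau>) - \<theta> b) (u (a, \<tau>) - \<theta> a) < e / 2 / 2"
    by blast
  then have d: "d > 0" "\<And>a b. dist a b < d \<Longrightarrow>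
      \<bar>(u (a, \<tau>) - \<theta> a) - (u (b, \<tau>) - \<theta> b)\<bar> < e / 2 / 2"
    unfolding dist_real_def by blast+
  show "\<exists>d>0. \<forall>y\<in>UNIV. dist y x < d \<longrightarrow> dist (penalized_value \<tau> \<theta> y) (penalized_value \<tau> \<theta> x) < e"
  proof (intro exI[of _ "min d (e / 2 / 2)"] conjI ballI impI)
    show "0 < min d (e / 2 / 2)" using d e by simp
    fix y :: "'a characteristic" assume y: "dist y x < min d (e / 2 / 2)"
    obtain K' u' where y': "y = (K', u')" by (cases y)
    have dK: "dist K K' < d" using y dist_fst_le[of y x] by (simp add: x y' dist_commute)
    have du: "dist u u' < e / 2 / 2" using y dist_snd_le[of y x] by (simp add: x y' dist_commute)
    have "\<bar>penalized_value \<tau> \<theta> y - penalized_value \<tau> \<theta> x\<bar> \<le> e / 2"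
      using penalized_value_le[OF \<theta> d(2) dK du] unfolding x y' by linarith
    then show "dist (penalized_value \<tau> \<theta> y) (penalized_value \<tau> \<theta> x) < e"
      using e by (simp add: dist_real_def)
  qed
qed

text \<open>The loss in the best payoff against \<open>\<tau>\<close> when straying from \<open>B\<close> costs the distance to \<open>B\<close>. For nonempty \<open>B\<close>
it vanishes if and only if some best reply lies in the closure of \<open>B\<close>. The penalty, instead of a restriction to \<open>B\<close>, makes it
continuous in the type.\<close>

definition gap :: "'a::metric_space borel_prob \<Rightarrow> 'a set \<Rightarrow> 'a characteristic \<Rightarrow> real" where
  "gap \<tau> B x = penalized_value \<tau> (\<lambda>_. 0) x - penalized_value \<tau> (\<lambda>a. infdist a B) x"

lemma continuous_on_gap: "continuous_on UNIV (gap \<tau> B)" for B :: "'a::compact_metric_space set"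
  unfolding gap_def
  by (intro continuous_on_diff continuous_on_penalized_value continuous_intros)

lemma gap_nonneg: "0 \<le> gap \<tau> B x"
proof -
  obtain a where "a \<in> set_of (fst x)" "(snd x) (a, \<tau>) - infdist a B = penalized_value \<tau> (\<lambda>a. infdist a B) x"
    unfolding penalized_value_def
    by (rule max_over_attained[of "\<lambda>a. (snd x) (a, \<tau>) - infdist a B" "fst x"])
      (auto intro!: continuous_intros continuous_on_payoff_section)
  then show ?thesis
    using max_over_upper[OF continuous_on_payoff_section, of a "fst x" "snd x" \<tau>] infdist_nonneg[of a B]
    by (simp add: gap_def penalized_value_def)
qed

lemma gap_le_regret:
  assumes "a \<in> set_of (fst x)" "a \<in> B"
  shows "gap \<tau> B x \<le> max_over (fst x) (\<lambda>b. (snd x) (b, \<tau>)) - (snd x) (a, \<tau>)"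
proof -
  have "(snd x) (a, \<tau>) - infdist a B \<le> penalized_value \<tau> (\<lambda>a. infdist a B) x"
    unfolding penalized_value_def using assms(1)
    by (intro max_over_upper[of "\<lambda>a. (snd x) (a, \<tau>) - infdist a B"])
      (auto intro!: continuous_intros continuous_on_payoff_section)
  then show ?thesis using assms(2) by (simp add: gap_def penalized_value_def)
qed

text \<open>If the best payoff is not lowered by the penalty, then the best penalized action pays no penalty.\<close>

lemma gap_eq_0_imp_best_response:
  assumes "gap \<tau> B x \<le> 0" "B \<noteq> {}"
  obtains b where "b \<in> set_of (fst x)" "b \<in> closure B"
    "\<And>a. a \<in> set_of (fst x) \<Longrightarrow> (snd x) (a, \<tau>) \<le> (snd x) (b, \<tau>)"
proof -
  obtain b where b: "b \<in> set_of (fst x)" "(snd x) (b, \<tau>) - infdist b B = penalized_value \<tau> (\<lambda>a. infdist a B) x"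
    unfolding penalized_value_def
    by (rule max_over_attained[of "\<lambda>a. (snd x) (a, \<tau>) - infdist a B" "fst x"])
      (auto intro!: continuous_intros continuous_on_payoff_section)
  have up: "(snd x) (a, \<tau>) \<le> penalized_value \<tau> (\<lambda>_. 0) x" if "a \<in> set_of (fst x)" for a
    using max_over_upper[OF continuous_on_payoff_section that, of "snd x" \<tau>] by (simp add: penalized_value_def)
  have "penalized_value \<tau> (\<lambda>_. 0) x \<le> (snd x) (b, \<tau>) - infdist b B"
    using assms(1) b(2) by (simp add: gap_def)
  with up[OF b(1)] infdist_nonneg[of b B]
  have "infdist b B = 0" "penalized_value \<tau> (\<lambda>_. 0) x \<le> (snd x) (b, \<tau>)" by linarith+
  with that[of b] b(1) up assms(2) show thesis
    by (force simp: in_closure_iff_infdist_zero)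
qed

section \<open>Finite games with small players\<close>

lemma measurable_finite_prob_space:
  assumes "finite_prob_space L n" "\<And>x. f x \<in> space N"
  shows "f \<in> measurable L N"
  using assms by (auto simp: measurable_def finite_prob_space_def)

lemma integral_finite_prob_space:
  fixes f :: "'j \<Rightarrow> real"
  assumes L: "finite_prob_space L n"
  shows "(\<integral>i. f i \<partial>L) = (\<Sum>i\<in>space L. measure L {i} * f i)"
proof -
  interpret prob_space L using L by (simp add: finite_prob_space_def)
  have fin: "finite (space L)" and S: "sets L = Pow (space L)"
    using L by (auto simp: finite_prob_space_def)
  have "(\<integral>i. f i \<partial>L) = (\<integral>i. (\<Sum>j\<in>space L. f j * indicator {j} i) \<partial>L)"
  proof (rule Bochner_Integration.integral_cong[OF refl])
    fix i assume "i \<in> space L"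
    then show "f i = (\<Sum>j\<in>space L. f j * indicator {j} i)"
      using fin by (subst sum.remove[of _ i]) (auto simp: indicator_def)
  qed
  also have "\<dots> = (\<Sum>j\<in>space L. \<integral>i. f j * indicator {j} i \<partial>L)"
    using S by (intro Bochner_Integration.integral_sum) (auto simp: integrable_indicator_iff less_top[symmetric])
  also have "\<dots> = (\<Sum>i\<in>space L. measure L {i} * f i)"
    using S by (intro sum.cong) (auto simp: mult.commute)
  finally show ?thesis .
qed

lemma sum_finite_prob_space:
  assumes "finite_prob_space L n"
  shows "(\<Sum>i\<in>space L. measure L {i}) = 1"
  using integral_finite_prob_space[OF assms, of "\<lambda>_. 1"] assms
  by (simp add: finite_prob_space_def prob_space.prob_space)

lemma measure_mixture:
  assumes L: "finite_prob_space L n" and B: "B \<in> sets borel"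
  shows "mass (mixture L g) B = (\<Sum>i\<in>space L. measure L {i} * mass (g i) B)"
proof -
  interpret L: prob_space L using L by (simp add: finite_prob_space_def)
  have "emeasure (meas (mixture L g)) B = (\<Sum>i\<in>space L. ennreal (measure L {i} * mass (g i) B))"
    unfolding emeasure_mixture[OF L B]
    by (intro sum.cong) (simp_all add: L.emeasure_eq_measure ennreal_mult
        finite_measure.emeasure_eq_measure[OF finite_measure_meas, of _ B])
  also have "\<dots> = ennreal (\<Sum>i\<in>space L. measure L {i} * mass (g i) B)"
    by (intro sum_ennreal) simp
  finally show ?thesis by (simp add: measure_def sum_nonneg)
qed

lemma mixture_dirac:
  assumes L: "finite_prob_space L n"
  shows "mixture L (\<lambda>j. dirac (a j)) = law L a"
proof -
  interpret L: prob_space L using L by (simp add: finite_prob_space_def)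
  have fin: "finite (space L)" and S: "sets L = Pow (space L)"
    using L by (auto simp: finite_prob_space_def)
  have am: "a \<in> borel_measurable L" using L by (rule measurable_finite_prob_space) simp
  have "meas (mixture L (\<lambda>j. dirac (a j))) = meas (law L a)"
  proof (rule measure_eqI)
    fix B :: "'b set" assume "B \<in> sets (meas (mixture L (\<lambda>j. dirac (a j))))"
    then have B: "B \<in> sets borel" by simp
    have "emeasure (meas (mixture L (\<lambda>j. dirac (a j)))) B = (\<Sum>i\<in>space L. emeasure L {i} * indicator B (a i))"
      unfolding emeasure_mixture[OF L B] meas_dirac using B by simp
    also have "\<dots> = (\<Sum>i\<in>a -` B \<inter> space L. emeasure L {i})"
      using fin by (intro sum.mono_neutral_cong_right) (auto simp: indicator_def)
    also have "\<dots> = emeasure L (a -` B \<inter> space L)"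
      using fin S by (intro emeasure_eq_sum_singleton[symmetric]) auto
    also have "\<dots> = emeasure (meas (law L a)) B"
      unfolding meas_law[OF L.prob_space_axioms am] using am B by (simp add: emeasure_distr)
    finally show "emeasure (meas (mixture L (\<lambda>j. dirac (a j)))) B = emeasure (meas (law L a)) B" .
  qed simp
  then show ?thesis by (simp add: meas_inject)
qed

lemma integral_law_finite:
  fixes f :: "'b::topological_space \<Rightarrow> real"
  assumes L: "finite_prob_space L n" and f: "f \<in> borel_measurable borel"
  shows "(\<integral>x. f x \<partial>meas (law L a)) = (\<Sum>i\<in>space L. measure L {i} * f (a i))"
proof -
  have "prob_space L" using L by (simp add: finite_prob_space_def)
  moreover have am: "a \<in> borel_measurable L" using L by (rule measurable_finite_prob_space) simp
  ultimately show ?thesis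
    using f by (simp add: meas_law integral_distr integral_finite_prob_space[OF L])
qed

lemma measure_law_finite:
  fixes a :: "'j \<Rightarrow> 'b::topological_space"
  assumes L: "finite_prob_space L n" and B: "B \<in> sets borel"
  shows "mass (law L a) B = (\<Sum>i\<in>space L. measure L {i} * indicator B (a i))"
  using integral_law_finite[OF L, of "indicator B" a] B by simp

lemma law_cong: "(\<And>i. i \<in> space L \<Longrightarrow> a i = a' i) \<Longrightarrow> law L a = law L a'"
  unfolding law_def by (metis (mono_tags, lifting) distr_cong)

context
  fixes L :: "'j measure" and n :: nat and g :: "'j \<Rightarrow> 'a::compact_metric_space borel_prob"
  assumes L: "finite_prob_space L n"
begin

text \<open>The distribution of pure action profiles when the players randomize independently by \<open>g\<close>.\<close>

definition play :: "('j \<Rightarrow> 'a) measure" where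
  "play = (\<Pi>\<^sub>M j\<in>space L. meas (g j))"

lemma prob_space_play: "prob_space play"
  unfolding play_def by (intro prob_space_PiM prob_space_meas)

lemma finite_players: "finite (space L)"
  using L by (simp add: finite_prob_space_def)

lemma measurable_play_component:
  "i \<in> space L \<Longrightarrow> (\<lambda>a. a i) \<in> borel_measurable play"
  unfolding play_def using measurable_component_singleton[of i "space L" "\<lambda>j. meas (g j)"]
  by (simp cong: measurable_cong_sets)

lemma distr_play_component:
  assumes "i \<in> space L"
  shows "distr play borel (\<lambda>a. a i) = meas (g i)"
proof -
  have "distr play (meas (g i)) (\<lambda>a. a i) = meas (g i)"
    unfolding play_def by (intro distr_PiM_component assms prob_space_meas)
  then show ?thesis by (simp cong: distr_cong)
qed

lemma measurable_play_law_cell: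
  assumes "B \<in> sets borel"
  shows "(\<lambda>a. mass (law L a) B) \<in> borel_measurable play"
  unfolding measure_law_finite[OF L assms]
  using assms by (intro borel_measurable_sum borel_measurable_times borel_measurable_const)
    (auto intro!: measurable_compose[OF measurable_play_component] borel_measurable_indicator)

text \<open>Replacing each action by the chosen point of its cell turns the payoff into a function of finitely
many discrete coordinates, which is measurable for the product \<open>\<sigma>\<close>-algebra. These functions converge
pointwise to the payoff.\<close>

lemma measurable_play_payoff:
  fixes u :: "'a payoff"
  assumes i: "i \<in> space L"
  shows "(\<lambda>a. u (a i, law L a)) \<in> borel_measurable play"
proof -
  \<comment> \<open>Any measure yields a resolving sequence of Borel sets.\<close>
  obtain b :: "nat \<Rightarrow> 'a set" where b: "resolving b" "\<And>l. b l \<in> sets borel"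
    using exists_resolving_continuity_sets[of "law L (\<lambda>_. undefined)"] by (metis continuity_setsD(1))
  define q where "q m x = cell_point b (code b m x)" for m x
  define \<Phi> where "\<Phi> s = u (cell_point b (s i), law L (\<lambda>j. cell_point b (s j)))" for s :: "'j \<Rightarrow> bool list"
  show ?thesis
  proof (rule borel_measurable_LIMSEQ_real)
    fix a
    have conv: "(\<lambda>m. law L (\<lambda>j. q m (a j))) \<longlonglongrightarrow> law L a"
      unfolding tendsto_borel_prob_iff
    proof
      fix \<phi> :: "'a \<Rightarrow>\<^sub>C real"
      have m: "apply_bcontfun \<phi> \<in> borel_measurable borel"
        by (intro borel_measurable_continuous_onI) simp
      have "(\<lambda>m. \<phi> (q m (a j))) \<longlonglongrightarrow> \<phi> (a j)" for j
        unfolding q_def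
        by (rule continuous_on_tendsto_compose[OF continuous_on_apply_bcontfun[of UNIV] tendsto_cell_point[OF b(1)]]) auto
      then show "(\<lambda>m. \<integral>x. \<phi> x \<partial>meas (law L (\<lambda>j. q m (a j)))) \<longlonglongrightarrow>
          (\<integral>x. \<phi> x \<partial>meas (law L a))"
        unfolding integral_law_finite[OF L m] by (intro tendsto_intros)
    qed
    have "(\<lambda>m. (q m (a i), law L (\<lambda>j. q m (a j)))) \<longlonglongrightarrow> (a i, law L a)"
      unfolding q_def by (intro tendsto_Pair tendsto_cell_point[OF b(1)] conv[unfolded q_def])
    then show "(\<lambda>m. u (q m (a i), law L (\<lambda>j. q m (a j)))) \<longlonglongrightarrow> u (a i, law L a)"
      by (rule continuous_on_tendsto_compose[OF continuous_on_apply_bcontfun[of UNIV]]) auto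
  next
    fix m
    have cm: "code b m \<in> measurable borel (count_space UNIV)"
      using b(2) by (intro measurable_code) simp
    have "(\<lambda>a. \<lambda>j\<in>space L. code b m (a j)) \<in> measurable play (\<Pi>\<^sub>M j\<in>space L. count_space UNIV)"
      by (intro measurable_restrict measurable_compose[OF measurable_play_component cm])
    then have *: "(\<lambda>a. \<lambda>j\<in>space L. code b m (a j)) \<in> measurable play (count_space (\<Pi>\<^sub>E j\<in>space L. UNIV))"
      by (subst (asm) count_space_PiM_finite[OF finite_players]) auto
    have "(\<lambda>a. \<Phi> (\<lambda>j\<in>space L. code b m (a j))) \<in> borel_measurable play"
      by (rule measurable_compose[OF *]) simp
    moreover have "\<Phi> (\<lambda>j\<in>space L. code b m (a j)) = u (q m (a i), law L (\<lambda>j. q m (a j)))" for a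
    proof -
      have "law L (\<lambda>j. cell_point b ((\<lambda>j\<in>space L. code b m (a j)) j)) = law L (\<lambda>j. q m (a j))"
        by (rule law_cong) (simp add: q_def)
      then show ?thesis using i by (simp add: \<Phi>_def q_def)
    qed
    ultimately show "(\<lambda>a. u (q m (a i), law L (\<lambda>j. q m (a j)))) \<in> borel_measurable play"
      by simp
  qed
qed

text \<open>Infeasible action profiles are null, so the domain of integration can be dropped.\<close>

lemma expected_payoff_eq:
  assumes g: "randomized_profile L H g" and i: "i \<in> space L"
  shows "expected_payoff L H g i = (\<integral>a. payoff H i (a i) (law L a) \<partial>play)"
proof -
  have feas: "AE a in play. a \<in> (\<Pi>\<^sub>E j\<in>space L. feasible H j)"
  proof -
    have "AE a in play. \<forall>j\<in>space L. a j \<in> feasible H j"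
    proof (rule AE_finite_allI[OF finite_players])
      fix j assume j: "j \<in> space L"
      interpret prob_space "meas (g j)" by (rule prob_space_meas)
      have "feasible H j \<in> sets borel" by (intro borel_closed compact_imp_closed compact_set_of)
      then have "AE x in meas (g j). x \<in> feasible H j"
        using g j by (intro AE_prob_1) (simp add: randomized_profile_def)
      then show "AE a in play. a j \<in> feasible H j"
        unfolding play_def using j by (intro AE_PiM_component prob_space_meas)
    qed
    moreover have "AE a in play. a \<in> space play" by (rule AE_space)
    ultimately show ?thesis
      by eventually_elim (auto simp: play_def space_PiM PiE_def)
  qed
  have closed: "feasible H j \<in> sets (meas (g j))" for j
    by (simp add: borel_closed compact_imp_closed compact_set_of)
  have [measurable]: "(\<Pi>\<^sub>E j\<in>space L. feasible H j) \<in> sets play"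
    unfolding play_def by (intro sets_PiM_I_finite finite_players closed)
  note measurable_play_payoff[OF i, measurable]
  have "expected_payoff L H g i = (\<integral>a. indicator (\<Pi>\<^sub>E j\<in>space L. feasible H j) a *\<^sub>R payoff H i (a i) (law L a) \<partial>play)"
    unfolding expected_payoff_def set_lebesgue_integral_def play_def mixture_dirac[OF L] ..
  also have "\<dots> = (\<integral>a. payoff H i (a i) (law L a) \<partial>play)"
    using feas by (intro integral_cong_AE) (auto elim: eventually_mono)
  finally show ?thesis .
qed

text \<open>Hoeffding's inequality. The empirical mass of \<open>B\<close> is a sum of independent terms with values in
\<open>{0..measure L {i}}\<close>, and the squares of the weights sum to at most the largest weight \<open>m\<close>.\<close>

lemma empirical_concentration:
  assumes B: "B \<in> sets borel" and m: "\<And>i. i \<in> space L \<Longrightarrow> measure L {i} \<le> m" and e: "0 < e"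
  shows "measure play {a\<in>space play. e \<le> \<bar>mass (law L a) B - mass (mixture L g) B\<bar>} \<le> m / e\<^sup>2"
proof -
  interpret P: prob_space play by (rule prob_space_play)
  have ne: "space L \<noteq> {}" using L by (auto simp: finite_prob_space_def prob_space.not_empty)
  define X where "X i a = measure L {i} * indicator B (a i)" for i and a :: "'j \<Rightarrow> 'a"
  have "P.indep_vars (\<lambda>_. borel) (\<lambda>i a. a i) (space L)"
  proof (subst P.indep_vars_iff_distr_eq_PiM'[OF ne measurable_play_component])
    have "distr play (\<Pi>\<^sub>M i\<in>space L. borel) (\<lambda>x. \<lambda>i\<in>space L. x i) = distr play play (\<lambda>x. x)"
    proof (rule distr_cong)
      show "sets (\<Pi>\<^sub>M i\<in>space L. borel) = sets play"
        unfolding play_def by (rule sets_PiM_cong) simp_all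
      show "(\<lambda>i\<in>space L. x i) = x" if "x \<in> space play" for x
        using that by (simp add: play_def space_PiM PiE_def extensional_restrict)
    qed simp
    also have "\<dots> = play" by (simp add: distr_id)
    also have "\<dots> = (\<Pi>\<^sub>M i\<in>space L. distr play borel (\<lambda>x. x i))"
    proof -
      have "(\<Pi>\<^sub>M i\<in>space L. distr play borel (\<lambda>x. x i)) = (\<Pi>\<^sub>M i\<in>space L. meas (g i))"
        by (rule PiM_cong[OF refl distr_play_component])
      then show ?thesis by (simp only: play_def)
    qed
    finally show "distr play (\<Pi>\<^sub>M i\<in>space L. borel) (\<lambda>x. \<lambda>i\<in>space L. x i) = (\<Pi>\<^sub>M i\<in>space L. distr play borel (\<lambda>x. x i))" .
  qed
  from P.indep_vars_compose2[OF this, of "\<lambda>i x. measure L {i} * indicator B x" "\<lambda>_. borel"]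
  have indep: "P.indep_vars (\<lambda>_. borel) X (space L)"
    unfolding X_def[abs_def] using B by simp
  define \<mu> where "\<mu> = (\<Sum>i\<in>space L. P.expectation (X i))"
  interpret Hoeffding_ineq play "space L" X "\<lambda>_. 0" "\<lambda>i. measure L {i}" \<mu>
    by unfold_locales (use indep finite_players in \<open>auto simp: X_def \<mu>_def indicator_def\<close>)
  define S where "S = (\<Sum>i\<in>space L. (measure L {i} - 0)\<^sup>2)"
  have S_le: "S \<le> m"
  proof -
    have "S \<le> (\<Sum>i\<in>space L. measure L {i} * m)"
      unfolding S_def using m by (intro sum_mono) (simp add: power2_eq_square mult_left_mono)
    also have "\<dots> = m" using sum_finite_prob_space[OF L] by (simp flip: sum_distrib_right)
    finally show ?thesis .
  qed
  have S_pos: "S > 0"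
  proof (rule ccontr)
    assume "\<not> S > 0"
    then have "S = 0" unfolding S_def by (simp add: sum_nonneg order_antisym not_less)
    then have "\<forall>i\<in>space L. measure L {i} = 0"
      unfolding S_def using finite_players by (simp add: sum_nonneg_eq_0_iff)
    then show False using sum_finite_prob_space[OF L] by simp
  qed
  have mu: "\<mu> = mass (mixture L g) B"
    unfolding \<mu>_def measure_mixture[OF L B]
  proof (rule sum.cong[OF refl])
    fix i assume i: "i \<in> space L"
    have "P.expectation (X i) = measure L {i} * (\<integral>a. indicator B (a i) \<partial>play)"
      by (simp add: X_def[abs_def])
    also have "(\<integral>a. indicator B (a i) \<partial>play) = (\<integral>x. (indicator B x :: real) \<partial>distr play borel (\<lambda>a. a i))"
      using B measurable_play_component[OF i] by (subst integral_distr) auto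
    also have "\<dots> = mass (g i) B"
      unfolding distr_play_component[OF i] using B by simp
    finally show "P.expectation (X i) = measure L {i} * mass (g i) B" .
  qed
  have "measure play {a\<in>space play. e \<le> \<bar>(\<Sum>i\<in>space L. X i a) - \<mu>\<bar>} \<le> 2 * exp (- 2 * e\<^sup>2 / S)"
    unfolding S_def using e S_pos by (intro Hoeffding_ineq_abs_ge) (auto simp: S_def)
  \<comment> \<open>A bound linear in \<open>m\<close> suffices, so \<open>exp (- x)\<close> is replaced by \<open>1 / x\<close>.\<close>
  also have "exp (- 2 * e\<^sup>2 / S) \<le> S / (2 * e\<^sup>2)"
  proof -
    have "2 * e\<^sup>2 / S \<le> exp (2 * e\<^sup>2 / S)"
      using exp_ge_add_one_self[of "2 * e\<^sup>2 / S"] by linarith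
    then show ?thesis using S_pos e by (simp add: exp_minus field_simps)
  qed
  also have "2 * (S / (2 * e\<^sup>2)) \<le> m / e\<^sup>2"
    using S_le e by (simp add: divide_right_mono)
  finally show ?thesis
    unfolding mu X_def measure_law_finite[OF L B] by simp
qed

end

text \<open>A decreasing sequence of sets of measures around \<open>\<tau>\<close>, described by countably many cells, such that
for resolving Borel sets \<open>b\<close> every sequence running through them converges to \<open>\<tau>\<close>.\<close>

definition near :: "'a::metric_space borel_prob \<Rightarrow> (nat \<Rightarrow> 'a set) \<Rightarrow> nat \<Rightarrow> 'a borel_prob set" where
  "near \<tau> b k = {\<nu>. \<forall>s. length s < k \<longrightarrow>
     \<bar>mass \<nu> (cell b s) - mass \<tau> (cell b s)\<bar> < inverse (real (Suc k))}"

text \<open>How much the payoff can vary with society near \<open>\<tau>\<close>, uniformly in the own action.\<close>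

definition oscillation :: "'a::metric_space borel_prob \<Rightarrow> (nat \<Rightarrow> 'a set) \<Rightarrow> nat \<Rightarrow> 'a payoff \<Rightarrow> real" where
  "oscillation \<tau> b k u =
    (SUP p\<in>UNIV \<times> near \<tau> b k. \<bar>u p - u (fst p, \<tau>)\<bar>)"

lemma self_near: "\<tau> \<in> near \<tau> b k"
  by (simp add: near_def)

lemma near_antimono: "k \<le> k' \<Longrightarrow> near \<tau> b k' \<subseteq> near \<tau> b k"
proof
  fix \<nu> assume k: "k \<le> k'" and \<nu>: "\<nu> \<in> near \<tau> b k'"
  have "inverse (real (Suc k')) \<le> inverse (real (Suc k))" using k by simp
  then show "\<nu> \<in> near \<tau> b k"
    using \<nu> k unfolding near_def by (fastforce intro: less_le_trans)
qed

lemma payoff_diff_le: "\<bar>u p - u q\<bar> \<le> 2 * norm u"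
  for u :: "'a::topological_space \<Rightarrow>\<^sub>C real"
  using norm_bounded[of u p] norm_bounded[of u q] by simp

lemma bdd_above_oscillation:
  fixes u :: "'a::metric_space payoff"
  shows "bdd_above ((\<lambda>p. \<bar>u p - u (fst p, \<tau>)\<bar>) ` (UNIV \<times> near \<tau> b k))"
  by (intro bdd_aboveI2[of _ _ "2 * norm u"] payoff_diff_le)

lemma oscillation_upper:
  fixes u :: "'a::metric_space payoff"
  assumes "\<nu> \<in> near \<tau> b k"
  shows "\<bar>u (a, \<nu>) - u (a, \<tau>)\<bar> \<le> oscillation \<tau> b k u"
proof -
  have "\<bar>u (a, \<nu>) - u (fst (a, \<nu>), \<tau>)\<bar> \<le> oscillation \<tau> b k u"
    unfolding oscillation_def using assms by (intro cSUP_upper bdd_above_oscillation) simp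
  then show ?thesis by simp
qed

lemma oscillation_least:
  fixes u :: "'a::metric_space payoff"
  assumes "\<And>a \<nu>. \<nu> \<in> near \<tau> b k \<Longrightarrow> \<bar>u (a, \<nu>) - u (a, \<tau>)\<bar> \<le> c"
  shows "oscillation \<tau> b k u \<le> c"
proof -
  have "UNIV \<times> near \<tau> b k \<noteq> {}" using self_near[of \<tau> b k] by auto
  then show ?thesis unfolding oscillation_def using assms by (intro cSUP_least) auto
qed

lemma oscillation_nonneg: "0 \<le> oscillation \<tau> b k u"
  using oscillation_upper[OF self_near[of \<tau> b k], of u undefined] by simp

lemma oscillation_lipschitz: "oscillation \<tau> b k u \<le> oscillation \<tau> b k u' + 2 * dist u u'"
proof (rule oscillation_least)
  fix a and \<nu> assume "\<nu> \<in> near \<tau> b k"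
  from oscillation_upper[OF this, of u' a] dist_bounded[of u "(a, \<nu>)" u'] dist_bounded[of u "(a, \<tau>)" u']
  show "\<bar>u (a, \<nu>) - u (a, \<tau>)\<bar> \<le> oscillation \<tau> b k u' + 2 * dist u u'"
    by (simp add: dist_real_def)
qed

lemma continuous_on_oscillation: "continuous_on UNIV (oscillation \<tau> b k)"
  unfolding continuous_on_iff
proof (intro ballI allI impI)
  fix u :: "'a payoff" and e :: real assume e: "0 < e"
  show "\<exists>d>0. \<forall>v\<in>UNIV. dist v u < d \<longrightarrow> dist (oscillation \<tau> b k v) (oscillation \<tau> b k u) < e"
  proof (intro exI[of _ "e / 2"] conjI ballI impI)
    fix v assume "dist v u < e / 2"
    then show "dist (oscillation \<tau> b k v) (oscillation \<tau> b k u) < e"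
      using oscillation_lipschitz[of \<tau> b k u v] oscillation_lipschitz[of \<tau> b k v u]
      by (simp add: dist_real_def dist_commute)
  qed (use e in simp)
qed

text \<open>Otherwise there are societies that converge to \<open>\<tau>\<close>, and actions, at which the payoff stays away from its
value against \<open>\<tau>\<close>; along a subsequence the actions converge as well, which contradicts continuity.\<close>

lemma oscillation_tendsto_0:
  fixes \<tau> :: "'a::compact_metric_space borel_prob" and u :: "'a payoff"
  assumes b: "resolving b" "\<And>l. b l \<in> sets borel"
  shows "(\<lambda>k. oscillation \<tau> b k u) \<longlonglongrightarrow> 0"
proof (rule ccontr)
  assume "\<not> ?thesis"
  then obtain e where e: "e > 0" "\<And>n. \<exists>k\<ge>n. e \<le> oscillation \<tau> b k u"
    using oscillation_nonneg[of \<tau> b _ u] unfolding LIMSEQ_iff by (auto simp: not_less)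
  have "\<exists>p. snd p \<in> near \<tau> b n \<and> e / 2 < \<bar>u p - u (fst p, \<tau>)\<bar>" for n
  proof (rule ccontr)
    assume neg: "\<not> ?thesis"
    obtain k where k: "k \<ge> n" "e \<le> oscillation \<tau> b k u" using e(2) by blast
    have "oscillation \<tau> b k u \<le> e / 2"
    proof (rule oscillation_least)
      fix a and \<nu> assume "\<nu> \<in> near \<tau> b k"
      then have "\<nu> \<in> near \<tau> b n" using near_antimono[OF k(1)] by blast
      then show "\<bar>u (a, \<nu>) - u (a, \<tau>)\<bar> \<le> e / 2"
        using neg by (metis fst_conv linorder_not_less snd_conv)
    qed
    with k e show False by simp
  qed
  then have "\<forall>n. \<exists>p. snd p \<in> near \<tau> b n \<and> e / 2 < \<bar>u p - u (fst p, \<tau>)\<bar>" by blast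
  then obtain p where p: "\<And>n. snd (p n) \<in> near \<tau> b n"
    "\<And>n. e / 2 < \<bar>u (p n) - u (fst (p n), \<tau>)\<bar>"
    by (auto simp only: choice_iff)
  have nu: "(\<lambda>n. snd (p n)) \<longlonglongrightarrow> \<tau>"
  proof (rule tendsto_borel_prob_cells[OF b])
    fix s
    have "(\<lambda>n. mass (snd (p n)) (cell b s) - mass \<tau> (cell b s)) \<longlonglongrightarrow> 0"
    proof (rule Lim_null_comparison[OF _ LIMSEQ_inverse_real_of_nat])
      show "\<forall>\<^sub>F n in sequentially. norm (mass (snd (p n)) (cell b s) - mass \<tau> (cell b s))
          \<le> inverse (real (Suc n))"
        using eventually_gt_at_top[of "length s"]
      proof eventually_elim
        case (elim n)
        then show ?case using p(1)[of n] by (auto simp: near_def intro: less_imp_le)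
      qed
    qed
    then show "(\<lambda>n. mass (snd (p n)) (cell b s)) \<longlonglongrightarrow> mass \<tau> (cell b s)"
      by (rule LIM_zero_cancel)
  qed
  have "seq_compact (UNIV :: 'a set)"
    using compact_whole_space by (simp add: compact_eq_seq_compact_metric)
  then obtain a r where "strict_mono (r :: nat \<Rightarrow> nat)" "((\<lambda>n. fst (p n)) \<circ> r) \<longlonglongrightarrow> a"
    by (rule seq_compactE[where f = "\<lambda>n. fst (p n)"]) auto
  then have r: "strict_mono r" "(\<lambda>n. fst (p (r n))) \<longlonglongrightarrow> a"
    by (simp_all add: o_def)
  have nur: "(\<lambda>n. snd (p (r n))) \<longlonglongrightarrow> \<tau>"
    using LIMSEQ_subseq_LIMSEQ[OF nu r(1)] by (simp add: o_def)
  have "(\<lambda>n. (fst (p (r n)), snd (p (r n)))) \<longlonglongrightarrow> (a, \<tau>)"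
    by (intro tendsto_Pair r nur)
  then have l1: "(\<lambda>n. u (p (r n))) \<longlonglongrightarrow> u (a, \<tau>)"
    by (intro continuous_on_tendsto_compose[OF continuous_on_apply_bcontfun[of UNIV u]]) auto
  have "(\<lambda>n. (fst (p (r n)), \<tau>)) \<longlonglongrightarrow> (a, \<tau>)"
    by (intro tendsto_Pair r tendsto_const)
  then have l2: "(\<lambda>n. u (fst (p (r n)), \<tau>)) \<longlonglongrightarrow> u (a, \<tau>)"
    by (intro continuous_on_tendsto_compose[OF continuous_on_apply_bcontfun[of UNIV u]]) auto
  have "(\<lambda>n. \<bar>u (p (r n)) - u (fst (p (r n)), \<tau>)\<bar>) \<longlonglongrightarrow> \<bar>u (a, \<tau>) - u (a, \<tau>)\<bar>"
    by (intro tendsto_intros l1 l2)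
  then have "e / 2 \<le> \<bar>u (a, \<tau>) - u (a, \<tau>)\<bar>"
    using p(2) by (intro LIMSEQ_le_const) (auto intro: less_imp_le)
  with e show False by simp
qed

text \<open>The number of short bit strings, which are the cells that define \<open>near\<close>, times the factor from
\<open>empirical_concentration\<close> for half the radius of \<open>near\<close>.\<close>

definition tail_bound :: "nat \<Rightarrow> real" where
  "tail_bound k = real (card {s :: bool list. length s < k}) * (2 * real (Suc k))\<^sup>2"

lemma tail_bound_nonneg: "0 \<le> tail_bound k"
  by (simp add: tail_bound_def)

lemma finite_short_lists: "finite {s :: bool list. length s < k}"
  using finite_lists_length_le[of "UNIV :: bool set" k] by (rule finite_subset[rotated]) auto

context
  fixes L :: "'j measure" and n :: nat and \<tau> :: "'a::compact_metric_space borel_prob"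
    and b :: "nat \<Rightarrow> 'a set" and m :: real and k :: nat
  assumes L: "finite_prob_space L n"
    and b: "\<And>l. b l \<in> sets borel"
    and m: "\<And>i. i \<in> space L \<Longrightarrow> measure L {i} \<le> m"
begin

lemma cell_borel: "cell b s \<in> sets borel"
  using b by (rule sets_cell)

lemma weight_bound_nonneg: "0 \<le> m"
proof -
  have "space L \<noteq> {}" using L by (auto simp: finite_prob_space_def prob_space.not_empty)
  then obtain i where "i \<in> space L" by blast
  from m[OF this] measure_nonneg[of L "{i}"] show ?thesis by linarith
qed

lemma sets_law_near: "{a\<in>space (play L g). law L a \<notin> near \<tau> b k} \<in> sets (play L g)"
proof -
  note measurable_play_law_cell[OF L cell_borel, where g = g, measurable]
  have "{a\<in>space (play L g). law L a \<notin> near \<tau> b k} =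
    (\<Union>s\<in>{s. length s < k}. {a\<in>space (play L g). inverse (real (Suc k)) \<le>
       \<bar>mass (law L a) (cell b s) - mass \<tau> (cell b s)\<bar>})"
    by (auto simp: near_def not_less)
  also have "\<dots> \<in> sets (play L g)"
    by (intro sets.finite_UN finite_short_lists) measurable
  finally show ?thesis .
qed

text \<open>The other half of the radius is left for the distance between \<open>\<tau>\<close> and the mean.\<close>

lemma prob_law_not_near:
  assumes mix: "\<And>s. length s < k \<Longrightarrow>
    \<bar>mass (mixture L g) (cell b s) - mass \<tau> (cell b s)\<bar> < inverse (real (Suc k)) / 2"
  shows "measure (play L g) {a\<in>space (play L g). law L a \<notin> near \<tau> b k} \<le> tail_bound k * m"
proof -
  interpret P: prob_space "play L g" by (rule prob_space_play[OF L])
  define e where "e = inverse (real (Suc k)) / 2"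
  define Bad where "Bad s = {a\<in>space (play L g). e \<le> \<bar>mass (law L a) (cell b s) - mass (mixture L g) (cell b s)\<bar>}" for s
  note measurable_play_law_cell[OF L cell_borel, where g = g, measurable]
  have Bad[measurable]: "Bad s \<in> sets (play L g)" for s unfolding Bad_def by measurable
  have "{a\<in>space (play L g). law L a \<notin> near \<tau> b k} \<subseteq> (\<Union>s\<in>{s. length s < k}. Bad s)"
  proof
    fix a assume "a \<in> {a\<in>space (play L g). law L a \<notin> near \<tau> b k}"
    then obtain s where a: "a \<in> space (play L g)" and s: "length s < k"
      "inverse (real (Suc k)) \<le> \<bar>mass (law L a) (cell b s) - mass \<tau> (cell b s)\<bar>"
      by (auto simp: near_def not_less)
    have "e \<le> \<bar>mass (law L a) (cell b s) - mass (mixture L g) (cell b s)\<bar>"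
      using s(2) mix[OF s(1)] unfolding e_def by linarith
    then show "a \<in> (\<Union>s\<in>{s. length s < k}. Bad s)" using a s(1) by (auto simp: Bad_def)
  qed
  then have "measure (play L g) {a\<in>space (play L g). law L a \<notin> near \<tau> b k} \<le> measure (play L g) (\<Union>s\<in>{s. length s < k}. Bad s)"
    by (intro P.finite_measure_mono sets.finite_UN finite_short_lists Bad)
  also have "\<dots> \<le> (\<Sum>s | length s < k. measure (play L g) (Bad s))"
    by (intro measure_UNION_le finite_short_lists Bad)
  also have "\<dots> \<le> (\<Sum>s :: bool list | length s < k. m / e\<^sup>2)"
    unfolding Bad_def by (intro sum_mono empirical_concentration[OF L] cell_borel m) (simp_all add: e_def)
  also have "\<dots> = tail_bound k * m"
    by (simp add: tail_bound_def e_def field_simps power2_eq_square)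
  finally show ?thesis .
qed

lemma payoff_near_limit_payoff:
  fixes u :: "'a payoff"
  assumes i: "i \<in> space L"
    and mix: "\<And>s. length s < k \<Longrightarrow>
      \<bar>mass (mixture L g) (cell b s) - mass \<tau> (cell b s)\<bar> < inverse (real (Suc k)) / 2"
  shows "\<bar>(\<integral>a. u (a i, law L a) \<partial>play L g) - (\<integral>x. u (x, \<tau>) \<partial>meas (g i))\<bar>
    \<le> oscillation \<tau> b k u + 2 * norm u * (tail_bound k * m)"
proof -
  interpret P: prob_space "play L g" by (rule prob_space_play[OF L])
  define bad where "bad = {a\<in>space (play L g). law L a \<notin> near \<tau> b k}"
  have bad[measurable]: "bad \<in> sets (play L g)" unfolding bad_def by (rule sets_law_near)
  have nb: "\<bar>u p\<bar> \<le> norm u" for p using norm_bounded[of u p] by simp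
  have sec: "(\<lambda>x. u (x, \<tau>)) \<in> borel_measurable borel"
    by (intro borel_measurable_continuous_onI continuous_on_payoff_section)
  have secm: "(\<lambda>a. u (a i, \<tau>)) \<in> borel_measurable (play L g)"
    by (rule measurable_compose[OF measurable_play_component[OF L i] sec])
  have i1: "integrable (play L g) (\<lambda>a. u (a i, law L a))"
    using nb by (intro P.integrable_const_bound[of _ "norm u"] measurable_play_payoff[OF L i]) auto
  have i2: "integrable (play L g) (\<lambda>a. u (a i, \<tau>))"
    using nb by (intro P.integrable_const_bound[of _ "norm u"] secm) auto
  have i3: "integrable (play L g) (\<lambda>a. oscillation \<tau> b k u + 2 * norm u * indicator bad a)"
    using bad by (auto simp: integrable_indicator_iff less_top[symmetric])
  have "(\<integral>x. u (x, \<tau>) \<partial>meas (g i)) = (\<integral>a. u (a i, \<tau>) \<partial>play L g)"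
    unfolding distr_play_component[OF L i, where g = g, symmetric]
    by (rule integral_distr[OF measurable_play_component[OF L i] sec])
  then have "\<bar>(\<integral>a. u (a i, law L a) \<partial>play L g) - (\<integral>x. u (x, \<tau>) \<partial>meas (g i))\<bar> =
      \<bar>\<integral>a. u (a i, law L a) - u (a i, \<tau>) \<partial>play L g\<bar>"
    using i1 i2 by simp
  also have "\<dots> \<le> (\<integral>a. \<bar>u (a i, law L a) - u (a i, \<tau>)\<bar> \<partial>play L g)"
    by (rule integral_abs_bound)
  also have "\<dots> \<le> (\<integral>a. oscillation \<tau> b k u + 2 * norm u * indicator bad a \<partial>play L g)"
  proof (rule integral_mono)
    fix a assume a: "a \<in> space (play L g)"
    show "\<bar>u (a i, law L a) - u (a i, \<tau>)\<bar> \<le> oscillation \<tau> b k u + 2 * norm u * indicator bad a"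
    proof (cases "a \<in> bad")
      case True
      then show ?thesis
        using payoff_diff_le[of u "(a i, law L a)" "(a i, \<tau>)"] oscillation_nonneg[of \<tau> b k u] by simp
    next
      case False
      then have "law L a \<in> near \<tau> b k" using a by (simp add: bad_def)
      then show ?thesis using oscillation_upper[of "law L a" \<tau> b k u "a i"] False by simp
    qed
  qed (use i1 i2 i3 in auto)
  also have "\<dots> = oscillation \<tau> b k u + 2 * norm u * measure (play L g) bad"
    using bad by (subst Bochner_Integration.integral_add)
      (auto simp: P.prob_space integrable_indicator_iff less_top[symmetric])
  also have "\<dots> \<le> oscillation \<tau> b k u + 2 * norm u * (tail_bound k * m)"
    unfolding bad_def by (intro add_left_mono mult_left_mono prob_law_not_near mix) auto
  finally show ?thesis .
qed

lemma mixture_update_close: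
  fixes g :: "'j \<Rightarrow> 'a borel_prob"
  assumes i: "i \<in> space L" and B: "B \<in> sets borel"
  shows "\<bar>mass (mixture L (g(i := \<mu>))) B - mass (mixture L g) B\<bar> \<le> m"
proof -
  have fin: "finite (space L)" using L by (simp add: finite_prob_space_def)
  have le1: "mass \<nu> B \<le> 1" for \<nu> :: "'a borel_prob"
    using prob_space.prob_le_1[OF prob_space_meas] .
  have "mass (mixture L (g(i := \<mu>))) B - mass (mixture L g) B =
      measure L {i} * (mass \<mu> B - mass (g i) B)"
    unfolding measure_mixture[OF L B] using fin i
    by (simp add: sum.remove[OF fin i] right_diff_distrib)
  moreover have "\<bar>mass \<mu> B - mass (g i) B\<bar> \<le> 1"
    using le1[of \<mu>] le1[of "g i"] measure_nonneg[of "meas \<mu>" B] measure_nonneg[of "meas (g i)" B] by linarith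
  ultimately have "\<bar>mass (mixture L (g(i := \<mu>))) B - mass (mixture L g) B\<bar> \<le> measure L {i} * 1"
    by (simp only: abs_mult abs_of_nonneg[OF measure_nonneg] mult_left_mono measure_nonneg)
  then show ?thesis using m[OF i] by simp
qed

text \<open>Compare the equilibrium strategy with the deviation to a best reply against \<open>\<tau>\<close>. Under either strategy
the expected payoff is close to the payoff against \<open>\<tau>\<close>, so equilibrium bounds the regret against \<open>\<tau>\<close>;
and each action in \<open>B\<close> has a regret of at least the gap.\<close>

lemma Nash_gap_bound:
  fixes H :: "'j \<Rightarrow> 'a characteristic"
  assumes Nash: "randomized_Nash L H g" and i: "i \<in> space L" and B: "B \<in> sets borel"
    and mix: "\<And>s. length s < k \<Longrightarrow>
      \<bar>mass (mixture L g) (cell b s) - mass \<tau> (cell b s)\<bar> + m < inverse (real (Suc k)) / 2"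
  shows "gap \<tau> B (H i) * mass (g i) B
    \<le> 2 * oscillation \<tau> b k (snd (H i)) + 4 * norm (snd (H i)) * (tail_bound k * m)"
proof -
  let ?u = "snd (H i)"
  interpret g: prob_space "meas (g i)" by (rule prob_space_meas)
  have prof: "randomized_profile L H g" using Nash by (simp add: randomized_Nash_def)
  have closed: "feasible H i \<in> sets borel" by (intro borel_closed compact_imp_closed compact_set_of)
  obtain c where c: "c \<in> feasible H i" "?u (c, \<tau>) = max_over (fst (H i)) (\<lambda>a. ?u (a, \<tau>))"
    using max_over_attained[OF continuous_on_payoff_section, of "fst (H i)" ?u \<tau>] by metis
  define g' where "g' = g(i := dirac c)"
  have dc: "mass (dirac c) (feasible H i) = 1"
    using c(1) closed by (simp add: meas_dirac measure_return)
  then have prof': "randomized_profile L H g'"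
    using prof by (auto simp: randomized_profile_def g'_def)
  have sec: "(\<lambda>x. ?u (x, \<tau>)) \<in> borel_measurable borel"
    by (intro borel_measurable_continuous_onI continuous_on_payoff_section)
  have secint: "integrable (meas (g i)) (\<lambda>x. ?u (x, \<tau>))"
    using norm_bounded[of ?u] by (intro integrable_meas_bounded[OF sec, of "norm ?u"]) simp
  have mix1: "\<bar>mass (mixture L g) (cell b s) - mass \<tau> (cell b s)\<bar> < inverse (real (Suc k)) / 2"
    if "length s < k" for s
    using mix[OF that] weight_bound_nonneg by linarith
  have mix2: "\<bar>mass (mixture L g') (cell b s) - mass \<tau> (cell b s)\<bar> < inverse (real (Suc k)) / 2"
    if "length s < k" for s
    using mix[OF that] mixture_update_close[OF i cell_borel[of s], where g = g and \<mu> = "dirac c"] unfolding g'_def by linarith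
  define R where "R = oscillation \<tau> b k ?u + 2 * norm ?u * (tail_bound k * m)"
  have d1: "\<bar>expected_payoff L H g i - (\<integral>x. ?u (x, \<tau>) \<partial>meas (g i))\<bar> \<le> R"
    unfolding R_def expected_payoff_eq[OF L prof i] by (intro payoff_near_limit_payoff i mix1)
  have "\<bar>expected_payoff L H g' i - (\<integral>x. ?u (x, \<tau>) \<partial>meas (g' i))\<bar> \<le> R"
    unfolding R_def expected_payoff_eq[OF L prof' i] by (intro payoff_near_limit_payoff i mix2)
  moreover have "(\<integral>x. ?u (x, \<tau>) \<partial>meas (g' i)) = ?u (c, \<tau>)"
    using sec by (simp add: g'_def meas_dirac integral_return)
  moreover have "expected_payoff L H g i \<ge> expected_payoff L H g' i"
    using Nash i dc by (simp add: randomized_Nash_def g'_def)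
  ultimately have regret: "?u (c, \<tau>) - (\<integral>x. ?u (x, \<tau>) \<partial>meas (g i)) \<le> 2 * R"
    using d1 by linarith
  have feas: "AE x in meas (g i). x \<in> feasible H i"
    using prof i by (intro g.AE_prob_1) (simp add: randomized_profile_def)
  have "gap \<tau> B (H i) * mass (g i) B = (\<integral>x. gap \<tau> B (H i) * indicator B x \<partial>meas (g i))"
    using B by simp
  also have "\<dots> \<le> (\<integral>x. ?u (c, \<tau>) - ?u (x, \<tau>) \<partial>meas (g i))"
  proof (rule integral_mono_AE)
    show "AE x in meas (g i). gap \<tau> B (H i) * indicator B x \<le> ?u (c, \<tau>) - ?u (x, \<tau>)"
      using feas
    proof eventually_elim
      case (elim x)
      then show ?case
        using gap_le_regret[of x "H i" B \<tau>] max_over_upper[OF continuous_on_payoff_section elim, of ?u \<tau>] c(2)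
        by (cases "x \<in> B") auto
    qed
  qed (use secint B in \<open>auto simp: integrable_indicator_iff less_top[symmetric]\<close>)
  also have "\<dots> = ?u (c, \<tau>) - (\<integral>x. ?u (x, \<tau>) \<partial>meas (g i))"
    using secint g.prob_space by simp
  also note regret
  finally show ?thesis by (simp add: R_def)
qed

end

section \<open>Responses in the limit of finite games\<close>

lemma tendsto_integral_weak_limit:
  fixes f :: "'a::topological_space \<Rightarrow> real"
  assumes "(\<nu> \<longlongrightarrow> \<mu>) F" "continuous_on UNIV f" "\<And>x. \<bar>f x\<bar> \<le> B"
  shows "((\<lambda>n. \<integral>x. f x \<partial>meas (\<nu> n)) \<longlongrightarrow> (\<integral>x. f x \<partial>meas \<mu>)) F"
proof -
  obtain \<phi> :: "'a \<Rightarrow>\<^sub>C real" where "apply_bcontfun \<phi> = f"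
    using exists_bcontfun[OF assms(2,3)] by blast
  then show ?thesis using assms(1) unfolding tendsto_borel_prob_iff by auto
qed

text \<open>A bounded continuous indicator of payoffs that are too large for a uniform estimate.\<close>

definition excess :: "real \<Rightarrow> real \<Rightarrow> real" where
  "excess R t = min 1 (max 0 (t - R))"

text \<open>The bound for a single player depends on the type through the oscillation and the norm of the payoff.
Both are continuous in the type. So their truncated averages converge to integrals with respect
to \<open>\<mu>\<close>, and dominated convergence makes these small.\<close>

theorem average_gap_tendsto_0:
  fixes L :: "nat \<Rightarrow> 'j measure" and H :: "nat \<Rightarrow> 'j \<Rightarrow> 'a::compact_metric_space characteristic"
    and \<mu> :: "'a characteristic borel_prob"
  assumes L: "\<And>n. 1 \<le> n \<Longrightarrow> finite_prob_space (L n) n"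
    and small: "(\<lambda>n. SUP i\<in>space (L n). measure (L n) {i}) \<longlonglongrightarrow> 0"
    and types: "(\<lambda>n. law (L n) (H n)) \<longlonglongrightarrow> \<mu>"
    and Nash: "\<And>n. 1 \<le> n \<Longrightarrow> randomized_Nash (L n) (H n) (g n)"
    and mix: "(\<lambda>n. mixture (L n) (g n)) \<longlonglongrightarrow> \<tau>"
    and B: "B \<in> sets borel"
  shows "(\<lambda>n. \<Sum>i\<in>space (L n). measure (L n) {i} * (min 1 (gap \<tau> B (H n i)) * mass (g n i) B)) \<longlonglongrightarrow> 0"
proof -
  interpret \<mu>: prob_space "meas \<mu>" by (rule prob_space_meas)
  obtain b where b: "resolving b" "\<And>l. b l \<in> continuity_sets \<tau>"
    using exists_resolving_continuity_sets[of \<tau>] by blast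
  have bm: "b l \<in> sets borel" for l using b(2) by (rule continuity_setsD)
  define m where "m n = (SUP i\<in>space (L n). measure (L n) {i})" for n
  have m: "measure (L n) {i} \<le> m n" if "1 \<le> n" "i \<in> space (L n)" for n i
    unfolding m_def using L[OF that(1)] that(2)
    by (intro cSUP_upper bdd_above_finite) (auto simp: finite_prob_space_def)
  define A where "A n = (\<Sum>i\<in>space (L n). measure (L n) {i} * (min 1 (gap \<tau> B (H n i)) * mass (g n i) B))" for n
  have A0: "0 \<le> A n" for n
    unfolding A_def by (intro sum_nonneg mult_nonneg_nonneg measure_nonneg) (simp add: gap_nonneg)
  have mixlim: "(\<lambda>n. \<bar>mass (mixture (L n) (g n)) (cell b s) - mass \<tau> (cell b s)\<bar> + m n) \<longlonglongrightarrow> 0" for s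
  proof -
    have "(\<lambda>n. mass (mixture (L n) (g n)) (cell b s)) \<longlonglongrightarrow> mass \<tau> (cell b s)"
      using cell_continuity_sets[of b \<tau> s, OF b(2)]
      by (intro weak_limit_continuity_set[OF mix]) (auto dest: continuity_setsD)
    then have "(\<lambda>n. \<bar>mass (mixture (L n) (g n)) (cell b s) - mass \<tau> (cell b s)\<bar> + m n) \<longlonglongrightarrow>
        \<bar>mass \<tau> (cell b s) - mass \<tau> (cell b s)\<bar> + 0"
      unfolding m_def by (intro tendsto_intros small)
    then show ?thesis by simp
  qed
  have oc: "continuous_on UNIV (\<lambda>x :: 'a characteristic. min 1 (oscillation \<tau> b k (snd x)))" for k
    by (intro continuous_intros continuous_on_compose2[OF continuous_on_oscillation]) auto
  have ob: "\<bar>min 1 (oscillation \<tau> b k (snd x))\<bar> \<le> 1" for k and x :: "'a characteristic"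
    using oscillation_nonneg[of \<tau> b k "snd x"] by (simp add: min_def)
  have ec: "continuous_on UNIV (\<lambda>x :: 'a characteristic. excess R (norm (snd x)))" for R
    unfolding excess_def by (intro continuous_intros)
  have eb: "\<bar>excess R t\<bar> \<le> 1" for R t
    by (simp add: excess_def min_def max_def)
  show ?thesis
    unfolding A_def[symmetric]
  proof (rule order_tendstoI)
    show "\<forall>\<^sub>F n in sequentially. c < A n" if "c < 0" for c
      using that A0 by (auto intro!: always_eventually intro: less_le_trans)
  next
    fix e :: real assume e: "0 < e"
    have "(\<lambda>k. \<integral>x. min 1 (oscillation \<tau> b k (snd x)) \<partial>meas \<mu>) \<longlonglongrightarrow> (\<integral>x. 0 \<partial>meas \<mu>)"
    proof (rule integral_dominated_convergence[where w = "\<lambda>_. 1"])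
      show "AE x in meas \<mu>. (\<lambda>k. min 1 (oscillation \<tau> b k (snd x))) \<longlonglongrightarrow> 0"
      proof (rule AE_I2)
        fix x :: "'a characteristic"
        have "(\<lambda>k. min 1 (oscillation \<tau> b k (snd x))) \<longlonglongrightarrow> min 1 0"
          by (intro tendsto_intros oscillation_tendsto_0 b bm)
        then show "(\<lambda>k. min 1 (oscillation \<tau> b k (snd x))) \<longlonglongrightarrow> 0" by simp
      qed
      show "(\<lambda>x. min 1 (oscillation \<tau> b k (snd x))) \<in> borel_measurable (meas \<mu>)" for k
        using borel_measurable_continuous_onI[OF oc] by simp
    qed (use ob in auto)
    then have "\<forall>\<^sub>F k in sequentially. (\<integral>x. min 1 (oscillation \<tau> b k (snd x)) \<partial>meas \<mu>) < e / 8"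
      by (rule order_tendstoD) (use e in simp)
    then obtain k where k: "(\<integral>x. min 1 (oscillation \<tau> b k (snd x)) \<partial>meas \<mu>) < e / 8"
      by (auto dest: eventually_happens)
    have "(\<lambda>R. \<integral>x. excess (real R) (norm (snd x)) \<partial>meas \<mu>) \<longlonglongrightarrow> (\<integral>x. 0 \<partial>meas \<mu>)"
    proof (rule integral_dominated_convergence[where w = "\<lambda>_. 1"])
      show "AE x in meas \<mu>. (\<lambda>R. excess (real R) (norm (snd x))) \<longlonglongrightarrow> 0"
      proof (rule AE_I2)
        fix x :: "'a characteristic"
        have "\<forall>\<^sub>F R in sequentially. norm (snd x) < real R"
          using filterlim_real_sequentially by (auto simp: filterlim_at_top_dense)
        then have "\<forall>\<^sub>F R in sequentially. excess (real R) (norm (snd x)) = 0"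
          by eventually_elim (simp add: excess_def)
        then show "(\<lambda>R. excess (real R) (norm (snd x))) \<longlonglongrightarrow> 0" by (rule tendsto_eventually)
      qed
      show "(\<lambda>x. excess (real R) (norm (snd x))) \<in> borel_measurable (meas \<mu>)" for R
        using borel_measurable_continuous_onI[OF ec] by simp
    qed (use eb in auto)
    then have "\<forall>\<^sub>F R in sequentially. (\<integral>x. excess (real R) (norm (snd x)) \<partial>meas \<mu>) < e / 4"
      by (rule order_tendstoD) (use e in simp)
    then obtain R where R: "(\<integral>x. excess (real R) (norm (snd x)) \<partial>meas \<mu>) < e / 4"
      by (auto dest: eventually_happens)
    have ev1: "\<forall>\<^sub>F n in sequentially. (\<integral>x. min 1 (oscillation \<tau> b k (snd x)) \<partial>meas (law (L n) (H n))) < e / 8"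
      using tendsto_integral_weak_limit[OF types oc ob] k by (rule order_tendstoD)
    have ev2: "\<forall>\<^sub>F n in sequentially. (\<integral>x. excess (real R) (norm (snd x)) \<partial>meas (law (L n) (H n))) < e / 4"
      using tendsto_integral_weak_limit[OF types ec eb] R by (rule order_tendstoD)
    \<comment> \<open>Payoffs of norm at most \<open>R + 1\<close> admit this constant; for the others \<open>excess\<close> equals \<open>1\<close>.\<close>
    define K where "K = 4 * (real R + 1) * tail_bound k"
    have K0: "0 \<le> K" by (simp add: K_def tail_bound_nonneg)
    have "(\<lambda>n. K * m n) \<longlonglongrightarrow> K * 0"
      unfolding m_def by (intro tendsto_intros small)
    then have ev3: "\<forall>\<^sub>F n in sequentially. K * m n < e / 4"
      by (rule order_tendstoD) (use e in simp)
    have ev4: "\<forall>\<^sub>F n in sequentially. \<forall>s\<in>{s. length s < k}.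
      \<bar>mass (mixture (L n) (g n)) (cell b s) - mass \<tau> (cell b s)\<bar> + m n < inverse (real (Suc k)) / 2"
      by (intro eventually_ball_finite finite_short_lists ballI order_tendstoD(2)[OF mixlim]) simp
    show "\<forall>\<^sub>F n in sequentially. A n < e"
      using ev1 ev2 ev3 ev4 eventually_ge_at_top[of 1]
    proof eventually_elim
      case (elim n)
      note Ln = L[OF elim(5)]
      have bound: "min 1 (gap \<tau> B (H n i)) * mass (g n i) B \<le>
          2 * min 1 (oscillation \<tau> b k (snd (H n i))) + excess (real R) (norm (snd (H n i))) + K * m n"
        if i: "i \<in> space (L n)" for i
      proof -
        have gB: "0 \<le> mass (g n i) B" "mass (g n i) B \<le> 1"
          using prob_space.prob_le_1[OF prob_space_meas] by auto
        have one: "min 1 (gap \<tau> B (H n i)) * mass (g n i) B \<le> 1"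
          using gB mult_mono[of "min 1 (gap \<tau> B (H n i))" 1 "mass (g n i) B" 1] by simp
        have m0: "0 \<le> m n" using m[OF elim(5) i] measure_nonneg[of "L n" "{i}"] by linarith
        have Km: "0 \<le> K * m n" using K0 m0 by simp
        have o0: "0 \<le> oscillation \<tau> b k (snd (H n i))" by (rule oscillation_nonneg)
        have e0: "0 \<le> excess (real R) (norm (snd (H n i)))" by (simp add: excess_def)
        consider "1 \<le> oscillation \<tau> b k (snd (H n i))" | "norm (snd (H n i)) > real R + 1"
          | "oscillation \<tau> b k (snd (H n i)) < 1" "norm (snd (H n i)) \<le> real R + 1" by linarith
        then show ?thesis
        proof cases
          case 1
          then show ?thesis using one Km e0 by simp
        next
          case 2
          then have "excess (real R) (norm (snd (H n i))) = 1" by (simp add: excess_def)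
          then show ?thesis using one Km o0 by simp
        next
          case 3
          have "min 1 (gap \<tau> B (H n i)) * mass (g n i) B \<le> gap \<tau> B (H n i) * mass (g n i) B"
            using gB by (intro mult_right_mono) auto
          also have "\<dots> \<le> 2 * oscillation \<tau> b k (snd (H n i)) + 4 * norm (snd (H n i)) * (tail_bound k * m n)"
            by (rule Nash_gap_bound[OF Ln bm m[OF elim(5)] Nash[OF elim(5)] i B]) (use elim(4) in auto)
          also have "4 * norm (snd (H n i)) * (tail_bound k * m n) \<le> 4 * (real R + 1) * (tail_bound k * m n)"
            using 3 m0 tail_bound_nonneg[of k] by (intro mult_right_mono mult_left_mono mult_nonneg_nonneg) auto
          finally show ?thesis using 3 e0 by (simp add: K_def mult.assoc)
        qed
      qed
      have "A n \<le> (\<Sum>i\<in>space (L n). measure (L n) {i} *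
          (2 * min 1 (oscillation \<tau> b k (snd (H n i))) + excess (real R) (norm (snd (H n i))) + K * m n))"
        unfolding A_def by (intro sum_mono mult_left_mono bound) auto
      also have "\<dots> = 2 * (\<Sum>i\<in>space (L n). measure (L n) {i} * min 1 (oscillation \<tau> b k (snd (H n i))))
          + (\<Sum>i\<in>space (L n). measure (L n) {i} * excess (real R) (norm (snd (H n i))))
          + (\<Sum>i\<in>space (L n). measure (L n) {i}) * (K * m n)"
        by (simp add: sum.distrib sum_distrib_left sum_distrib_right algebra_simps)
      also have "\<dots> = 2 * (\<integral>x. min 1 (oscillation \<tau> b k (snd x)) \<partial>meas (law (L n) (H n)))
          + (\<integral>x. excess (real R) (norm (snd x)) \<partial>meas (law (L n) (H n))) + K * m n"
        using sum_finite_prob_space[OF Ln] integral_law_finite[OF Ln borel_measurable_continuous_onI[OF oc]]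
          integral_law_finite[OF Ln borel_measurable_continuous_onI[OF ec]] by simp
      also have "\<dots> < e" using elim(1-3) e by linarith
      finally show ?case .
    qed
  qed
qed

text \<open>By Tychonoff's theorem the sequence has a cluster point in the cube over all \<open>s\<close>. The filter of its
neighbourhoods makes uncountably many bounded sequences converge at once, where a subsequence would
serve only countably many.\<close>

lemma exists_limit_filter:
  fixes x :: "nat \<Rightarrow> 's \<Rightarrow> real"
  assumes x: "\<And>n s. x n s \<in> {0..1}"
  shows "\<exists>F. F \<noteq> bot \<and> F \<le> sequentially \<and> (\<forall>s. \<exists>l. ((\<lambda>n. x n s) \<longlongrightarrow> l) F)"
proof -
  have "compactin (product_topology (\<lambda>_ :: 's. euclidean) UNIV) (\<Pi>\<^sub>E s\<in>UNIV. {0..1 :: real})"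
    by (simp add: compactin_PiE)
  then have K: "compact (\<Pi>\<^sub>E s\<in>(UNIV :: 's set). {0..1 :: real})"
    by (simp add: euclidean_product_topology)
  have "eventually (\<lambda>y. y \<in> (\<Pi>\<^sub>E s\<in>UNIV. {0..1})) (filtermap x sequentially)"
    using x by (auto simp: eventually_filtermap intro!: always_eventually)
  moreover have "filtermap x sequentially \<noteq> bot" by (simp add: filtermap_bot_iff)
  ultimately obtain l where l: "inf (nhds l) (filtermap x sequentially) \<noteq> bot"
    using K unfolding compact_filter by blast
  define F where "F = inf sequentially (filtercomap x (nhds l))"
  have "F \<noteq> bot"
  proof
    assume "F = bot"
    then have "eventually (\<lambda>_. False) F" by simp
    then obtain P Q where P: "eventually P sequentially" and Q: "eventually Q (filtercomap x (nhds l))"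
      and PQ: "\<And>n. P n \<Longrightarrow> Q n \<Longrightarrow> False"
      unfolding F_def eventually_inf by blast
    obtain Q' where Q': "eventually Q' (nhds l)" "\<And>n. Q' (x n) \<Longrightarrow> Q n"
      using Q unfolding eventually_filtercomap by blast
    have "eventually (\<lambda>y. \<not> Q' y) (filtermap x sequentially)"
      unfolding eventually_filtermap using P by eventually_elim (use PQ Q'(2) in blast)
    with Q'(1) have "eventually (\<lambda>_. False) (inf (nhds l) (filtermap x sequentially))"
      unfolding eventually_inf by blast
    then show False using l by (simp add: eventually_False)
  qed
  moreover have "((\<lambda>n. x n s) \<longlongrightarrow> l s) F" for s
  proof -
    have "filterlim x (nhds l) F"
      unfolding F_def filterlim_def filtermap_le_iff_le_filtercomap by simp
    moreover have "((\<lambda>y. y s) \<longlongrightarrow> l s) (nhds l)"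
    proof (rule topological_tendstoI)
      fix V :: "real set" assume V: "open V" "l s \<in> V"
      have "continuous_on UNIV (\<lambda>y :: 's \<Rightarrow> real. y s)"
        by (rule continuous_on_product_coordinates)
      with V(1) have "open ((\<lambda>y :: 's \<Rightarrow> real. y s) -` V)" by (intro open_vimage)
      then show "\<forall>\<^sub>F y in nhds l. y s \<in> V" using V(2) unfolding eventually_nhds by blast
    qed
    ultimately show ?thesis by (rule filterlim_compose[rotated])
  qed
  moreover have "F \<le> sequentially" by (simp add: F_def)
  ultimately show ?thesis by blast
qed

text \<open>In the proof \<open>\<kappa> n (C, B)\<close> is the probability, in the \<open>n\<close>-th game, of a type in \<open>C\<close> together with an action in \<open>B\<close>,
and \<open>\<rho> C B\<close> is its limit. The function \<open>h s\<close> represents the conditional probability of \<open>cell b s\<close> given the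
type. The last property holds because \<open>\<rho>\<close> vanishes for types whose gap exceeds a positive level: there
the mass is at most a multiple of the average gap.\<close>

theorem limit_response_densities:
  fixes L :: "nat \<Rightarrow> 'j measure" and H :: "nat \<Rightarrow> 'j \<Rightarrow> 'a::compact_metric_space characteristic"
    and \<mu> :: "'a characteristic borel_prob"
  assumes L: "\<And>n. 1 \<le> n \<Longrightarrow> finite_prob_space (L n) n"
    and small: "(\<lambda>n. SUP i\<in>space (L n). measure (L n) {i}) \<longlonglongrightarrow> 0"
    and types: "(\<lambda>n. law (L n) (H n)) \<longlonglongrightarrow> \<mu>"
    and Nash: "\<And>n. 1 \<le> n \<Longrightarrow> randomized_Nash (L n) (H n) (g n)"
    and mix: "(\<lambda>n. mixture (L n) (g n)) \<longlonglongrightarrow> \<tau>"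
    and b: "\<And>l. b l \<in> continuity_sets \<tau>"
  obtains h :: "bool list \<Rightarrow> 'a characteristic \<Rightarrow> real" where
    "\<And>s. h s \<in> borel_measurable borel" "\<And>s x. 0 \<le> h s x" "\<And>s x. h s x \<le> 1"
    "AE x in meas \<mu>. h [] x = 1"
    "\<And>s. AE x in meas \<mu>. h s x = h (True # s) x + h (False # s) x"
    "\<And>s. (\<integral>x. h s x \<partial>meas \<mu>) = mass \<tau> (cell b s)"
    "\<And>s. AE x in meas \<mu>. 0 < h s x \<longrightarrow> gap \<tau> (cell b s) x \<le> 0"
proof -
  interpret \<mu>: prob_space "meas \<mu>" by (rule prob_space_meas)
  interpret alg: algebra UNIV "continuity_sets \<mu>" by (rule algebra_continuity_sets)
  interpret algt: algebra UNIV "continuity_sets \<tau>" by (rule algebra_continuity_sets)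
  have cellc: "cell b s \<in> continuity_sets \<tau>" for s using b by (rule cell_continuity_sets)
  have cellb: "cell b s \<in> sets borel" for s using cellc by (rule continuity_setsD)
  have prob1: "0 \<le> mass \<nu> B" "mass \<nu> B \<le> 1" for \<nu> :: "'a borel_prob" and B
    using prob_space.prob_le_1[OF prob_space_meas] by auto
  define \<kappa> where "\<kappa> n z = (if n = 0 then 0 else
    (\<Sum>i\<in>space (L n). measure (L n) {i} * (indicator (fst z) (H n i) * mass (g n i) (snd z))))"
    for n and z :: "'a characteristic set \<times> 'a set"
  have \<kappa>_eq: "\<kappa> n (C, B) = (\<Sum>i\<in>space (L n). measure (L n) {i} * (indicator C (H n i) * mass (g n i) B))"
    if "1 \<le> n" for n C B using that by (simp add: \<kappa>_def)
  have \<kappa>0: "0 \<le> \<kappa> n z" for n z by (auto simp: \<kappa>_def intro!: sum_nonneg)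
  have \<kappa>_le_types: "\<kappa> n (C, B) \<le> mass (law (L n) (H n)) C" if "1 \<le> n" "C \<in> sets borel" for n C B
    unfolding \<kappa>_eq[OF that(1)] measure_law_finite[OF L[OF that(1)] that(2)]
    using prob1 by (intro sum_mono mult_left_mono) (auto simp: indicator_def)
  have \<kappa>_UNIV: "\<kappa> n (C, UNIV) = mass (law (L n) (H n)) C" if "1 \<le> n" "C \<in> sets borel" for n C
  proof -
    have "mass (g n i) UNIV = 1" for i
      using prob_space.prob_space[OF prob_space_meas[of "g n i"]] by simp
    then show ?thesis
      unfolding \<kappa>_eq[OF that(1)] measure_law_finite[OF L[OF that(1)] that(2)] by simp
  qed
  have \<kappa>_mix: "\<kappa> n (UNIV, B) = mass (mixture (L n) (g n)) B" if "1 \<le> n" "B \<in> sets borel" for n B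
    unfolding \<kappa>_eq[OF that(1)] measure_mixture[OF L[OF that(1)] that(2)] by simp
  have "\<kappa> n z \<le> 1" for n z
  proof (cases "n = 0")
    case False
    then have n: "1 \<le> n" by simp
    have "\<kappa> n z \<le> \<kappa> n (UNIV, snd z)"
      using False by (auto simp: \<kappa>_def indicator_def intro!: sum_mono mult_left_mono)
    also have "\<dots> \<le> (\<Sum>i\<in>space (L n). measure (L n) {i} * 1)"
      unfolding \<kappa>_eq[OF n] using prob1 by (intro sum_mono mult_left_mono) auto
    finally show ?thesis using sum_finite_prob_space[OF L[OF n]] by simp
  qed (simp add: \<kappa>_def)
  with \<kappa>0 have "\<exists>F. F \<noteq> bot \<and> F \<le> sequentially \<and> (\<forall>z. \<exists>l. ((\<lambda>n. \<kappa> n z) \<longlongrightarrow> l) F)"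
    by (intro exists_limit_filter) auto
  then obtain F \<rho>' where F: "F \<noteq> bot" "F \<le> sequentially" and \<rho>': "\<forall>z. ((\<lambda>n. \<kappa> n z) \<longlongrightarrow> \<rho>' z) F"
    unfolding choice_iff by blast
  define \<rho> where "\<rho> C B = \<rho>' (C, B)" for C B
  have \<rho>: "((\<lambda>n. \<kappa> n (C, B)) \<longlongrightarrow> \<rho> C B) F" for C B using \<rho>' by (simp add: \<rho>_def)
  have ev1: "eventually (\<lambda>n. 1 \<le> n) F"
    using eventually_ge_at_top[of 1] F(2) by (simp add: filter_leD)
  have cong: "(k \<longlongrightarrow> l) F" if "(f \<longlongrightarrow> l) F" "\<And>n. 1 \<le> n \<Longrightarrow> f n = k n" for f k :: "nat \<Rightarrow> real" and l
    by (rule Lim_transform_eventually[OF that(1) eventually_mono[OF ev1]]) (rule that(2))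
  have typesF: "((\<lambda>n. law (L n) (H n)) \<longlongrightarrow> \<mu>) F" using types F(2) by (rule tendsto_mono[rotated])
  have mixF: "((\<lambda>n. mixture (L n) (g n)) \<longlongrightarrow> \<tau>) F" using mix F(2) by (rule tendsto_mono[rotated])
  have typesC: "((\<lambda>n. mass (law (L n) (H n)) C) \<longlongrightarrow> mass \<mu> C) F"
    if "C \<in> continuity_sets \<mu>" for C
    using that by (intro weak_limit_continuity_set[OF typesF]) (auto dest: continuity_setsD)
  have \<rho>0: "0 \<le> \<rho> C B" for C B
    by (rule tendsto_lowerbound[OF \<rho> _ F(1)]) (simp add: \<kappa>0)
  have \<rho>_le: "\<rho> C B \<le> mass \<mu> C" if C: "C \<in> continuity_sets \<mu>" for C B
    by (rule tendsto_le[OF F(1) typesC[OF C] \<rho>], rule eventually_mono[OF ev1])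
      (use C in \<open>auto intro: \<kappa>_le_types dest: continuity_setsD\<close>)
  have \<rho>_UNIV: "\<rho> C UNIV = mass \<mu> C" if C: "C \<in> continuity_sets \<mu>" for C
  proof (rule tendsto_unique[OF F(1) \<rho>])
    show "((\<lambda>n. \<kappa> n (C, UNIV)) \<longlongrightarrow> mass \<mu> C) F"
      by (rule cong[OF typesC[OF C]]) (simp add: \<kappa>_UNIV continuity_setsD(1)[OF C])
  qed
  have \<rho>_mix: "\<rho> UNIV B = mass \<tau> B" if B: "B \<in> continuity_sets \<tau>" for B
  proof (rule tendsto_unique[OF F(1) \<rho>])
    have "((\<lambda>n. mass (mixture (L n) (g n)) B) \<longlongrightarrow> mass \<tau> B) F"
      using B by (intro weak_limit_continuity_set[OF mixF]) (auto dest: continuity_setsD)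
    then show "((\<lambda>n. \<kappa> n (UNIV, B)) \<longlongrightarrow> mass \<tau> B) F"
      by (rule cong) (simp add: \<kappa>_mix continuity_setsD(1)[OF B])
  qed
  have \<rho>_add1: "\<rho> (C \<union> D) B = \<rho> C B + \<rho> D B" if "C \<inter> D = {}" for C D B
  proof (rule tendsto_unique[OF F(1) \<rho>])
    have "\<kappa> n (C, B) + \<kappa> n (D, B) = \<kappa> n (C \<union> D, B)" if "1 \<le> n" for n
      unfolding \<kappa>_eq[OF that] using \<open>C \<inter> D = {}\<close>
      by (subst sum.distrib[symmetric], intro sum.cong) (auto simp: indicator_def)
    then show "((\<lambda>n. \<kappa> n (C \<union> D, B)) \<longlongrightarrow> \<rho> C B + \<rho> D B) F"
      by (rule cong[OF tendsto_add[OF \<rho> \<rho>]])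
  qed
  have \<rho>_add2: "\<rho> C (B \<union> B') = \<rho> C B + \<rho> C B'" if B: "B \<in> sets borel" "B' \<in> sets borel" "B \<inter> B' = {}" for C B B'
  proof (rule tendsto_unique[OF F(1) \<rho>])
    have "mass \<nu> (B \<union> B') = mass \<nu> B + mass \<nu> B'" for \<nu> :: "'a borel_prob"
      using B by (intro finite_measure.finite_measure_Union finite_measure_meas) auto
    then have "\<kappa> n (C, B) + \<kappa> n (C, B') = \<kappa> n (C, B \<union> B')" if "1 \<le> n" for n
      unfolding \<kappa>_eq[OF that] by (simp add: sum.distrib[symmetric] algebra_simps)
    then show "((\<lambda>n. \<kappa> n (C, B \<union> B')) \<longlongrightarrow> \<rho> C B + \<rho> C B') F"
      by (rule cong[OF tendsto_add[OF \<rho> \<rho>]])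
  qed
  have alg': "algebra (space (meas \<mu>)) (continuity_sets \<mu>)" by (simp add: alg.algebra_axioms)
  have sub: "continuity_sets \<mu> \<subseteq> sets (meas \<mu>)" by (auto dest: continuity_setsD)
  have "\<exists>h\<in>borel_measurable (sigma (space (meas \<mu>)) (continuity_sets \<mu>)). (\<forall>x. 0 \<le> h x \<and> h x \<le> 1) \<and>
      (\<forall>C\<in>continuity_sets \<mu>. (\<integral>x\<in>C. h x \<partial>meas \<mu>) = \<rho> C (cell b s))" for s
    by (intro dominated_charge_density[OF finite_measure_meas alg' sub] \<rho>0 \<rho>_le \<rho>_add1)
  then have "\<forall>s. \<exists>h. h \<in> borel_measurable (sigma (space (meas \<mu>)) (continuity_sets \<mu>)) \<and> (\<forall>x. 0 \<le> h x \<and> h x \<le> 1) \<and>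
      (\<forall>C\<in>continuity_sets \<mu>. (\<integral>x\<in>C. h x \<partial>meas \<mu>) = \<rho> C (cell b s))" by blast
  then obtain h where hS: "\<And>s. h s \<in> borel_measurable (sigma (space (meas \<mu>)) (continuity_sets \<mu>))"
    and h01: "\<And>s x. 0 \<le> h s x" "\<And>s x. h s x \<le> 1"
    and hI: "\<And>s C. C \<in> continuity_sets \<mu> \<Longrightarrow> (\<integral>x\<in>C. h s x \<partial>meas \<mu>) = \<rho> C (cell b s)"
    unfolding choice_iff by blast
  have subalg: "subalgebra (meas \<mu>) (sigma (space (meas \<mu>)) (continuity_sets \<mu>))"
    using sets.sigma_sets_subset[OF sub] by (simp add: subalgebra_def space_measure_of_conv sets_measure_of_conv)
  have hm: "h s \<in> borel_measurable borel" for s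
    using measurable_from_subalg[OF subalg hS, of s] by simp
  have hint: "integrable (meas \<mu>) (h s)" for s
    using h01 by (intro integrable_meas_bounded[of _ 1] hm) simp
  have SI: "set_integrable (meas \<mu>) C (h s)" if "C \<in> sets borel" for C s
    using that by (intro integrable_imp_set_integrable hint) simp
  have top: "UNIV \<in> continuity_sets \<mu>" using alg.top by simp
  have "AE x in meas \<mu>. h [] x = 1"
  proof (rule AE_eq_if_integrals_eq_on_algebra[OF finite_measure_meas alg' sub hS hint])
    show "(\<integral>x\<in>C. h [] x \<partial>meas \<mu>) = (\<integral>x\<in>C. 1 \<partial>meas \<mu>)" if "C \<in> continuity_sets \<mu>" for C
    proof -
      have "(\<integral>x\<in>C. 1 \<partial>meas \<mu>) = mass \<mu> C"
        using continuity_setsD(1)[OF that] by (simp add: set_lebesgue_integral_def)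
      then show ?thesis using hI[OF that, of "[]"] \<rho>_UNIV[OF that] by simp
    qed
  qed auto
  moreover have "AE x in meas \<mu>. h s x = h (True # s) x + h (False # s) x" for s
  proof (rule AE_eq_if_integrals_eq_on_algebra[OF finite_measure_meas alg' sub hS hint])
    fix C assume C: "C \<in> continuity_sets \<mu>"
    have "cell b s = cell b (True # s) \<union> cell b (False # s)" by auto
    then have "\<rho> C (cell b s) = \<rho> C (cell b (True # s)) + \<rho> C (cell b (False # s))"
      by (simp only:) (intro \<rho>_add2 cellb, auto)
    then show "(\<integral>x\<in>C. h s x \<partial>meas \<mu>) = (\<integral>x\<in>C. h (True # s) x + h (False # s) x \<partial>meas \<mu>)"
      using SI C by (simp add: hI continuity_setsD)
  qed (use hS hint in \<open>auto intro!: borel_measurable_add\<close>)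
  moreover have "(\<integral>x. h s x \<partial>meas \<mu>) = mass \<tau> (cell b s)" for s
  proof -
    have "(\<integral>x. h s x \<partial>meas \<mu>) = (\<integral>x\<in>UNIV. h s x \<partial>meas \<mu>)" by (simp add: set_lebesgue_integral_def)
    then show ?thesis using hI[OF top] \<rho>_mix[OF cellc] by simp
  qed
  moreover have "AE x in meas \<mu>. 0 < h s x \<longrightarrow> gap \<tau> (cell b s) x \<le> 0" for s
  proof -
    let ?B = "cell b s"
    have gm: "gap \<tau> ?B \<in> borel_measurable borel"
      by (intro borel_measurable_continuous_onI continuous_on_gap)
    have "AE x in meas \<mu>. 0 < h s x \<longrightarrow> gap \<tau> ?B x < inverse (real (Suc m))" for m
    proof -
      obtain c where c: "0 < c" "c < inverse (real (Suc m))" "mass \<mu> {x. gap \<tau> ?B x = c} = 0"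
        using exists_null_level[OF gm, of 0 "inverse (real (Suc m))" \<mu>] by auto
      \<comment> \<open>A null level, so that the types of larger gap form a continuity set.\<close>
      define C where "C = {x. c < gap \<tau> ?B x}"
      have C: "C \<in> continuity_sets \<mu>"
        unfolding C_def by (rule continuity_sets_superlevel[OF continuous_on_gap c(3)])
      have Cb[measurable]: "C \<in> sets borel" using C by (rule continuity_setsD)
      define A where "A n = (\<Sum>i\<in>space (L n). measure (L n) {i} * (min 1 (gap \<tau> ?B (H n i)) * mass (g n i) ?B))" for n
      have "A \<longlonglongrightarrow> 0"
        unfolding A_def by (rule average_gap_tendsto_0[OF L small types Nash mix cellb])
      then have "(A \<longlongrightarrow> 0) F" using F(2) by (rule tendsto_mono[rotated])
      then have lim: "((\<lambda>n. inverse (min 1 c) * A n) \<longlongrightarrow> inverse (min 1 c) * 0) F"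
        by (intro tendsto_intros)
      have "\<kappa> n (C, ?B) \<le> inverse (min 1 c) * A n" if "1 \<le> n" for n
        unfolding \<kappa>_eq[OF that] A_def sum_distrib_left
      proof (rule sum_mono)
        fix i
        have "indicator C (H n i) \<le> inverse (min 1 c) * min 1 (gap \<tau> ?B (H n i))"
        proof (cases "H n i \<in> C")
          case True
          then have "min 1 c \<le> min 1 (gap \<tau> ?B (H n i))" by (simp add: C_def)
          moreover have "0 < min 1 c" using c by simp
          ultimately show ?thesis using True by (simp add: field_simps)
        qed (use c gap_nonneg[of \<tau> ?B "H n i"] in simp)
        then have "measure (L n) {i} * (indicator C (H n i) * mass (g n i) ?B) \<le>
            measure (L n) {i} * (inverse (min 1 c) * min 1 (gap \<tau> ?B (H n i)) * mass (g n i) ?B)"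
          by (intro mult_left_mono mult_right_mono) auto
        then show "measure (L n) {i} * (indicator C (H n i) * mass (g n i) ?B) \<le>
            inverse (min 1 c) * (measure (L n) {i} * (min 1 (gap \<tau> ?B (H n i)) * mass (g n i) ?B))"
          by (simp only: mult_ac)
      qed
      then have "\<rho> C ?B \<le> inverse (min 1 c) * 0"
        by (intro tendsto_le[OF F(1) lim \<rho>] eventually_mono[OF ev1])
      then have "(\<integral>x\<in>C. h s x \<partial>meas \<mu>) = 0" using hI[OF C, of s] \<rho>0[of C ?B] by simp
      then have "AE x in meas \<mu>. indicator C x *\<^sub>R h s x = 0"
        using SI[OF Cb, of s] h01(1)[of s] unfolding set_lebesgue_integral_def set_integrable_def
        by (subst (asm) integral_nonneg_eq_0_iff_AE) auto
      then show ?thesis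
        by eventually_elim (use c(2) in \<open>auto simp: C_def indicator_def split: if_splits\<close>)
    qed
    then have "AE x in meas \<mu>. \<forall>m. 0 < h s x \<longrightarrow> gap \<tau> ?B x < inverse (real (Suc m))"
      unfolding AE_all_countable by blast
    then show ?thesis
    proof eventually_elim
      case (elim x)
      show ?case
      proof
        assume "0 < h s x"
        with elim have "gap \<tau> ?B x \<le> inverse (real (Suc m))" for m by (simp add: less_imp_le)
        then show "gap \<tau> ?B x \<le> 0"
          by (intro LIMSEQ_le_const[OF LIMSEQ_inverse_real_of_nat]) auto
      qed
    qed
  qed
  ultimately show thesis using that[of h, OF hm h01] by blast
qed

section \<open>Pure selections from limit responses\<close>

text \<open>The closures of the cells contain best replies, which have the same limit as the points \<open>p n\<close>, and the
set of best replies is closed.\<close>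

lemma limit_in_best_responses:
  fixes x :: "'a::compact_metric_space characteristic"
  assumes b: "resolving b" and s: "\<And>n. length (s n) = n"
    and p: "\<And>n. p n \<in> cell b (s n)" "p \<longlonglongrightarrow> y"
    and gap: "\<And>n. gap \<tau> (cell b (s n)) x \<le> 0"
  shows "y \<in> set_of (fst x)"
    and "\<And>a. a \<in> set_of (fst x) \<Longrightarrow> (snd x) (a, \<tau>) \<le> (snd x) (y, \<tau>)"
proof -
  have "\<exists>c. c \<in> set_of (fst x) \<and> c \<in> closure (cell b (s n)) \<and>
    (\<forall>a\<in>set_of (fst x). (snd x) (a, \<tau>) \<le> (snd x) (c, \<tau>))" for n
  proof -
    have "cell b (s n) \<noteq> {}" using p(1)[of n] by blast
    from gap_eq_0_imp_best_response[OF gap[of n] this] show ?thesis by metis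
  qed
  then have "\<forall>n. \<exists>c. c \<in> set_of (fst x) \<and> c \<in> closure (cell b (s n)) \<and>
    (\<forall>a\<in>set_of (fst x). (snd x) (a, \<tau>) \<le> (snd x) (c, \<tau>))" by blast
  then obtain c where c: "\<And>n. c n \<in> set_of (fst x)" "\<And>n. c n \<in> closure (cell b (s n))"
    "\<And>n a. a \<in> set_of (fst x) \<Longrightarrow> (snd x) (a, \<tau>) \<le> (snd x) (c n, \<tau>)"
    unfolding choice_iff by blast
  have lim0: "(\<lambda>n. dist (c n) (p n)) \<longlonglongrightarrow> 0"
  proof (rule metric_LIMSEQ_I)
    fix e :: real assume "e > 0"
    then have e2: "e / 2 > 0" by simp
    then obtain N where N: "\<And>x y. code b N x = code b N y \<Longrightarrow> dist x y < e / 2"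
      using b unfolding resolving_def by blast
    have "dist (c n) (p n) < e" if "n \<ge> N" for n
    proof -
      obtain z where z: "z \<in> cell b (s n)" "dist z (c n) < e / 2"
        using c(2)[of n] e2 unfolding closure_approachable by blast
      have "code b n z = code b n (p n)" using z(1) p(1)[of n] by (simp add: mem_cell_iff s)
      then have "dist z (p n) < e / 2" using that by (rule N[OF code_eq_antimono])
      then show ?thesis using z(2) dist_triangle3[of "c n" "p n" z] by linarith
    qed
    then show "\<exists>N. \<forall>n\<ge>N. dist (dist (c n) (p n)) 0 < e" by auto
  qed
  have clim: "c \<longlonglongrightarrow> y"
  proof (rule metric_tendsto_imp_tendsto)
    show "(\<lambda>n. dist (c n) (p n) + dist (p n) y) \<longlonglongrightarrow> 0"
      using tendsto_add[OF lim0 p(2)[THEN tendsto_dist_iff[THEN iffD1]]] by simp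
    show "\<forall>\<^sub>F n in sequentially. dist (c n) y \<le> dist (dist (c n) (p n) + dist (p n) y) 0"
      by (simp add: dist_triangle)
  qed
  show "y \<in> set_of (fst x)"
    by (rule closed_sequentially[OF compact_imp_closed[OF compact_set_of] _ clim]) (simp add: c)
  fix a assume a: "a \<in> set_of (fst x)"
  have "(\<lambda>n. (snd x) (c n, \<tau>)) \<longlonglongrightarrow> (snd x) (y, \<tau>)"
    by (rule continuous_on_tendsto_compose[OF continuous_on_payoff_section clim]) auto
  then show "(snd x) (a, \<tau>) \<le> (snd x) (y, \<tau>)"
    using c(3)[OF a] by (intro LIMSEQ_le_const) auto
qed

text \<open>The tree of cells is copied inside \<open>M\<close>. At a node \<open>D s\<close> with conditional probability \<open>\<phi> s\<close>, Maharam's lemma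
cuts out a part with conditional probability \<open>\<phi> (True # s)\<close>, and additivity of \<open>\<phi>\<close> takes care of the
rest. The set \<open>J l\<close> collects the parts that are cut out at depth \<open>l\<close>.\<close>

theorem realize_densities:
  fixes \<phi> :: "bool list \<Rightarrow> 'i \<Rightarrow> real"
  assumes M: "finite_measure M" and F: "subalgebra M F"
    and ne: "nowhere_equivalent M (sets F)"
    and \<phi>: "\<And>s. \<phi> s \<in> borel_measurable F" "\<And>s i. 0 \<le> \<phi> s i" "\<And>s i. \<phi> s i \<le> 1"
    and top: "AE i in M. \<phi> [] i = 1"
    and split: "\<And>s. AE i in M. \<phi> s i = \<phi> (True # s) i + \<phi> (False # s) i"
  obtains J where "\<And>l. J l \<in> sets M"
    "\<And>s C. C \<in> sets F \<Longrightarrow> measure M (cell J s \<inter> space M \<inter> C) = (\<integral>i\<in>C. \<phi> s i \<partial>M)"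
proof -
  interpret finite_measure M by fact
  have FM: "sets F \<subseteq> sets M" and sp: "space F = space M" using F by (auto simp: subalgebra_def)
  have \<phi>m: "\<phi> s \<in> borel_measurable M" for s by (rule measurable_from_subalg[OF F \<phi>(1)])
  have \<phi>int: "integrable M (\<phi> s)" for s
    using \<phi>(2,3) by (intro integrable_const_bound[of _ 1] \<phi>m) auto
  have SI: "set_integrable M C (\<phi> s)" if "C \<in> sets F" for C s
    using that FM by (intro integrable_imp_set_integrable \<phi>int) auto
  have splitI: "(\<integral>i\<in>C. \<phi> s i \<partial>M) = (\<integral>i\<in>C. \<phi> (True # s) i \<partial>M) + (\<integral>i\<in>C. \<phi> (False # s) i \<partial>M)"
    if C: "C \<in> sets F" for C s
  proof -
    have "(\<integral>i\<in>C. \<phi> s i \<partial>M) = (\<integral>i\<in>C. \<phi> (True # s) i + \<phi> (False # s) i \<partial>M)"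
      using split[of s] C FM \<phi>m by (intro set_lebesgue_integral_cong_AE) auto
    then show ?thesis using SI[OF C] by simp
  qed
  define pick where "pick s X = (SOME E. E \<in> sets M \<and> E \<subseteq> X \<and>
    (\<forall>C\<in>sets F. measure M (E \<inter> C) = (\<integral>i\<in>C. \<phi> (True # s) i \<partial>M)))" for s X
  define D where "D = rec_list (space M) (\<lambda>\<beta> s X. if \<beta> then pick s X else X - pick s X)"
  have D: "D [] = space M" "D (True # s) = pick s (D s)" "D (False # s) = D s - D (True # s)" for s
    by (simp_all add: D_def)
  have pick: "pick s X \<in> sets M \<and> pick s X \<subseteq> X \<and> (\<forall>C\<in>sets F. measure M (pick s X \<inter> C) = (\<integral>i\<in>C. \<phi> (True # s) i \<partial>M))"
    if X: "X \<in> sets M" "\<And>C. C \<in> sets F \<Longrightarrow> measure M (X \<inter> C) = (\<integral>i\<in>C. \<phi> s i \<partial>M)" for s X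
  proof -
    have "\<exists>E\<in>sets M. E \<subseteq> X \<and> (\<forall>C\<in>sets F. measure M (E \<inter> C) = (\<integral>i\<in>C. \<phi> (True # s) i \<partial>M))"
    proof (rule nowhere_equivalent_exists_subset_with_density[OF M F ne X(1) \<phi>(1) \<phi>int \<phi>(2)])
      fix C assume C: "C \<in> sets F"
      have "0 \<le> (\<integral>i\<in>C. \<phi> (False # s) i \<partial>M)"
        unfolding set_lebesgue_integral_def using \<phi>(2)
        by (intro Bochner_Integration.integral_nonneg) (simp add: indicator_def)
      then show "(\<integral>i\<in>C. \<phi> (True # s) i \<partial>M) \<le> measure M (X \<inter> C)"
        using splitI[OF C, of s] X(2)[OF C] by simp
    qed
    then have "\<exists>E. E \<in> sets M \<and> E \<subseteq> X \<and> (\<forall>C\<in>sets F. measure M (E \<inter> C) = (\<integral>i\<in>C. \<phi> (True # s) i \<partial>M))"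
      by blast
    then show ?thesis unfolding pick_def by (rule someI_ex)
  qed
  have inv: "D s \<in> sets M \<and> (\<forall>C\<in>sets F. measure M (D s \<inter> C) = (\<integral>i\<in>C. \<phi> s i \<partial>M))" for s
  proof (induction s)
    case Nil
    have "measure M (space M \<inter> C) = (\<integral>i\<in>C. \<phi> [] i \<partial>M)" if C: "C \<in> sets F" for C
    proof -
      have CM: "C \<in> sets M" using C FM by auto
      have "(\<integral>i\<in>C. \<phi> [] i \<partial>M) = (\<integral>i\<in>C. 1 \<partial>M)"
        using top CM \<phi>m by (intro set_lebesgue_integral_cong_AE) auto
      also have "\<dots> = measure M C" using CM by (simp add: set_lebesgue_integral_def)
      finally show ?thesis using sets.sets_into_space[OF CM] by (simp add: Int_absorb1)
    qed
    then show ?case by (simp add: D)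
  next
    case (Cons \<beta> s)
    have X: "D s \<in> sets M" "\<And>C. C \<in> sets F \<Longrightarrow> measure M (D s \<inter> C) = (\<integral>i\<in>C. \<phi> s i \<partial>M)"
      using Cons by auto
    have T: "D (True # s) \<in> sets M" "D (True # s) \<subseteq> D s"
      "\<And>C. C \<in> sets F \<Longrightarrow> measure M (D (True # s) \<inter> C) = (\<integral>i\<in>C. \<phi> (True # s) i \<partial>M)"
      using pick[OF X] by (auto simp: D(2))
    have "measure M (D (False # s) \<inter> C) = (\<integral>i\<in>C. \<phi> (False # s) i \<partial>M)" if C: "C \<in> sets F" for C
    proof -
      have "D (False # s) \<inter> C = D s \<inter> C - D (True # s) \<inter> C" by (auto simp: D(3))
      then have "measure M (D (False # s) \<inter> C) = measure M (D s \<inter> C) - measure M (D (True # s) \<inter> C)"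
        using X(1) T(1,2) C FM by (simp only:) (intro finite_measure_Diff, auto)
      then show ?thesis using X(2)[OF C] T(3)[OF C] splitI[OF C, of s] by simp
    qed
    then show ?case using T X(1) by (cases \<beta>) (auto simp: D(3))
  qed
  have sub: "D (\<beta> # s) \<subseteq> D s" for \<beta> s
    using pick[of "D s" s] inv[of s] by (cases \<beta>) (auto simp: D(2,3))
  have disj: "length s = length s' \<Longrightarrow> s \<noteq> s' \<Longrightarrow> D s \<inter> D s' = {}" for s s'
  proof (induction s s' rule: list_induct2')
    case (4 \<beta> s \<beta>' s')
    show ?case
    proof (cases "s = s'")
      case True
      then have "\<beta> \<noteq> \<beta>'" using 4 by simp
      then show ?thesis unfolding True by (cases \<beta>; cases \<beta>') (auto simp: D(3))
    next
      case False
      then show ?thesis using 4 sub[of \<beta> s] sub[of \<beta>' s'] by auto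
    qed
  qed auto
  define J where "J l = (\<Union>s\<in>{s. length s = l}. D (True # s))" for l
  have cell: "cell J s \<inter> space M = D s" for s
  proof (induction s)
    case (Cons \<beta> s)
    have "D s \<inter> J (length s) = D (True # s)"
    proof (rule antisym)
      show "D s \<inter> J (length s) \<subseteq> D (True # s)"
      proof
        fix i assume i: "i \<in> D s \<inter> J (length s)"
        then obtain s' where s': "length s' = length s" "i \<in> D (True # s')" by (auto simp: J_def)
        then have "i \<in> D s'" using sub by blast
        then have "s' = s" using disj[OF s'(1)] i by blast
        then show "i \<in> D (True # s)" using s' by simp
      qed
      show "D (True # s) \<subseteq> D s \<inter> J (length s)" using sub[of True s] by (auto simp: J_def)
    qed
    then show ?case using Cons by (cases \<beta>) (auto simp: D(3))
  qed (simp add: D)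
  have "J l \<in> sets M" for l
    unfolding J_def using inv by (intro sets.finite_UN finite_codes) auto
  moreover have "measure M (cell J s \<inter> space M \<inter> C) = (\<integral>i\<in>C. \<phi> s i \<partial>M)" if "C \<in> sets F" for s C
    unfolding cell using inv that by blast
  ultimately show thesis by (rule that)
qed

text \<open>The code of a player with respect to \<open>J\<close> is almost surely the code of a shrinking sequence of nonempty
cells, and she plays their limit point. At each finite stage the cells of \<open>J\<close> have the measures that \<open>\<tau>\<close>
gives to the cells of \<open>b\<close>, so the law is \<open>\<tau>\<close>.\<close>

theorem pure_selection_nowhere_equivalent:
  fixes \<phi> :: "bool list \<Rightarrow> 'i \<Rightarrow> real" and \<tau> :: "'a::compact_metric_space borel_prob"
    and G :: "'i \<Rightarrow> 'a characteristic"
  assumes M: "prob_space M" and F: "subalgebra M F"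
    and ne: "nowhere_equivalent M (sets F)"
    and b: "resolving b" "\<And>l. b l \<in> sets borel"
    and \<phi>: "\<And>s. \<phi> s \<in> borel_measurable F" "\<And>s i. 0 \<le> \<phi> s i" "\<And>s i. \<phi> s i \<le> 1"
    and top: "AE i in M. \<phi> [] i = 1"
    and split: "\<And>s. AE i in M. \<phi> s i = \<phi> (True # s) i + \<phi> (False # s) i"
    and mass: "\<And>s. (\<integral>i. \<phi> s i \<partial>M) = mass \<tau> (cell b s)"
    and supp: "\<And>s. AE i in M. 0 < \<phi> s i \<longrightarrow> gap \<tau> (cell b s) (G i) \<le> 0"
  shows "\<exists>f\<in>borel_measurable M. law M f = \<tau> \<and> (AE i in M. f i \<in> feasible G i \<and>
    (\<forall>a\<in>feasible G i. payoff G i a \<tau> \<le> payoff G i (f i) \<tau>))"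
proof -
  interpret prob_space M by fact
  have FM: "sets F \<subseteq> sets M" and sp: "space F = space M" using F by (auto simp: subalgebra_def)
  have \<phi>m[measurable]: "\<phi> s \<in> borel_measurable M" for s by (rule measurable_from_subalg[OF F \<phi>(1)])
  have \<phi>int: "integrable M (\<phi> s)" for s
    using \<phi>(2,3) by (intro integrable_const_bound[of _ 1] \<phi>m) auto
  obtain J where Jm: "\<And>l. J l \<in> sets M"
    and J: "\<And>s C. C \<in> sets F \<Longrightarrow> measure M (cell J s \<inter> space M \<inter> C) = (\<integral>i\<in>C. \<phi> s i \<partial>M)"
    using realize_densities[OF finite_measure_axioms F ne \<phi> top split] by blast
  have Jm': "J l \<inter> space M \<in> sets M" for l using Jm by auto
  have codem: "code J n \<in> measurable M (count_space UNIV)" for n using Jm' by (rule measurable_code)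
  have cellJ: "measure M (cell J s \<inter> space M) = mass \<tau> (cell b s)" for s
    using J[of "space M" s] sets.top[of F] set_integral_space[OF \<phi>int[of s]] mass[of s] by (simp add: sp)
  define p where "p n i = cell_point b (code J n i)" for n i
  have pm: "p n \<in> borel_measurable M" for n
    unfolding p_def by (rule measurable_compose[OF codem]) simp
  have "AE i in M. i \<in> cell J s \<longrightarrow> 0 < \<phi> s i \<and> cell b s \<noteq> {}" for s
  proof -
    define Z where "Z = {i\<in>space F. \<phi> s i \<le> 0}"
    have Z: "Z \<in> sets F" unfolding Z_def using \<phi>(1) by measurable
    have "cell J s \<inter> space M \<in> sets M"
    proof -
      have "cell J s \<inter> space M = code J (length s) -` {s} \<inter> space M" by (auto simp: mem_cell_iff)
      then show ?thesis using measurable_sets[OF codem, of "{s}"] by simp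
    qed
    note cm = this
    have "(\<integral>i\<in>Z. \<phi> s i \<partial>M) = (\<integral>i\<in>Z. 0 \<partial>M)"
      unfolding set_lebesgue_integral_def using \<phi>(2)[of s]
      by (intro Bochner_Integration.integral_cong) (auto simp: Z_def indicator_def intro: antisym)
    then have "measure M (cell J s \<inter> space M \<inter> Z) = 0" using J[OF Z, of s] by simp
    then have "AE i in M. i \<notin> cell J s \<inter> space M \<inter> Z"
      using cm Z FM by (subst AE_iff_null_sets[symmetric]) (auto simp: null_sets_def emeasure_eq_measure)
    moreover have "AE i in M. i \<in> cell J s \<inter> space M \<longrightarrow> cell b s \<noteq> {}"
    proof (cases "cell b s = {}")
      case True
      then have "measure M (cell J s \<inter> space M) = 0" using cellJ[of s] by simp
      then have "AE i in M. i \<notin> cell J s \<inter> space M"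
        using cm by (subst AE_iff_null_sets[symmetric]) (auto simp: null_sets_def emeasure_eq_measure)
      then show ?thesis by eventually_elim blast
    qed simp
    ultimately show ?thesis using AE_space
      by eventually_elim (auto simp: Z_def sp)
  qed
  then have "AE i in M. \<forall>s. i \<in> cell J s \<longrightarrow> 0 < \<phi> s i \<and> cell b s \<noteq> {}"
    unfolding AE_all_countable by blast
  moreover have "AE i in M. \<forall>s. 0 < \<phi> s i \<longrightarrow> gap \<tau> (cell b s) (G i) \<le> 0"
    unfolding AE_all_countable using supp by blast
  ultimately have ae: "AE i in M. \<forall>n. gap \<tau> (cell b (code J n i)) (G i) \<le> 0 \<and> cell b (code J n i) \<noteq> {}"
    by eventually_elim (auto simp: mem_cell_iff)
  then obtain N0 where N0: "N0 \<in> null_sets M"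
    "\<And>i n. i \<in> space M - N0 \<Longrightarrow> gap \<tau> (cell b (code J n i)) (G i) \<le> 0 \<and> cell b (code J n i) \<noteq> {}"
    by (elim AE_E3) blast
  have pcell: "p n i \<in> cell b (code J n i)" if "i \<in> space M - N0" for n i
  proof -
    have "\<exists>z. z \<in> cell b (code J n i)" using N0(2)[OF that, of n] by blast
    then show ?thesis unfolding p_def cell_point_def by (rule someI_ex)
  qed
  have mono: "code b n x = code J n i" if "code b k x = code J k i" "n \<le> k" for n k i x
    using that by (induction k) (auto elim: le_SucE)
  have "\<exists>y. (\<lambda>n. p n i) \<longlonglongrightarrow> y" if i: "i \<in> space M - N0" for i
  proof -
    have "Cauchy (\<lambda>n. p n i)"
    proof (rule metric_CauchyI)
      fix e :: real assume "e > 0"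
      then obtain N where N: "\<And>x y. code b N x = code b N y \<Longrightarrow> dist x y < e"
        using b(1) unfolding resolving_def by blast
      have "code b N (p n i) = code J N i" if "n \<ge> N" for n
        using pcell[OF i, of n] by (intro mono[OF _ that]) (simp add: mem_cell_iff)
      then show "\<exists>N. \<forall>m\<ge>N. \<forall>n\<ge>N. dist (p m i) (p n i) < e" using N by metis
    qed
    then show ?thesis
      using completeE[OF compact_imp_complete[OF compact_whole_space], of "\<lambda>n. p n i"] by auto
  qed
  then obtain y where y: "\<And>i. i \<in> space M - N0 \<Longrightarrow> (\<lambda>n. p n i) \<longlonglongrightarrow> y i" by metis
  \<comment> \<open>The value on the null set \<open>N0\<close> is arbitrary.\<close>
  define f where "f i = (if i \<in> N0 then undefined else y i)" for i
  have N0m: "N0 \<in> sets M" using N0(1) by auto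
  have fm: "f \<in> borel_measurable M"
  proof (rule borel_measurable_LIMSEQ_metric)
    show "(\<lambda>i. if i \<in> N0 then undefined else p n i) \<in> borel_measurable M" for n
      using N0m pm[of n] by measurable
    show "(\<lambda>n. if i \<in> N0 then undefined else p n i) \<longlonglongrightarrow> f i" if "i \<in> space M" for i
      using y[of i] that by (auto simp: f_def)
  qed
  have good: "AE i in M. i \<in> space M - N0"
    using AE_not_in[OF N0(1)] AE_space by eventually_elim simp
  have plim: "AE i in M. (\<lambda>n. p n i) \<longlonglongrightarrow> f i"
    using good by eventually_elim (use y in \<open>simp add: f_def\<close>)
  have "law M f = \<tau>"
  proof (rule borel_prob_eqI)
    fix \<psi> :: "'a \<Rightarrow>\<^sub>C real"
    have \<psi>m[measurable]: "apply_bcontfun \<psi> \<in> borel_measurable borel"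
      by (intro borel_measurable_continuous_onI) simp
    have nb: "norm (\<psi> z) \<le> norm \<psi>" for z by (rule norm_bounded)
    interpret t: prob_space "meas \<tau>" by (rule prob_space_meas)
    have eq: "(\<integral>i. \<psi> (p n i) \<partial>M) = (\<integral>x. \<psi> (cell_point b (code b n x)) \<partial>meas \<tau>)" for n
      unfolding p_def using integral_code(1)[of M J "\<lambda>s. \<psi> (cell_point b s)" n, OF finite_measure_axioms Jm']
        integral_code(1)[of "meas \<tau>" b "\<lambda>s. \<psi> (cell_point b s)" n, OF finite_measure_meas] b(2)
      by (simp add: cellJ)
    have "(\<lambda>n. \<integral>i. \<psi> (p n i) \<partial>M) \<longlonglongrightarrow> (\<integral>i. \<psi> (f i) \<partial>M)"
    proof (rule integral_dominated_convergence[where w = "\<lambda>_. norm \<psi>"])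
      show "AE i in M. (\<lambda>n. \<psi> (p n i)) \<longlonglongrightarrow> \<psi> (f i)"
        using plim by eventually_elim
          (rule continuous_on_tendsto_compose[OF continuous_on_apply_bcontfun[of UNIV \<psi>]], auto)
    qed (use nb fm pm in auto)
    moreover have "(\<lambda>n. \<integral>x. \<psi> (cell_point b (code b n x)) \<partial>meas \<tau>) \<longlonglongrightarrow> (\<integral>x. \<psi> x \<partial>meas \<tau>)"
    proof (rule integral_dominated_convergence[where w = "\<lambda>_. norm \<psi>"])
      show "AE x in meas \<tau>. (\<lambda>n. \<psi> (cell_point b (code b n x))) \<longlonglongrightarrow> \<psi> x"
        by (intro AE_I2 continuous_on_tendsto_compose[OF continuous_on_apply_bcontfun[of UNIV \<psi>] tendsto_cell_point[OF b(1)]]) auto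
      have "code b n \<in> measurable (meas \<tau>) (count_space UNIV)" for n
        using b(2) by (intro measurable_code) simp
      then show "(\<lambda>x. \<psi> (cell_point b (code b n x))) \<in> borel_measurable (meas \<tau>)" for n
        by (rule measurable_compose) simp
    qed (use nb in auto)
    ultimately have "(\<integral>i. \<psi> (f i) \<partial>M) = (\<integral>x. \<psi> x \<partial>meas \<tau>)"
      unfolding eq by (rule LIMSEQ_unique)
    then show "(\<integral>x. \<psi> x \<partial>meas (law M f)) = (\<integral>x. \<psi> x \<partial>meas \<tau>)"
      by (simp add: meas_law[OF prob_space_axioms fm] integral_distr[OF fm \<psi>m])
  qed
  moreover have "AE i in M. f i \<in> feasible G i \<and> (\<forall>a\<in>feasible G i. payoff G i a \<tau> \<le> payoff G i (f i) \<tau>)"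
    using good
  proof eventually_elim
    case (elim i)
    then have "(\<lambda>n. p n i) \<longlonglongrightarrow> f i" using y[of i] by (simp add: f_def)
    from limit_in_best_responses[OF b(1) length_code pcell[OF elim] this] N0(2)[OF elim]
    show ?case by blast
  qed
  ultimately show ?thesis using fm by blast
qed

lemma sum_over_codes_eq_1:
  fixes \<phi> :: "bool list \<Rightarrow> real"
  assumes "\<phi> [] = 1" "\<And>s. \<phi> s = \<phi> (True # s) + \<phi> (False # s)"
  shows "(\<Sum>s | length s = n. \<phi> s) = 1"
proof (induction n)
  case (Suc n)
  have eq: "{s :: bool list. length s = Suc n} = Cons True ` {s. length s = n} \<union> Cons False ` {s. length s = n}"
  proof (rule set_eqI)
    fix s :: "bool list"
    show "s \<in> {s. length s = Suc n} \<longleftrightarrow> s \<in> Cons True ` {s. length s = n} \<union> Cons False ` {s. length s = n}"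
      by (cases s) (auto simp: image_iff)
  qed
  have "(\<Sum>s | length s = Suc n. \<phi> s) = (\<Sum>s | length s = n. \<phi> (True # s)) + (\<Sum>s | length s = n. \<phi> (False # s))"
    unfolding eq using finite_codes[of n]
    by (subst sum.union_disjoint) (auto simp: sum.reindex)
  also have "\<dots> = (\<Sum>s | length s = n. \<phi> s)"
    by (simp add: sum.distrib[symmetric] assms(2)[symmetric])
  finally show ?case using Suc by simp
qed (use assms(1) in simp)

lemma codes_separate_finite:
  assumes b: "resolving b" and Q: "finite Q"
  shows "\<exists>n. inj_on (code b n) Q"
  using Q
proof (induction Q)
  case (insert a Q)
  then obtain n where n: "inj_on (code b n) Q" by blast
  have "\<exists>k. code b k a \<noteq> code b k x" if "x \<noteq> a" for x
  proof -
    have "dist a x > 0" using that by simp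
    then obtain k where "\<And>x' y. code b k x' = code b k y \<Longrightarrow> dist x' y < dist a x"
      using b unfolding resolving_def by blast
    then have "code b k a \<noteq> code b k x" by blast
    then show ?thesis ..
  qed
  then obtain k where k: "\<And>x. x \<noteq> a \<Longrightarrow> code b (k x) a \<noteq> code b (k x) x" by metis
  define N where "N = Max (insert n (k ` Q))"
  have fin: "finite (insert n (k ` Q))" using insert by simp
  have nN: "n \<le> N" unfolding N_def using fin by simp
  have kN: "k x \<le> N" if "x \<in> Q" for x unfolding N_def using fin that by simp
  have "inj_on (code b N) (insert a Q)"
  proof (rule inj_onI)
    fix x y assume xy: "x \<in> insert a Q" "y \<in> insert a Q" "code b N x = code b N y"
    have an: "code b N a \<noteq> code b N z" if "z \<in> Q" "z \<noteq> a" for z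
      using k[OF that(2)] code_eq_antimono[of b N a z "k z"] kN[OF that(1)] by blast
    have "code b n x = code b n y" by (rule code_eq_antimono[OF xy(3) nN])
    then show "x = y"
      using xy an n by (metis inj_onD insertE)
  qed
  then show ?case by blast
qed simp

text \<open>The weight \<open>W a i\<close> of a single action is the limit of the densities of the cells around it. Distinct
actions end up in distinct cells, so the weights sum to at most \<open>1\<close>; since their integrals are the
point masses of \<open>\<tau>\<close>, which has no other mass on a countable space, they sum to \<open>1\<close> almost everywhere. An
action of positive weight lies only in cells of positive density.\<close>

theorem pure_selection_countable:
  fixes \<phi> :: "bool list \<Rightarrow> 'i \<Rightarrow> real" and \<tau> :: "'a::compact_metric_space borel_prob"
    and G :: "'i \<Rightarrow> 'a characteristic"
  assumes M: "prob_space M" and at: "atomless M" and A: "countable (UNIV :: 'a set)"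
    and b: "resolving b" "\<And>l. b l \<in> sets borel"
    and \<phi>: "\<And>s. \<phi> s \<in> borel_measurable M" "\<And>s i. 0 \<le> \<phi> s i" "\<And>s i. \<phi> s i \<le> 1"
    and top: "AE i in M. \<phi> [] i = 1"
    and split: "\<And>s. AE i in M. \<phi> s i = \<phi> (True # s) i + \<phi> (False # s) i"
    and mass: "\<And>s. (\<integral>i. \<phi> s i \<partial>M) = mass \<tau> (cell b s)"
    and supp: "\<And>s. AE i in M. 0 < \<phi> s i \<longrightarrow> gap \<tau> (cell b s) (G i) \<le> 0"
  shows "\<exists>f\<in>borel_measurable M. law M f = \<tau> \<and> (AE i in M. f i \<in> feasible G i \<and>
    (\<forall>a\<in>feasible G i. payoff G i a \<tau> \<le> payoff G i (f i) \<tau>))"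
proof -
  interpret prob_space M by fact
  interpret t: prob_space "meas \<tau>" by (rule prob_space_meas)
  note \<phi>(1)[measurable]
  define good where "good i \<longleftrightarrow> \<phi> [] i = 1 \<and> (\<forall>s. \<phi> s i = \<phi> (True # s) i + \<phi> (False # s) i)" for i
  have good: "AE i in M. good i"
  proof -
    have "AE i in M. \<forall>s. \<phi> s i = \<phi> (True # s) i + \<phi> (False # s) i"
      unfolding AE_all_countable using split by blast
    with top show ?thesis by eventually_elim (unfold good_def, blast)
  qed
  define W where "W a i = lim (\<lambda>n. \<phi> (code b n a) i)" for a i
  have Wm[measurable]: "W a \<in> borel_measurable M" for a unfolding W_def by measurable
  have dec: "decseq (\<lambda>n. \<phi> (code b n a) i)" if "good i" for a i
  proof (rule decseq_SucI)
    fix n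
    have "\<phi> (code b n a) i = \<phi> (True # code b n a) i + \<phi> (False # code b n a) i"
      using that unfolding good_def by blast
    then show "\<phi> (code b (Suc n) a) i \<le> \<phi> (code b n a) i"
      using \<phi>(2)[of "True # code b n a" i] \<phi>(2)[of "False # code b n a" i] by (cases "a \<in> b n") auto
  qed
  have Wlim: "(\<lambda>n. \<phi> (code b n a) i) \<longlonglongrightarrow> W a i" if g: "good i" for a i
  proof (rule decseq_convergent[where B = 0, OF dec[OF g, of a]])
    show "\<forall>n. 0 \<le> \<phi> (code b n a) i" using \<phi>(2) by blast
    fix l assume "(\<lambda>n. \<phi> (code b n a) i) \<longlonglongrightarrow> l"
    then show "(\<lambda>n. \<phi> (code b n a) i) \<longlonglongrightarrow> W a i" by (simp add: W_def limI)
  qed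
  have W0: "0 \<le> W a i" if "good i" for a i
    using \<phi>(2) by (intro LIMSEQ_le_const[OF Wlim[OF that]]) auto
  have Wle: "W a i \<le> \<phi> (code b n a) i" if "good i" for a i n
    by (rule decseq_ge[OF dec[OF that] Wlim[OF that]])
  have Wsum: "(\<Sum>a\<in>Q. W a i) \<le> 1" if g: "good i" and Q: "finite Q" for i Q
  proof -
    obtain n where n: "inj_on (code b n) Q" using codes_separate_finite[OF b(1) Q] by blast
    have "(\<Sum>a\<in>Q. W a i) \<le> (\<Sum>a\<in>Q. \<phi> (code b n a) i)" by (intro sum_mono Wle g)
    also have "\<dots> = (\<Sum>s\<in>code b n ` Q. \<phi> s i)" using n by (simp add: sum.reindex)
    also have "\<dots> \<le> (\<Sum>s | length s = n. \<phi> s i)"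
      using finite_codes \<phi>(2) by (intro sum_mono2) auto
    also have "\<dots> = 1"
      by (rule sum_over_codes_eq_1) (use g in \<open>unfold good_def, blast\<close>)+
    finally show ?thesis .
  qed
  have cellb: "cell b s \<in> sets borel" for s using b(2) by (rule sets_cell)
  have Wint: "(\<integral>i. W a i \<partial>M) = mass \<tau> {a}" for a
  proof (rule LIMSEQ_unique)
    show "(\<lambda>n. \<integral>i. \<phi> (code b n a) i \<partial>M) \<longlonglongrightarrow> (\<integral>i. W a i \<partial>M)"
    proof (rule integral_dominated_convergence[where w = "\<lambda>_. 1"])
      show "AE i in M. (\<lambda>n. \<phi> (code b n a) i) \<longlonglongrightarrow> W a i"
        using good by eventually_elim (rule Wlim)
    qed (use \<phi> in auto)
    have "(\<Inter>n. cell b (code b n a)) = {a}"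
    proof
      show "(\<Inter>n. cell b (code b n a)) \<subseteq> {a}"
      proof
        fix x assume "x \<in> (\<Inter>n. cell b (code b n a))"
        then have eq: "code b n x = code b n a" for n by (auto simp: mem_cell_iff)
        have "\<not> 0 < dist x a"
        proof
          assume "0 < dist x a"
          then obtain k where "\<And>x' y. code b k x' = code b k y \<Longrightarrow> dist x' y < dist x a"
            using b(1) unfolding resolving_def by blast
          from this[OF eq[of k]] show False by simp
        qed
        then show "x \<in> {a}" by simp
      qed
    qed (auto simp: mem_cell_iff)
    moreover have "decseq (\<lambda>n. cell b (code b n a))" by (rule decseq_SucI) auto
    ultimately have "(\<lambda>n. mass \<tau> (cell b (code b n a))) \<longlonglongrightarrow> mass \<tau> {a}"
      using t.finite_Lim_measure_decseq[of "\<lambda>n. cell b (code b n a)"] cellb by auto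
    then show "(\<lambda>n. \<integral>i. \<phi> (code b n a) i \<partial>M) \<longlonglongrightarrow> mass \<tau> {a}" by (simp add: mass)
  qed
  have borelI: "B \<in> sets borel" for B :: "'a set"
  proof (rule sets.countable)
    show "countable B" using A by (rule countable_subset[rotated]) simp
  qed simp
  define e :: "'a \<Rightarrow> nat" where "e = to_nat_on UNIV"
  have e: "inj e" unfolding e_def using A by (rule inj_on_to_nat_on)
  define w where "w n i = (if n \<in> range e then W (inv e n) i else 0)" for n i
  have wm[measurable]: "w n \<in> borel_measurable M" for n unfolding w_def by (cases "n \<in> range e") simp_all
  have we: "w (e a) i = W a i" for a i by (simp add: w_def e)
  have w0: "0 \<le> w n i" if "good i" for n i using W0[OF that] by (simp add: w_def)
  have wsum: "(\<Sum>n<N. w n i) \<le> 1" if g: "good i" for N i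
  proof -
    define Q where "Q = {a. e a < N}"
    have Q: "finite Q" unfolding Q_def using finite_vimageI[OF finite_lessThan[of N] e] by (simp add: vimage_def)
    have "(\<Sum>n<N. w n i) = (\<Sum>n\<in>e ` Q. w n i)"
      by (rule sum.mono_neutral_right) (auto simp: Q_def w_def)
    also have "\<dots> = (\<Sum>a\<in>Q. W a i)" using e by (subst sum.reindex) (auto intro: inj_on_subset simp: we)
    also have "\<dots> \<le> 1" by (rule Wsum[OF g Q])
    finally show ?thesis .
  qed
  have wsummable: "summable (\<lambda>n. w n i)" if "good i" for i
    by (rule summableI_nonneg_bounded[where x = 1]) (use that w0 wsum in auto)
  have wle1: "w n i \<le> 1" if "good i" for n i
    using wsum[OF that, of "Suc n"] sum_nonneg[of "{..<n}" "\<lambda>n. w n i"] w0[OF that] by simp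
  have wint: "(\<lambda>n. \<integral>i. w n i \<partial>M) sums 1"
  proof -
    define E where "E n = {a. e a = n}" for n
    have "(\<lambda>n. mass \<tau> (E n)) sums mass \<tau> (\<Union>n. E n)"
      using borelI by (intro t.finite_measure_UNION) (auto simp: disjoint_family_on_def E_def)
    moreover have "(\<Union>n. E n) = UNIV" by (auto simp: E_def)
    moreover have "mass \<tau> (E n) = (\<integral>i. w n i \<partial>M)" for n
    proof (cases "n \<in> range e")
      case True
      then obtain a where a: "n = e a" by blast
      then have "E n = {a}" using e by (auto simp: E_def inj_eq)
      then show ?thesis using Wint[of a] by (simp add: a we)
    next
      case False
      then have "E n = {}" by (auto simp: E_def)
      then show ?thesis using False by (simp add: w_def)
    qed
    ultimately show ?thesis using t.prob_space by simp
  qed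
  have winteg: "integrable M (w n)" for n
    using good by (intro integrable_const_bound[of _ 1]) (auto elim!: eventually_mono simp: w0 wle1)
  have one: "AE i in M. (\<Sum>n. w n i) = 1"
  proof -
    have S: "(\<integral>i. (\<Sum>n. w n i) \<partial>M) = (\<Sum>n. \<integral>i. w n i \<partial>M)" "integrable M (\<lambda>i. \<Sum>n. w n i)"
    proof -
      have 1: "AE i in M. summable (\<lambda>n. norm (w n i))"
        using good by eventually_elim (use wsummable w0 in simp)
      have "(\<integral>i. norm (w n i) \<partial>M) = (\<integral>i. w n i \<partial>M)" for n
        using good by (intro integral_cong_AE) (auto elim!: eventually_mono simp: w0)
      then have 2: "summable (\<lambda>n. \<integral>i. norm (w n i) \<partial>M)" using wint by (simp add: sums_iff)
      show "(\<integral>i. (\<Sum>n. w n i) \<partial>M) = (\<Sum>n. \<integral>i. w n i \<partial>M)" "integrable M (\<lambda>i. \<Sum>n. w n i)"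
        using winteg 1 2 by (auto intro: integral_suminf integrable_suminf)
    qed
    have "(\<integral>i. 1 - (\<Sum>n. w n i) \<partial>M) = 0"
      using S wint by (simp add: sums_iff prob_space)
    moreover have le: "AE i in M. 0 \<le> 1 - (\<Sum>n. w n i)"
      using good
    proof eventually_elim
      case (elim i)
      have "(\<Sum>n. w n i) \<le> 1"
        using wsum[OF elim] by (intro suminf_le_const wsummable[OF elim]) auto
      then show ?case by simp
    qed
    ultimately have "AE i in M. 1 - (\<Sum>n. w n i) = 0"
      using S(2) by (subst (asm) integral_nonneg_eq_0_iff_AE) auto
    then show ?thesis by eventually_elim simp
  qed
  have "AE i in M. good i \<and> (\<Sum>n. w n i) = 1" using good one by eventually_elim simp
  then obtain N0 where N0: "N0 \<in> null_sets M" "\<And>i. i \<in> space M - N0 \<Longrightarrow> good i \<and> (\<Sum>n. w n i) = 1"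
    by (elim AE_E3) blast
  have N0m[measurable]: "N0 \<in> sets M" using N0(1) by auto
  \<comment> \<open>Off the good set any weights with sum \<open>1\<close> will do.\<close>
  define h where "h n i = (if i \<in> space M - N0 then w n i else if n = 0 then 1 else 0)" for n i
  have ok: "AE i in M. i \<in> space M - N0"
    using AE_not_in[OF N0(1)] AE_space by eventually_elim simp
  have h0: "0 \<le> h n i" for n i using N0(2) w0 by (auto simp: h_def)
  have hs: "(\<lambda>n. h n i) sums 1" for i
  proof (cases "i \<in> space M - N0")
    case True
    then show ?thesis using N0(2)[OF True] wsummable[of i] by (simp add: h_def sums_iff)
  next
    case False
    then have "(\<lambda>n. h n i) = (\<lambda>n. if n = 0 then 1 else 0)" unfolding h_def by (simp only: if_False)
    then show ?thesis using sums_single[of 0 "\<lambda>_. 1 :: real"] by simp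
  qed
  have hm: "h n \<in> borel_measurable M" for n unfolding h_def by measurable
  obtain c where c: "c \<in> measurable M (count_space UNIV)"
    and cm: "\<And>n. measure M {i\<in>space M. c i = n} = (\<integral>i. h n i \<partial>M)" and cpos: "AE i in M. 0 < h (c i) i"
    using countable_purification[OF finite_measure_axioms at hm h0 hs] by blast
  have hw: "(\<integral>i. h n i \<partial>M) = (\<integral>i. w n i \<partial>M)" for n
    using ok by (intro integral_cong_AE hm wm) (auto elim!: eventually_mono simp: h_def)
  define f where "f i = inv e (c i)" for i
  have fm[measurable]: "f \<in> borel_measurable M"
    unfolding f_def by (rule measurable_compose[OF c]) simp
  have cf: "AE i in M. good i \<and> c i = e (f i) \<and> 0 < W (f i) i"
    using cpos ok
  proof eventually_elim
    case (elim i)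
    then have "0 < w (c i) i" by (simp add: h_def)
    then have "c i \<in> range e" by (simp add: w_def split: if_splits)
    then have "c i = e (f i)" by (simp add: f_def f_inv_into_f)
    then show ?case using \<open>0 < w (c i) i\<close> N0(2)[OF elim(2)] we[of "f i" i] by simp
  qed
  have "meas (law M f) = meas \<tau>"
  proof (rule measure_eqI_countable[OF _ _ A])
    show "sets (meas (law M f)) = Pow UNIV" "sets (meas \<tau>) = Pow UNIV"
      using borelI by auto
    fix a
    have "mass (law M f) {a} = measure M {i\<in>space M. f i = a}"
      by (subst meas_law[OF prob_space_axioms fm], subst measure_distr) (auto simp: vimage_def Int_def conj_commute)
    also have "\<dots> = measure M {i\<in>space M. c i = e a}"
    proof (rule measure_eq_AE)
      show "AE i in M. i \<in> {i\<in>space M. f i = a} \<longleftrightarrow> i \<in> {i\<in>space M. c i = e a}"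
        using cf by eventually_elim (use e in \<open>auto simp: inj_eq\<close>)
      show "{i\<in>space M. c i = e a} \<in> sets M" using c by measurable
      have "{i\<in>space M. f i = a} = f -` {a} \<inter> space M" by auto
      then show "{i\<in>space M. f i = a} \<in> sets M" using fm by simp
    qed
    also have "\<dots> = mass \<tau> {a}" using cm[of "e a"] hw[of "e a"] Wint[of a] by (simp add: we)
    finally show "emeasure (meas (law M f)) {a} = emeasure (meas \<tau>) {a}"
      by (simp add: finite_measure.emeasure_eq_measure[OF finite_measure_meas])
  qed
  then have "law M f = \<tau>" by (simp add: meas_inject)
  moreover have "AE i in M. \<forall>s. 0 < \<phi> s i \<longrightarrow> gap \<tau> (cell b s) (G i) \<le> 0"
    unfolding AE_all_countable using supp by blast
  then have "AE i in M. f i \<in> feasible G i \<and> (\<forall>a\<in>feasible G i. payoff G i a \<tau> \<le> payoff G i (f i) \<tau>)"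
    using cf
  proof eventually_elim
    case (elim i)
    then have g: "good i" and W: "0 < W (f i) i" by auto
    have gp: "gap \<tau> (cell b (code b n (f i))) (G i) \<le> 0" for n
      using Wle[OF g, of "f i" n] W elim(1) by force
    have "f i \<in> cell b (code b n (f i))" for n by (simp add: mem_cell_iff)
    from limit_in_best_responses[OF b(1) length_code this tendsto_const gp]
    show ?case by blast
  qed
  ultimately show ?thesis using fm by blast
qed

section \<open>The closed graph property\<close>

theorem proposition2:
  fixes M :: "'i measure"
    and G :: "'i \<Rightarrow> 'a::compact_metric_space characteristic"
  assumes "large_game M G"
    and "countable_valued M G \<or> nowhere_equivalent M (game_algebra M G)"
  shows "pure_closed_graph TYPE('j) M G"
  unfolding pure_closed_graph_def
proof (intro allI impI)
  fix L :: "nat \<Rightarrow> 'j measure" and H :: "nat \<Rightarrow> 'j \<Rightarrow> 'a characteristic"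
    and g :: "nat \<Rightarrow> 'j \<Rightarrow> 'a borel_prob" and \<tau> :: "'a borel_prob"
  assume L: "\<forall>n\<ge>1. finite_prob_space (L n) n"
    and small: "(\<lambda>n. SUP i\<in>space (L n). measure (L n) {i}) \<longlonglongrightarrow> 0"
    and types: "(\<lambda>n. law (L n) (H n)) \<longlonglongrightarrow> law M G"
    and Nash: "\<forall>n\<ge>1. randomized_Nash (L n) (H n) (g n)"
    and mix: "(\<lambda>n. mixture (L n) (g n)) \<longlonglongrightarrow> \<tau>"
  have M: "prob_space M" "atomless M" and Gm: "G \<in> borel_measurable M"
    using assms(1) by (auto simp: large_game_def)
  interpret prob_space M by (rule M)
  obtain b where b: "resolving b" "\<And>l. b l \<in> continuity_sets \<tau>"
    using exists_resolving_continuity_sets[of \<tau>] by blast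
  have bm: "b l \<in> sets borel" for l using b(2) by (rule continuity_setsD)
  obtain h where hm: "\<And>s. h s \<in> borel_measurable borel" and h: "\<And>s x. 0 \<le> h s x" "\<And>s x. h s x \<le> 1"
    and top: "AE x in meas (law M G). h [] x = 1"
    and split: "\<And>s. AE x in meas (law M G). h s x = h (True # s) x + h (False # s) x"
    and mass: "\<And>s. (\<integral>x. h s x \<partial>meas (law M G)) = mass \<tau> (cell b s)"
    and supp: "\<And>s. AE x in meas (law M G). 0 < h s x \<longrightarrow> gap \<tau> (cell b s) x \<le> 0"
    by (rule limit_response_densities[where b = b, OF L[rule_format] small types Nash[rule_format] mix b(2)], assumption, assumption)
      (rule that)
  have lawG: "meas (law M G) = distr M borel G" by (rule meas_law[OF M(1) Gm])
  define \<phi> where "\<phi> s i = h s (G i)" for s i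
  have pull: "AE i in M. P (G i)" if "AE x in meas (law M G). P x" for P
    using that unfolding lawG by (rule AE_distrD[OF Gm])
  have \<phi>m: "\<phi> s \<in> borel_measurable M" for s
    unfolding \<phi>_def by (rule measurable_compose[OF Gm hm])
  have \<phi>01: "0 \<le> \<phi> s i" "\<phi> s i \<le> 1" for s i using h by (simp_all add: \<phi>_def)
  have \<phi>top: "AE i in M. \<phi> [] i = 1" unfolding \<phi>_def by (rule pull[OF top])
  have \<phi>split: "AE i in M. \<phi> s i = \<phi> (True # s) i + \<phi> (False # s) i" for s
    unfolding \<phi>_def by (rule pull[OF split])
  have \<phi>mass: "(\<integral>i. \<phi> s i \<partial>M) = mass \<tau> (cell b s)" for s
    unfolding \<phi>_def mass[symmetric] lawG by (rule integral_distr[OF Gm hm, symmetric])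
  have \<phi>supp: "AE i in M. 0 < \<phi> s i \<longrightarrow> gap \<tau> (cell b s) (G i) \<le> 0" for s
    unfolding \<phi>_def by (rule pull[OF supp])
  have "\<exists>f\<in>borel_measurable M. law M f = \<tau> \<and> (AE i in M. f i \<in> feasible G i \<and>
    (\<forall>a\<in>feasible G i. payoff G i a \<tau> \<le> payoff G i (f i) \<tau>))"
    using assms(2)
  proof
    assume "countable_valued M G"
    then have A: "countable (UNIV :: 'a set)" by (simp add: countable_valued_def)
    show ?thesis
      by (rule pure_selection_countable[where b = b and \<phi> = \<phi>])
        (rule M A b(1) bm \<phi>m \<phi>01 \<phi>top \<phi>split \<phi>mass \<phi>supp)+
  next
    assume ne: "nowhere_equivalent M (game_algebra M G)"
    define F where "F = vimage_algebra (space M) G borel"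
    have F: "subalgebra M F"
      unfolding subalgebra_def F_def
    proof
      show "sets (vimage_algebra (space M) G borel) \<subseteq> sets M"
        using measurable_sets[OF Gm] by (auto simp: sets_vimage_algebra2)
    qed simp
    have "G \<in> measurable F borel" unfolding F_def by (rule measurable_vimage_algebra1) simp
    then have \<phi>F: "\<phi> s \<in> borel_measurable F" for s
      unfolding \<phi>_def by (rule measurable_compose[OF _ hm])
    have "nowhere_equivalent M (sets F)" using ne by (simp add: game_algebra_def F_def)
    note neF = this
    show ?thesis
      by (rule pure_selection_nowhere_equivalent[where b = b and \<phi> = \<phi> and F = F])
        (rule M(1) F neF b(1) bm \<phi>F \<phi>01 \<phi>top \<phi>split \<phi>mass \<phi>supp)+
  qed
  then obtain f where "f \<in> borel_measurable M" "law M f = \<tau>" "AE i in M. f i \<in> feasible G i \<and>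
    (\<forall>a\<in>feasible G i. payoff G i a \<tau> \<le> payoff G i (f i) \<tau>)" by blast
  then show "\<exists>f. pure_Nash M G f \<and> law M f = \<tau>"
    by (intro exI[of _ f]) (auto simp: pure_Nash_def pure_profile_def elim: eventually_mono)
qed

end
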